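(* Let $\mathscr{C}$ be a $2d$-Calabi-Yau $(d+2)$-angulated category that is $K$-linear, Hom-finite and Krull-Schmidt. Let $T$ and $U$ be two basic Oppermann-Thomas cluster tilting objects of $\mathscr{C}$, with $\mathscr{T}=\mathrm{add}(T)$ and $\mathscr{U}=\mathrm{add}(U)$. Then the homomorphisms $$(-1)^d\,\mathrm{Ind}_{\mathscr{U}}\circ\Sigma^d\big|_{K_0^{\mathrm{split}}(\mathscr{T})}: K_0^{\mathrm{split}}(\mathscr{T})\to K_0^{\mathrm{split}}(\mathscr{U}) \quad\text{and}\quad \mathrm{Ind}_{\mathscr{T}}\big|_{K_0^{\mathrm{split}}(\mathscr{U})}: K_0^{\mathrm{split}}(\mathscr{U})\to K_0^{\mathrm{split}}(\mathscr{T})$$ are mutually inverse isomorphisms.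
   Context: Throughout, $K$ is an algebraically closed field and $d$ is a positive integer. **$(d+2)$-angulated categories (Geiss-Keller-Oppermann).** Let $\mathscr{C}$ be an additive category with an automorphism $\Sigma^d$ (not assumed to be the $d$-th power of another functor). A $\Sigma^d$-sequence is a diagram $c^0\xrightarrow{\gamma^0}c^1\xrightarrow{\gamma^1}\cdots\to c^{d+1}\xrightarrow{\gamma^{d+1}}\Sigma^d(c^0)$. A $(d+2)$-angulated category is such a $\mathscr{C}$ together with a class of $\Sigma^d$-sequences, called $(d+2)$-angles, such that: (N1) the class is closed under sums and summands, contains $c\xrightarrow{\mathrm{id}}c\to0\to\cdots\to0\to\Sigma^d(c)$ for each $c$, and each morphism $c^0\to c^1$ is the first morphism of some $(d+2)$-angle; (N2) a $\Sigma^d$-sequence $c^0\xrightarrow{\gamma^0}c^1\xrightarrow{\gamma^1}\cdots\to c^{d+1}\xrightarrow{\gamma^{d+1}}\Sigma^d(c^0)$ is a $(d+2)$-angle if and only if its left rotation $c^1\xrightarrow{\gamma^1}c^2\to\cdots\to c^{d+1}\xrightarrow{\gamma^{d+1}}\Sigma^d(c^0)\xrightarrow{(-1)^d\Sigma^d(\gamma^0)}\Sigma^d(c^1)$ is; (N3) given $(d+2)$-angles $b^\bullet$ and $c^\bullet$ with morphisms $\beta^i,\gamma^i$, and $\varphi^0:b^0\to c^0$, $\varphi^1:b^1\to c^1$ with $\varphi^1\beta^0=\gamma^0\varphi^0$, there are $\varphi^i:b^i\to c^i$ ($2\le i\le d+1$) completing $\varphi^0,\varphi^1,\Sigma^d(\varphi^0)$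 to a morphism of $\Sigma^d$-sequences; (N4) (octahedral axiom) in (N3) the $\varphi^i$ can be chosen so that the mapping cone $b^1\oplus c^0\to b^2\oplus c^1\to\cdots\to\Sigma^d b^0\oplus c^{d+1}\to\Sigma^d b^1\oplus\Sigma^d c^0$, with morphisms $\begin{pmatrix}-\beta^{i+1}&0\\ \varphi^{i+1}&\gamma^i\end{pmatrix}$ for $0\le i\le d$ and last morphism $\begin{pmatrix}-\Sigma^d\beta^0&0\\ \Sigma^d\varphi^0&\gamma^{d+1}\end{pmatrix}$, is a $(d+2)$-angle. $\mathscr{C}$ is $2d$-Calabi-Yau if it has a Serre functor (an auto-equivalence $S$ with isomorphisms $\mathrm{Hom}_{\mathscr{C}}(Y,SX)\cong D\,\mathrm{Hom}_{\mathscr{C}}(X,Y)$ natural in $X,Y$, where $D=\mathrm{Hom}_K(-,K)$) isomorphic to $\Sigma^{2d}:=(\Sigma^d)^2$. **Oppermann-Thomas cluster tilting.** An object $T$ is an Oppermann-Thomas cluster tilting object if, with $\mathscr{T}=\mathrm{add}(T)$: (i) $\mathrm{Hom}_{\mathscr{C}}(\mathscr{T},\Sigma^d\mathscr{T})=0$; (ii) for every $c\in\mathscr{C}$ there is a $(d+2)$-angle $t_d\to t_{d-1}\to\cdots\to t_0\to c\to\Sigma^d(t_d)$ with all $t_i\in\mathscr{T}$. It is basic if its indecomposable summands are pairwise non-isomorphic. **Split Grothendieck group and index.** For an additive category $\mathscr{A}$ (here $\mathscr{C}$, $\mathscr{T}$ or $\mathscr{U}$), $K_0^{\mathrm{split}}(\mathscr{A})$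 is the abelian group generated by the objects of $\mathscr{A}$ modulo the relations $[a]=[a_0]+[a_1]$ whenever $a\cong a_0\oplus a_1$. For $\mathscr{T}=\mathrm{add}(T)$ with $T$ an Oppermann-Thomas cluster tilting object it is free on $[t]$, $t\in\mathrm{Indec}(\mathscr{T})$ (indecomposables up to isomorphism). $K_0^{\mathrm{split}}(\mathscr{T})$ and $K_0^{\mathrm{split}}(\mathscr{U})$ are regarded as subgroups of $K_0^{\mathrm{split}}(\mathscr{C})$. The index of $c\in\mathscr{C}$ is $\mathrm{Ind}_{\mathscr{T}}(c)=\sum_{i=0}^d(-1)^i[t_i]\in K_0^{\mathrm{split}}(\mathscr{T})$ for any $(d+2)$-angle as in (ii); it is well defined. It induces a homomorphism $\mathrm{Ind}_{\mathscr{T}}:K_0^{\mathrm{split}}(\mathscr{C})\to K_0^{\mathrm{split}}(\mathscr{T})$, $[c]\mapsto\mathrm{Ind}_{\mathscr{T}}(c)$, and similarly for $\mathscr{U}$. Also $\Sigma^d$ induces $K_0^{\mathrm{split}}(\mathscr{C})\to K_0^{\mathrm{split}}(\mathscr{C})$, $[x]\mapsto[\Sigma^dx]$. *)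

theory Defs
  imports "HOL-Algebra.Algebraic_Closure" "HOL-Algebra.Free_Abelian_Groups"
begin

section \<open>Additive and linear categories\<close>

text \<open>
  Each \<open>Hom x y\<close> is a record of type \<^typ>\<open>('k, 'm) module\<close>. Only its carrier, addition, zero and
  (in the linear case) scalar multiplication are used; the ring fields \<open>mult\<close> and \<open>one\<close> are
  irrelevant. \<open>g \<cdot>\<^bsub>C\<^esub> f\<close> is "first \<open>f\<close>, then \<open>g\<close>". Different \<open>Hom x y\<close> are required to be disjoint, so that
  composition and functors can act on bare morphisms without loss of generality.
\<close>

record ('o, 'm, 'k) category =
  Obj :: "'o set"
  Hom :: "'o \<Rightarrow> 'o \<Rightarrow> ('k, 'm) module"
  Comp :: "'m \<Rightarrow> 'm \<Rightarrow> 'm"  (infixl "\<cdot>\<index>" 70)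
  Idn :: "'o \<Rightarrow> 'm"

abbreviation mor :: "('o, 'm, 'k) category \<Rightarrow> 'o \<Rightarrow> 'o \<Rightarrow> 'm set" where
  "mor C x y \<equiv> carrier (Hom C x y)"

definition zero_object :: "('o, 'm, 'k) category \<Rightarrow> 'o \<Rightarrow> bool" where
  "zero_object C z \<longleftrightarrow> z \<in> Obj C \<and>
     (\<forall>x \<in> Obj C. (\<exists>!f. f \<in> mor C x z) \<and> (\<exists>!f. f \<in> mor C z x))"

definition biproduct ::
  "('o, 'm, 'k) category \<Rightarrow> 'o \<Rightarrow> 'o \<Rightarrow> 'o \<Rightarrow> 'm \<Rightarrow> 'm \<Rightarrow> 'm \<Rightarrow> 'm \<Rightarrow> bool" where
  "biproduct C x A B i j p q \<longleftrightarrow>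
     x \<in> Obj C \<and> A \<in> Obj C \<and> B \<in> Obj C \<and>
     i \<in> mor C A x \<and> j \<in> mor C B x \<and> p \<in> mor C x A \<and> q \<in> mor C x B \<and>
     p \<cdot>\<^bsub>C\<^esub> i = Idn C A \<and> q \<cdot>\<^bsub>C\<^esub> j = Idn C B \<and>
     q \<cdot>\<^bsub>C\<^esub> i = \<zero>\<^bsub>Hom C A B\<^esub> \<and> p \<cdot>\<^bsub>C\<^esub> j = \<zero>\<^bsub>Hom C B A\<^esub> \<and>
     (i \<cdot>\<^bsub>C\<^esub> p) \<oplus>\<^bsub>Hom C x x\<^esub> (j \<cdot>\<^bsub>C\<^esub> q) = Idn C x"

text \<open>\<open>x \<cong> A \<oplus> B\<close>.\<close>

definition is_sum :: "('o, 'm, 'k) category \<Rightarrow> 'o \<Rightarrow> 'o \<Rightarrow> 'o \<Rightarrow> bool" where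
  "is_sum C x A B \<longleftrightarrow> (\<exists>i j p q. biproduct C x A B i j p q)"

text \<open>\<open>x \<cong> y\<^sub>0 \<oplus> \<dots> \<oplus> y\<^sub>n\<^sub>-\<^sub>1\<close>, where \<open>ys = [y\<^sub>0, \<dots>, y\<^sub>n\<^sub>-\<^sub>1]\<close>; for \<open>n = 0\<close> this says that \<open>x\<close> is zero.\<close>

definition is_direct_sum :: "('o, 'm, 'k) category \<Rightarrow> 'o \<Rightarrow> 'o list \<Rightarrow> bool" where
  "is_direct_sum C x ys \<longleftrightarrow> x \<in> Obj C \<and> set ys \<subseteq> Obj C \<and>
     (\<exists>i p :: nat \<Rightarrow> 'm.
        (\<forall>k < length ys. i k \<in> mor C (ys ! k) x \<and> p k \<in> mor C x (ys ! k)) \<and>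
        (\<forall>k < length ys. \<forall>l < length ys.
           p l \<cdot>\<^bsub>C\<^esub> i k = (if k = l then Idn C (ys ! k) else \<zero>\<^bsub>Hom C (ys ! k) (ys ! l)\<^esub>)) \<and>
        finsum (Hom C x x) (\<lambda>k. i k \<cdot>\<^bsub>C\<^esub> p k) {..<length ys} = Idn C x)"

locale additive_category =
  fixes C :: "('o, 'm, 'k) category" (structure)
  assumes hom_group: "\<lbrakk>x \<in> Obj C; y \<in> Obj C\<rbrakk> \<Longrightarrow> abelian_group (Hom C x y)"
    and hom_disjoint:
      "\<lbrakk>x \<in> Obj C; y \<in> Obj C; x' \<in> Obj C; y' \<in> Obj C; f \<in> mor C x y; f \<in> mor C x' y'\<rbrakk>
       \<Longrightarrow> x = x' \<and> y = y'"
    and comp_closed: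
      "\<lbrakk>x \<in> Obj C; y \<in> Obj C; z \<in> Obj C; f \<in> mor C x y; g \<in> mor C y z\<rbrakk>
       \<Longrightarrow> g \<cdot> f \<in> mor C x z"
    and comp_assoc:
      "\<lbrakk>w \<in> Obj C; x \<in> Obj C; y \<in> Obj C; z \<in> Obj C;
        f \<in> mor C w x; g \<in> mor C x y; h \<in> mor C y z\<rbrakk>
       \<Longrightarrow> (h \<cdot> g) \<cdot> f = h \<cdot> (g \<cdot> f)"
    and id_closed: "x \<in> Obj C \<Longrightarrow> Idn C x \<in> mor C x x"
    and id_left: "\<lbrakk>x \<in> Obj C; y \<in> Obj C; f \<in> mor C x y\<rbrakk> \<Longrightarrow> Idn C y \<cdot> f = f"
    and id_right: "\<lbrakk>x \<in> Obj C; y \<in> Obj C; f \<in> mor C x y\<rbrakk> \<Longrightarrow> f \<cdot> Idn C x = f"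
    and comp_add_left:
      "\<lbrakk>x \<in> Obj C; y \<in> Obj C; z \<in> Obj C; f \<in> mor C x y; g \<in> mor C y z; h \<in> mor C y z\<rbrakk>
       \<Longrightarrow> (g \<oplus>\<^bsub>Hom C y z\<^esub> h) \<cdot> f = (g \<cdot> f) \<oplus>\<^bsub>Hom C x z\<^esub> (h \<cdot> f)"
    and comp_add_right:
      "\<lbrakk>x \<in> Obj C; y \<in> Obj C; z \<in> Obj C; f \<in> mor C x y; g \<in> mor C x y; h \<in> mor C y z\<rbrakk>
       \<Longrightarrow> h \<cdot> (f \<oplus>\<^bsub>Hom C x y\<^esub> g) = (h \<cdot> f) \<oplus>\<^bsub>Hom C x z\<^esub> (h \<cdot> g)"
    and ex_zero_object: "\<exists>z. zero_object C z"
    and ex_biproduct: "\<lbrakk>A \<in> Obj C; B \<in> Obj C\<rbrakk> \<Longrightarrow> \<exists>x. is_sum C x A B"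

locale linear_category = additive_category C
  for K :: "('k, 'z) ring_scheme" and C :: "('o, 'm, 'k) category" (structure) +
  assumes hom_module: "\<lbrakk>x \<in> Obj C; y \<in> Obj C\<rbrakk> \<Longrightarrow> Module.module K (Hom C x y)"
    and comp_smult_left:
      "\<lbrakk>x \<in> Obj C; y \<in> Obj C; z \<in> Obj C; f \<in> mor C x y; g \<in> mor C y z; a \<in> carrier K\<rbrakk>
       \<Longrightarrow> (a \<odot>\<^bsub>Hom C y z\<^esub> g) \<cdot> f = a \<odot>\<^bsub>Hom C x z\<^esub> (g \<cdot> f)"
    and comp_smult_right:
      "\<lbrakk>x \<in> Obj C; y \<in> Obj C; z \<in> Obj C; f \<in> mor C x y; g \<in> mor C y z; a \<in> carrier K\<rbrakk>
       \<Longrightarrow> g \<cdot> (a \<odot>\<^bsub>Hom C x y\<^esub> f) = a \<odot>\<^bsub>Hom C x z\<^esub> (g \<cdot> f)"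

definition finite_dimensional :: "('k, 'z) ring_scheme \<Rightarrow> ('k, 'v) module \<Rightarrow> bool" where
  "finite_dimensional K V \<longleftrightarrow>
     (\<exists>B. finite B \<and> B \<subseteq> carrier V \<and>
        (\<forall>v \<in> carrier V. \<exists>a \<in> B \<rightarrow> carrier K. v = finsum V (\<lambda>b. a b \<odot>\<^bsub>V\<^esub> b) B))"

definition hom_finite :: "('k, 'z) ring_scheme \<Rightarrow> ('o, 'm, 'k) category \<Rightarrow> bool" where
  "hom_finite K C \<longleftrightarrow> (\<forall>x \<in> Obj C. \<forall>y \<in> Obj C. finite_dimensional K (Hom C x y))"

definition End_ring :: "('o, 'm, 'k) category \<Rightarrow> 'o \<Rightarrow> 'm ring" where
  "End_ring C x = \<lparr>carrier = mor C x x, monoid.mult = Comp C, one = Idn C x,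
     ring.zero = \<zero>\<^bsub>Hom C x x\<^esub>, ring.add = (\<oplus>\<^bsub>Hom C x x\<^esub>)\<rparr>"

text \<open>Locality for rings that need not be commutative: the sum of two non-units is a non-unit.\<close>

definition local_ring :: "'m ring \<Rightarrow> bool" where
  "local_ring R \<longleftrightarrow> ring R \<and> \<one>\<^bsub>R\<^esub> \<noteq> \<zero>\<^bsub>R\<^esub> \<and>
     (\<forall>a \<in> carrier R - Units R. \<forall>b \<in> carrier R - Units R. a \<oplus>\<^bsub>R\<^esub> b \<notin> Units R)"

definition krull_schmidt :: "('o, 'm, 'k) category \<Rightarrow> bool" where
  "krull_schmidt C \<longleftrightarrow>
     (\<forall>x \<in> Obj C. \<exists>ys. is_direct_sum C x ys \<and> (\<forall>y \<in> set ys. local_ring (End_ring C y)))"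

definition iso_mor :: "('o, 'm, 'k) category \<Rightarrow> 'o \<Rightarrow> 'o \<Rightarrow> 'm \<Rightarrow> bool" where
  "iso_mor C x y f \<longleftrightarrow>
     f \<in> mor C x y \<and> (\<exists>g \<in> mor C y x. g \<cdot>\<^bsub>C\<^esub> f = Idn C x \<and> f \<cdot>\<^bsub>C\<^esub> g = Idn C y)"

definition iso_obj :: "('o, 'm, 'k) category \<Rightarrow> 'o \<Rightarrow> 'o \<Rightarrow> bool" where
  "iso_obj C x y \<longleftrightarrow> x \<in> Obj C \<and> y \<in> Obj C \<and> (\<exists>f. iso_mor C x y f)"

definition indecomposable :: "('o, 'm, 'k) category \<Rightarrow> 'o \<Rightarrow> bool" where
  "indecomposable C x \<longleftrightarrow> x \<in> Obj C \<and> \<not> zero_object C x \<and>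
     (\<forall>A B. is_sum C x A B \<longrightarrow> zero_object C A \<or> zero_object C B)"

definition basic_object :: "('o, 'm, 'k) category \<Rightarrow> 'o \<Rightarrow> bool" where
  "basic_object C x \<longleftrightarrow>
     (\<forall>ys. is_direct_sum C x ys \<and> (\<forall>y \<in> set ys. indecomposable C y) \<longrightarrow>
        (\<forall>k < length ys. \<forall>l < length ys. k \<noteq> l \<longrightarrow> \<not> iso_obj C (ys ! k) (ys ! l)))"

text \<open>The objects of the full subcategory \<open>add(T)\<close>: direct summands of finite direct sums of copies of \<open>T\<close>.\<close>

definition add_closure :: "('o, 'm, 'k) category \<Rightarrow> 'o \<Rightarrow> 'o set" where
  "add_closure C T = {x. \<exists>n y z. is_direct_sum C z (replicate n T) \<and> is_sum C z x y}"


section \<open>Functors\<close>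

record ('o, 'm) endofunctor =
  fobj :: "'o \<Rightarrow> 'o"
  fmor :: "'m \<Rightarrow> 'm"

definition is_functor :: "('o, 'm, 'k) category \<Rightarrow> ('o, 'm) endofunctor \<Rightarrow> bool" where
  "is_functor C F \<longleftrightarrow>
     (\<forall>x \<in> Obj C. fobj F x \<in> Obj C \<and> fmor F (Idn C x) = Idn C (fobj F x)) \<and>
     (\<forall>x \<in> Obj C. \<forall>y \<in> Obj C. \<forall>f \<in> mor C x y. fmor F f \<in> mor C (fobj F x) (fobj F y)) \<and>
     (\<forall>x \<in> Obj C. \<forall>y \<in> Obj C. \<forall>z \<in> Obj C. \<forall>f \<in> mor C x y. \<forall>g \<in> mor C y z.
        fmor F (g \<cdot>\<^bsub>C\<^esub> f) = fmor F g \<cdot>\<^bsub>C\<^esub> fmor F f)"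

definition additive_functor :: "('o, 'm, 'k) category \<Rightarrow> ('o, 'm) endofunctor \<Rightarrow> bool" where
  "additive_functor C F \<longleftrightarrow> is_functor C F \<and>
     (\<forall>x \<in> Obj C. \<forall>y \<in> Obj C. \<forall>f \<in> mor C x y. \<forall>g \<in> mor C x y.
        fmor F (f \<oplus>\<^bsub>Hom C x y\<^esub> g) = fmor F f \<oplus>\<^bsub>Hom C (fobj F x) (fobj F y)\<^esub> fmor F g)"

definition id_functor :: "('o, 'm) endofunctor" where
  "id_functor = \<lparr>fobj = (\<lambda>x. x), fmor = (\<lambda>f. f)\<rparr>"

definition comp_functor ::
  "('o, 'm) endofunctor \<Rightarrow> ('o, 'm) endofunctor \<Rightarrow> ('o, 'm) endofunctor" where
  "comp_functor G F = \<lparr>fobj = fobj G \<circ> fobj F, fmor = fmor G \<circ> fmor F\<rparr>"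

definition eq_functor ::
  "('o, 'm, 'k) category \<Rightarrow> ('o, 'm) endofunctor \<Rightarrow> ('o, 'm) endofunctor \<Rightarrow> bool" where
  "eq_functor C F G \<longleftrightarrow>
     (\<forall>x \<in> Obj C. fobj F x = fobj G x) \<and>
     (\<forall>x \<in> Obj C. \<forall>y \<in> Obj C. \<forall>f \<in> mor C x y. fmor F f = fmor G f)"

definition iso_functor ::
  "('o, 'm, 'k) category \<Rightarrow> ('o, 'm) endofunctor \<Rightarrow> ('o, 'm) endofunctor \<Rightarrow> bool" where
  "iso_functor C F G \<longleftrightarrow>
     (\<exists>\<eta>. (\<forall>x \<in> Obj C. iso_mor C (fobj F x) (fobj G x) (\<eta> x)) \<and>
          (\<forall>x \<in> Obj C. \<forall>y \<in> Obj C. \<forall>f \<in> mor C x y.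
             \<eta> y \<cdot>\<^bsub>C\<^esub> fmor F f = fmor G f \<cdot>\<^bsub>C\<^esub> \<eta> x))"

definition automorphism :: "('o, 'm, 'k) category \<Rightarrow> ('o, 'm) endofunctor \<Rightarrow> bool" where
  "automorphism C F \<longleftrightarrow> additive_functor C F \<and>
     (\<exists>G. additive_functor C G \<and> eq_functor C (comp_functor G F) id_functor \<and>
          eq_functor C (comp_functor F G) id_functor)"

definition autoequivalence :: "('o, 'm, 'k) category \<Rightarrow> ('o, 'm) endofunctor \<Rightarrow> bool" where
  "autoequivalence C F \<longleftrightarrow> is_functor C F \<and>
     (\<exists>G. is_functor C G \<and> iso_functor C (comp_functor G F) id_functor \<and>
          iso_functor C (comp_functor F G) id_functor)"

definition dual_space :: "('k, 'z) ring_scheme \<Rightarrow> ('k, 'v) module \<Rightarrow> ('k, 'v \<Rightarrow> 'k) module" where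
  "dual_space K V =
     \<lparr>carrier = {\<phi> \<in> carrier V \<rightarrow>\<^sub>E carrier K.
        (\<forall>v \<in> carrier V. \<forall>w \<in> carrier V. \<phi> (v \<oplus>\<^bsub>V\<^esub> w) = \<phi> v \<oplus>\<^bsub>K\<^esub> \<phi> w) \<and>
        (\<forall>a \<in> carrier K. \<forall>v \<in> carrier V. \<phi> (a \<odot>\<^bsub>V\<^esub> v) = a \<otimes>\<^bsub>K\<^esub> \<phi> v)},
      monoid.mult = undefined, one = undefined,
      ring.zero = (\<lambda>v \<in> carrier V. \<zero>\<^bsub>K\<^esub>),
      ring.add = (\<lambda>\<phi> \<psi>. \<lambda>v \<in> carrier V. \<phi> v \<oplus>\<^bsub>K\<^esub> \<psi> v),
      module.smult = (\<lambda>a \<phi>. \<lambda>v \<in> carrier V. a \<otimes>\<^bsub>K\<^esub> \<phi> v)\<rparr>"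

definition linear_iso ::
  "('k, 'z) ring_scheme \<Rightarrow> ('k, 'v) module \<Rightarrow> ('k, 'w) module \<Rightarrow> ('v \<Rightarrow> 'w) \<Rightarrow> bool" where
  "linear_iso K V W h \<longleftrightarrow> bij_betw h (carrier V) (carrier W) \<and>
     (\<forall>v \<in> carrier V. \<forall>w \<in> carrier V. h (v \<oplus>\<^bsub>V\<^esub> w) = h v \<oplus>\<^bsub>W\<^esub> h w) \<and>
     (\<forall>a \<in> carrier K. \<forall>v \<in> carrier V. h (a \<odot>\<^bsub>V\<^esub> v) = a \<odot>\<^bsub>W\<^esub> h v)"

text \<open>
  \<open>\<eta> x y : Hom(y, S x) \<rightarrow> D Hom(x, y)\<close>. Both sides are covariant in \<open>x\<close> and contravariant in \<open>y\<close>; the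
  last clause is naturality with respect to \<open>b : x \<rightarrow> x'\<close> and \<open>a : y' \<rightarrow> y\<close>.
\<close>

definition serre_functor ::
  "('k, 'z) ring_scheme \<Rightarrow> ('o, 'm, 'k) category \<Rightarrow> ('o, 'm) endofunctor \<Rightarrow> bool" where
  "serre_functor K C S \<longleftrightarrow> autoequivalence C S \<and>
     (\<exists>\<eta> :: 'o \<Rightarrow> 'o \<Rightarrow> 'm \<Rightarrow> 'm \<Rightarrow> 'k.
        (\<forall>x \<in> Obj C. \<forall>y \<in> Obj C.
           linear_iso K (Hom C y (fobj S x)) (dual_space K (Hom C x y)) (\<eta> x y)) \<and>
        (\<forall>x \<in> Obj C. \<forall>x' \<in> Obj C. \<forall>y \<in> Obj C. \<forall>y' \<in> Obj C.
         \<forall>b \<in> mor C x x'. \<forall>a \<in> mor C y' y. \<forall>h \<in> mor C y (fobj S x). \<forall>f \<in> mor C x' y'.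
           \<eta> x' y' (fmor S b \<cdot>\<^bsub>C\<^esub> h \<cdot>\<^bsub>C\<^esub> a) f = \<eta> x y h (a \<cdot>\<^bsub>C\<^esub> f \<cdot>\<^bsub>C\<^esub> b)))"

text \<open>With \<open>F = \<Sigma>\<^sup>d\<close> this is the \<open>2d\<close>-Calabi-Yau property.\<close>

definition calabi_yau ::
  "('k, 'z) ring_scheme \<Rightarrow> ('o, 'm, 'k) category \<Rightarrow> ('o, 'm) endofunctor \<Rightarrow> bool" where
  "calabi_yau K C F \<longleftrightarrow> (\<exists>S. serre_functor K C S \<and> iso_functor C S (comp_functor F F))"


section \<open>Higher angulated categories\<close>

text \<open>
  From here on, \<open>F\<close> is the automorphism \<open>\<Sigma>\<^sup>d\<close>. A \<open>\<Sigma>\<^sup>d\<close>-sequence is stored as its objects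
  \<open>[c\<^sup>0, \<dots>, c\<^sup>d\<^sup>+\<^sup>1]\<close> and its morphisms \<open>[\<gamma>\<^sup>0, \<dots>, \<gamma>\<^sup>d\<^sup>+\<^sup>1]\<close>. The object at position \<open>d + 2\<close> is
  \<open>\<Sigma>\<^sup>d c\<^sup>0\<close>, and lists of morphisms are likewise continued by \<open>\<Sigma>\<^sup>d\<close> of their head.
\<close>

record ('o, 'm) sequence =
  objs :: "'o list"
  mors :: "'m list"

definition xobj :: "('o, 'm) endofunctor \<Rightarrow> ('o, 'm) sequence \<Rightarrow> nat \<Rightarrow> 'o" where
  "xobj F s k = (objs s @ [fobj F (hd (objs s))]) ! k"

definition xmor :: "('o, 'm) endofunctor \<Rightarrow> 'm list \<Rightarrow> nat \<Rightarrow> 'm" where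
  "xmor F fs k = (fs @ [fmor F (hd fs)]) ! k"

definition is_sequence ::
  "('o, 'm, 'k) category \<Rightarrow> ('o, 'm) endofunctor \<Rightarrow> nat \<Rightarrow> ('o, 'm) sequence \<Rightarrow> bool" where
  "is_sequence C F d s \<longleftrightarrow>
     length (objs s) = d + 2 \<and> length (mors s) = d + 2 \<and> set (objs s) \<subseteq> Obj C \<and>
     (\<forall>k < d + 2. mors s ! k \<in> mor C (xobj F s k) (xobj F s (k + 1)))"

definition is_sequence_mor ::
  "('o, 'm, 'k) category \<Rightarrow> ('o, 'm) endofunctor \<Rightarrow> nat \<Rightarrow>
   ('o, 'm) sequence \<Rightarrow> ('o, 'm) sequence \<Rightarrow> 'm list \<Rightarrow> bool" where
  "is_sequence_mor C F d b c \<phi> \<longleftrightarrow> length \<phi> = d + 2 \<and>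
     (\<forall>k < d + 2. \<phi> ! k \<in> mor C (objs b ! k) (objs c ! k)) \<and>
     (\<forall>k < d + 2. xmor F \<phi> (k + 1) \<cdot>\<^bsub>C\<^esub> (mors b ! k) = (mors c ! k) \<cdot>\<^bsub>C\<^esub> (\<phi> ! k))"

text \<open>\<open>s\<close> is a direct sum of \<open>a\<close> and \<open>b\<close> in the category of \<open>\<Sigma>\<^sup>d\<close>-sequences.\<close>

definition is_sequence_sum ::
  "('o, 'm, 'k) category \<Rightarrow> ('o, 'm) endofunctor \<Rightarrow> nat \<Rightarrow>
   ('o, 'm) sequence \<Rightarrow> ('o, 'm) sequence \<Rightarrow> ('o, 'm) sequence \<Rightarrow> bool" where
  "is_sequence_sum C F d s a b \<longleftrightarrow>
     is_sequence C F d s \<and> is_sequence C F d a \<and> is_sequence C F d b \<and>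
     (\<exists>i j p q.
        is_sequence_mor C F d a s i \<and> is_sequence_mor C F d b s j \<and>
        is_sequence_mor C F d s a p \<and> is_sequence_mor C F d s b q \<and>
        (\<forall>k < d + 2. biproduct C (objs s ! k) (objs a ! k) (objs b ! k)
                       (i ! k) (j ! k) (p ! k) (q ! k)))"

definition trivial_sequence ::
  "('o, 'm, 'k) category \<Rightarrow> ('o, 'm) endofunctor \<Rightarrow> nat \<Rightarrow> 'o \<Rightarrow> 'o \<Rightarrow> ('o, 'm) sequence" where
  "trivial_sequence C F d c z =
     (let cs = c # c # replicate d z in
      \<lparr>objs = cs,
       mors = Idn C c # map (\<lambda>k. \<zero>\<^bsub>Hom C ((cs @ [fobj F c]) ! k) ((cs @ [fobj F c]) ! (k + 1))\<^esub>) [1..<d + 2]\<rparr>)"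

definition left_rotation ::
  "('o, 'm, 'k) category \<Rightarrow> ('o, 'm) endofunctor \<Rightarrow> nat \<Rightarrow>
   ('o, 'm) sequence \<Rightarrow> ('o, 'm) sequence" where
  "left_rotation C F d s =
     \<lparr>objs = tl (objs s) @ [fobj F (objs s ! 0)],
      mors = tl (mors s) @
        [add_pow (Hom C (fobj F (objs s ! 0)) (fobj F (objs s ! 1))) ((-1) ^ d :: int)
           (fmor F (mors s ! 0))]\<rparr>"

text \<open>
  \<open>e\<close> is a mapping cone of \<open>\<phi> : b \<rightarrow> c\<close>, for some choice of the biproducts
  \<open>e\<^sup>k = b\<^sup>k\<^sup>+\<^sup>1 \<oplus> c\<^sup>k\<close> (\<open>0 \<le> k \<le> d + 1\<close>, with \<open>b\<^sup>d\<^sup>+\<^sup>2 = \<Sigma>\<^sup>d b\<^sup>0\<close>). Its \<open>k\<close>-th morphism is the matrix with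
  rows \<open>(- \<beta>\<^sup>k\<^sup>+\<^sup>1, 0)\<close> and \<open>(\<phi>\<^sup>k\<^sup>+\<^sup>1, \<gamma>\<^sup>k)\<close>, where \<open>\<beta>\<^sup>d\<^sup>+\<^sup>2 = \<Sigma>\<^sup>d \<beta>\<^sup>0\<close> and \<open>\<phi>\<^sup>d\<^sup>+\<^sup>2 = \<Sigma>\<^sup>d \<phi>\<^sup>0\<close>. The target
  \<open>\<Sigma>\<^sup>d e\<^sup>0\<close> of the last one is identified with \<open>\<Sigma>\<^sup>d b\<^sup>1 \<oplus> \<Sigma>\<^sup>d c\<^sup>0\<close> by means of \<open>\<Sigma>\<^sup>d\<close> of the biproduct
  structure on \<open>e\<^sup>0\<close>. Mapping cones for different choices are isomorphic, and the class of angles below is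
  closed under isomorphism, because an isomorphic copy of \<open>s\<close> is a sum of \<open>s\<close> and a zero sequence.
\<close>

definition is_mapping_cone ::
  "('o, 'm, 'k) category \<Rightarrow> ('o, 'm) endofunctor \<Rightarrow> nat \<Rightarrow>
   ('o, 'm) sequence \<Rightarrow> ('o, 'm) sequence \<Rightarrow> 'm list \<Rightarrow> ('o, 'm) sequence \<Rightarrow> bool" where
  "is_mapping_cone C F d b c \<phi> e \<longleftrightarrow> is_sequence C F d e \<and>
     (\<exists>i j p q. length i = d + 2 \<and> length j = d + 2 \<and> length p = d + 2 \<and> length q = d + 2 \<and>
        (\<forall>k < d + 2. biproduct C (objs e ! k) (xobj F b (k + 1)) (objs c ! k)
                       (i ! k) (j ! k) (p ! k) (q ! k)) \<and>
        (\<forall>k < d + 2. let H = Hom C (xobj F e k) (xobj F e (k + 1)) in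
           mors e ! k =
             (\<ominus>\<^bsub>H\<^esub> (xmor F i (k + 1) \<cdot>\<^bsub>C\<^esub> xmor F (mors b) (k + 1) \<cdot>\<^bsub>C\<^esub> (p ! k)))
             \<oplus>\<^bsub>H\<^esub> (xmor F j (k + 1) \<cdot>\<^bsub>C\<^esub> xmor F \<phi> (k + 1) \<cdot>\<^bsub>C\<^esub> (p ! k))
             \<oplus>\<^bsub>H\<^esub> (xmor F j (k + 1) \<cdot>\<^bsub>C\<^esub> (mors c ! k) \<cdot>\<^bsub>C\<^esub> (q ! k))))"

locale angulated_category = additive_category C
  for C :: "('o, 'm, 'k) category" (structure)
    and F :: "('o, 'm) endofunctor"
    and d :: nat
    and Angles :: "('o, 'm) sequence set" +
  assumes d_pos: "0 < d"
    and shift: "automorphism C F"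
    and angle_sequence: "s \<in> Angles \<Longrightarrow> is_sequence C F d s"
    and N1_sum: "\<lbrakk>a \<in> Angles; b \<in> Angles; is_sequence_sum C F d s a b\<rbrakk> \<Longrightarrow> s \<in> Angles"
    and N1_summand: "\<lbrakk>s \<in> Angles; is_sequence_sum C F d s a b\<rbrakk> \<Longrightarrow> a \<in> Angles \<and> b \<in> Angles"
    and N1_trivial: "\<lbrakk>c0 \<in> Obj C; zero_object C z\<rbrakk> \<Longrightarrow> trivial_sequence C F d c0 z \<in> Angles"
    and N1_first: "\<lbrakk>c0 \<in> Obj C; c1 \<in> Obj C; f \<in> mor C c0 c1\<rbrakk> \<Longrightarrow>
      \<exists>s \<in> Angles. objs s ! 0 = c0 \<and> objs s ! 1 = c1 \<and> mors s ! 0 = f"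
    and N2: "is_sequence C F d s \<Longrightarrow> s \<in> Angles \<longleftrightarrow> left_rotation C F d s \<in> Angles"
    and N3: "\<lbrakk>b \<in> Angles; c \<in> Angles;
        f0 \<in> mor C (objs b ! 0) (objs c ! 0); f1 \<in> mor C (objs b ! 1) (objs c ! 1);
        f1 \<cdot> (mors b ! 0) = (mors c ! 0) \<cdot> f0\<rbrakk> \<Longrightarrow>
      \<exists>\<phi>. is_sequence_mor C F d b c \<phi> \<and> \<phi> ! 0 = f0 \<and> \<phi> ! 1 = f1"
    and N4: "\<lbrakk>b \<in> Angles; c \<in> Angles;
        f0 \<in> mor C (objs b ! 0) (objs c ! 0); f1 \<in> mor C (objs b ! 1) (objs c ! 1);
        f1 \<cdot> (mors b ! 0) = (mors c ! 0) \<cdot> f0\<rbrakk> \<Longrightarrow>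
      \<exists>\<phi>. is_sequence_mor C F d b c \<phi> \<and> \<phi> ! 0 = f0 \<and> \<phi> ! 1 = f1 \<and>
          (\<exists>e \<in> Angles. is_mapping_cone C F d b c \<phi> e)"


section \<open>Oppermann-Thomas cluster tilting objects\<close>

text \<open>\<open>s\<close> is a \<open>(d+2)\<close>-angle \<open>t\<^sub>d \<rightarrow> \<dots> \<rightarrow> t\<^sub>0 \<rightarrow> c \<rightarrow> \<Sigma>\<^sup>d t\<^sub>d\<close> with all \<open>t\<^sub>i\<close> in \<open>add(T)\<close>.\<close>

definition is_resolution ::
  "('o, 'm, 'k) category \<Rightarrow> nat \<Rightarrow> ('o, 'm) sequence set \<Rightarrow> 'o \<Rightarrow> 'o \<Rightarrow>
   (nat \<Rightarrow> 'o) \<Rightarrow> ('o, 'm) sequence \<Rightarrow> bool" where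
  "is_resolution C d Angles T c t s \<longleftrightarrow>
     s \<in> Angles \<and> objs s = map t (rev [0..<Suc d]) @ [c] \<and> (\<forall>i \<le> d. t i \<in> add_closure C T)"

definition cluster_tilting ::
  "('o, 'm, 'k) category \<Rightarrow> ('o, 'm) endofunctor \<Rightarrow> nat \<Rightarrow> ('o, 'm) sequence set \<Rightarrow> 'o \<Rightarrow> bool" where
  "cluster_tilting C F d Angles T \<longleftrightarrow> T \<in> Obj C \<and>
     (\<forall>x \<in> add_closure C T. \<forall>y \<in> add_closure C T.
        mor C x (fobj F y) = {\<zero>\<^bsub>Hom C x (fobj F y)\<^esub>}) \<and>
     (\<forall>c \<in> Obj C. \<exists>t s. is_resolution C d Angles T c t s)"


section \<open>Split Grothendieck groups and the index\<close>

text \<open>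
  \<open>A\<close> is the set of objects of a full additive subcategory. The groups are written multiplicatively,
  so integral multiples appear as powers.
\<close>

definition K0_relations :: "('o, 'm, 'k) category \<Rightarrow> 'o set \<Rightarrow> ('o \<Rightarrow>\<^sub>0 int) set" where
  "K0_relations C A =
     generate (free_Abelian_group A)
       {frag_of a - (frag_of a0 + frag_of a1) | a a0 a1.
          a \<in> A \<and> a0 \<in> A \<and> a1 \<in> A \<and> is_sum C a a0 a1}"

definition K0 :: "('o, 'm, 'k) category \<Rightarrow> 'o set \<Rightarrow> ('o \<Rightarrow>\<^sub>0 int) set monoid" where
  "K0 C A = free_Abelian_group A Mod K0_relations C A"

definition K0_class :: "('o, 'm, 'k) category \<Rightarrow> 'o set \<Rightarrow> 'o \<Rightarrow> ('o \<Rightarrow>\<^sub>0 int) set" where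
  "K0_class C A a = K0_relations C A #>\<^bsub>free_Abelian_group A\<^esub> frag_of a"

text \<open>The homomorphism from \<open>K0 C A\<close> to \<open>G\<close> induced by \<open>[a] \<mapsto> h a\<close>.\<close>

definition K0_induced ::
  "('o, 'm, 'k) category \<Rightarrow> 'o set \<Rightarrow> 'g monoid \<Rightarrow> ('o \<Rightarrow> 'g) \<Rightarrow> ('o \<Rightarrow>\<^sub>0 int) set \<Rightarrow> 'g" where
  "K0_induced C A G h =
     (THE \<Phi>. \<Phi> \<in> hom (K0 C A) G \<and> \<Phi> \<in> extensional (carrier (K0 C A)) \<and>
             (\<forall>a \<in> A. \<Phi> (K0_class C A a) = h a))"

text \<open>The map \<open>[a] \<mapsto> [a]\<close> by which \<open>K0 C A\<close> is regarded as a subgroup of \<open>K0 C (Obj C)\<close>.\<close>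

definition K0_incl ::
  "('o, 'm, 'k) category \<Rightarrow> 'o set \<Rightarrow> ('o \<Rightarrow>\<^sub>0 int) set \<Rightarrow> ('o \<Rightarrow>\<^sub>0 int) set" where
  "K0_incl C A = K0_induced C A (K0 C (Obj C)) (K0_class C (Obj C))"

definition K0_shift ::
  "('o, 'm, 'k) category \<Rightarrow> ('o, 'm) endofunctor \<Rightarrow> ('o \<Rightarrow>\<^sub>0 int) set \<Rightarrow> ('o \<Rightarrow>\<^sub>0 int) set" where
  "K0_shift C F =
     K0_induced C (Obj C) (K0 C (Obj C)) (\<lambda>x. K0_class C (Obj C) (fobj F x))"

definition obj_index ::
  "('o, 'm, 'k) category \<Rightarrow> nat \<Rightarrow> ('o, 'm) sequence set \<Rightarrow> 'o \<Rightarrow> 'o \<Rightarrow> ('o \<Rightarrow>\<^sub>0 int) set" where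
  "obj_index C d Angles T c =
     (let A = add_closure C T; G = K0 C A in
      THE x. \<exists>t s. is_resolution C d Angles T c t s \<and>
        x = finprod G (\<lambda>i. K0_class C A (t i) [^]\<^bsub>G\<^esub> ((-1) ^ i :: int)) {..d})"

definition Ind ::
  "('o, 'm, 'k) category \<Rightarrow> nat \<Rightarrow> ('o, 'm) sequence set \<Rightarrow> 'o \<Rightarrow>
   ('o \<Rightarrow>\<^sub>0 int) set \<Rightarrow> ('o \<Rightarrow>\<^sub>0 int) set" where
  "Ind C d Angles T =
     K0_induced C (Obj C) (K0 C (add_closure C T)) (obj_index C d Angles T)"

end

theory Submission
  imports Defs
begin

text \<open>
  The whole argument rests on the cone of a morphism of \<open>(d+2)\<close>-angles \<open>b \<rightarrow> c\<close> that is an isomorphism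
  \<open>b\<^sup>d\<^sup>+\<^sup>1 \<cong> c\<^sup>d\<^sup>+\<^sup>1\<close>: after cancelling this summand it is an angle
  \<open>b\<^sup>0 \<rightarrow> b\<^sup>1 \<oplus> c\<^sup>0 \<rightarrow> \<dots> \<rightarrow> b\<^sup>d \<oplus> c\<^sup>d\<^sup>-\<^sup>1 \<rightarrow> c\<^sup>d\<close>, and such a morphism exists as soon as
  \<open>Hom(b\<^sup>d, \<Sigma>\<^sup>d c\<^sup>0) = 0\<close>. Coning with trivial angles shows that the alternating sum of the objects of an
  angle in \<open>add(T)\<close> vanishes in the split Grothendieck group; coning two resolutions of the same object
  then shows that the index is well defined; and coning with resolutions shows that the index is
  additive on every angle whose first object is in \<open>add(T)\<close>.

  A \<open>T\<close>-resolution of \<open>u \<in> add(U)\<close> rotates to an angle \<open>u \<rightarrow> \<Sigma>\<^sup>d t\<^sub>d \<rightarrow> \<dots> \<rightarrow> \<Sigma>\<^sup>d t\<^sub>0\<close>, on which the index with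
  respect to \<open>U\<close> is additive; a \<open>U\<close>-resolution of \<open>\<Sigma>\<^sup>d t\<close> rotates to an angle \<open>t \<rightarrow> u\<^sub>d \<rightarrow> \<dots> \<rightarrow> u\<^sub>0\<close>, on which
  the index with respect to \<open>T\<close> is additive. These are the two identities to be shown.
\<close>

section \<open>Calculus in additive categories\<close>

text \<open>The axioms offer no long exact Hom sequence. The only exactness needed is that the first
  morphism of an angle is a weak kernel of the second, which follows from (N3) against a rotated
  trivial angle. The condition on Hom(b^d, \<open>F\<close> c^0) says that b^d -> b^{d+1} = c^{d+1}
  -> \<open>F\<close> c^0 is zero, so that b^d -> c^{d+1} lifts to c^d. Since (N4) takes its data in
  the first two places, both angles are rotated by \<open>d\<close> before coning. The first cone
  morphism then has the given isomorphism as its component from b^{d+1} to c^{d+1}, and closure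
  under summands lets a trivial angle be split off there.

  Signs have two sources. In a cone the terms of c sit one place further right than those of b, so
  alternating sums are subtracted. And an angle numbers its objects from the left, while a
  resolution numbers its terms t_i from the right: for an angle x -> \<open>F\<close> t_d -> ... ->
  \<open>F\<close> t_0, additivity reads ind x = sum of (-1)^k ind(\<open>F\<close> t_{d-k}) =
  (-1)^d times the sum of (-1)^i ind(\<open>F\<close> t_i). This is the (-1)^d of the
  theorem.\<close>

context additive_category
begin

text \<open>
  Since distinct Hom groups are disjoint, source and target are functions of the morphism. Phrasing
  everything through them leaves no object variables to be guessed in the side conditions of the
  rewrite rules below.
\<close>

definition arrow :: "'m \<Rightarrow> bool" where
  "arrow f \<longleftrightarrow> (\<exists>x \<in> Obj C. \<exists>y \<in> Obj C. f \<in> mor C x y)"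

definition src :: "'m \<Rightarrow> 'o" where
  "src f = (THE x. x \<in> Obj C \<and> (\<exists>y \<in> Obj C. f \<in> mor C x y))"

definition tgt :: "'m \<Rightarrow> 'o" where
  "tgt f = (THE y. y \<in> Obj C \<and> (\<exists>x \<in> Obj C. f \<in> mor C x y))"

definition madd :: "'m \<Rightarrow> 'm \<Rightarrow> 'm"  (infixl "\<boxplus>" 65) where
  "f \<boxplus> g = f \<oplus>\<^bsub>Hom C (src f) (tgt f)\<^esub> g"

definition mneg :: "'m \<Rightarrow> 'm" where
  "mneg f = \<ominus>\<^bsub>Hom C (src f) (tgt f)\<^esub> f"

definition mzero :: "'o \<Rightarrow> 'o \<Rightarrow> 'm" where
  "mzero x y = \<zero>\<^bsub>Hom C x y\<^esub>"

lemma mor_iff: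
  assumes "x \<in> Obj C" "y \<in> Obj C"
  shows "f \<in> mor C x y \<longleftrightarrow> arrow f \<and> src f = x \<and> tgt f = y"
proof
  assume f: "f \<in> mor C x y"
  have "src f = x"
    unfolding src_def using f assms hom_disjoint by (intro the_equality) blast+
  moreover have "tgt f = y"
    unfolding tgt_def using f assms hom_disjoint by (intro the_equality) blast+
  ultimately show "arrow f \<and> src f = x \<and> tgt f = y"
    using f assms by (auto simp: arrow_def)
next
  assume *: "arrow f \<and> src f = x \<and> tgt f = y"
  then obtain x' y' where xy: "x' \<in> Obj C" "y' \<in> Obj C" "f \<in> mor C x' y'"
    by (auto simp: arrow_def)
  have "src f = x'"
    unfolding src_def using xy hom_disjoint by (intro the_equality) blast+
  moreover have "tgt f = y'"
    unfolding tgt_def using xy hom_disjoint by (intro the_equality) blast+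
  ultimately show "f \<in> mor C x y" using * xy by simp
qed

lemma arrow_objs [simp]:
  assumes "arrow f"
  shows "src f \<in> Obj C" "tgt f \<in> Obj C"
proof -
  obtain x y where "x \<in> Obj C" "y \<in> Obj C" "f \<in> mor C x y" using assms by (auto simp: arrow_def)
  then show "src f \<in> Obj C" "tgt f \<in> Obj C" by (simp_all add: mor_iff)
qed

lemma arrow_mor: "arrow f \<Longrightarrow> f \<in> mor C (src f) (tgt f)"
  by (simp add: mor_iff)

lemma mor_arrow:
  "\<lbrakk>f \<in> mor C x y; x \<in> Obj C; y \<in> Obj C\<rbrakk> \<Longrightarrow> arrow f \<and> src f = x \<and> tgt f = y"
  by (simp add: mor_iff)

lemma arrow_comp [simp]:
  assumes "arrow f" "arrow g" "src g = tgt f"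
  shows "arrow (g \<cdot> f)" "src (g \<cdot> f) = src f" "tgt (g \<cdot> f) = tgt g"
proof -
  have "g \<cdot> f \<in> mor C (src f) (tgt g)"
    using assms comp_closed[of "src f" "tgt f" "tgt g" f g] by (simp add: mor_iff)
  then show "arrow (g \<cdot> f)" "src (g \<cdot> f) = src f" "tgt (g \<cdot> f) = tgt g"
    using assms mor_arrow by auto
qed

lemma arrow_id [simp]:
  assumes "x \<in> Obj C"
  shows "arrow (Idn C x)" "src (Idn C x) = x" "tgt (Idn C x) = x"
  using id_closed[OF assms] assms mor_arrow by auto

lemma assoc [simp]:
  "\<lbrakk>arrow f; arrow g; arrow h; src g = tgt f; src h = tgt g\<rbrakk> \<Longrightarrow> (h \<cdot> g) \<cdot> f = h \<cdot> (g \<cdot> f)"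
  by (rule comp_assoc[of "src f" "tgt f" "tgt g" "tgt h"]) (simp_all add: mor_iff)

lemma id_comp [simp]: "\<lbrakk>arrow f; tgt f = y\<rbrakk> \<Longrightarrow> Idn C y \<cdot> f = f"
  by (rule id_left[of "src f"]) (auto simp: mor_iff)

lemma comp_id [simp]: "\<lbrakk>arrow f; src f = x\<rbrakk> \<Longrightarrow> f \<cdot> Idn C x = f"
  by (rule id_right[of _ "tgt f"]) (auto simp: mor_iff)

lemma arrow_madd [simp]:
  assumes "arrow f" "arrow g" "src g = src f" "tgt g = tgt f"
  shows "arrow (f \<boxplus> g)" "src (f \<boxplus> g) = src f" "tgt (f \<boxplus> g) = tgt f"
proof -
  interpret abelian_group "Hom C (src f) (tgt f)" using assms hom_group by simp
  have "f \<boxplus> g \<in> mor C (src f) (tgt f)"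
    using assms arrow_mor[of f] arrow_mor[of g] by (simp add: madd_def)
  then show "arrow (f \<boxplus> g)" "src (f \<boxplus> g) = src f" "tgt (f \<boxplus> g) = tgt f"
    using assms mor_arrow by auto
qed

lemma arrow_mzero [simp]:
  assumes "x \<in> Obj C" "y \<in> Obj C"
  shows "arrow (mzero x y)" "src (mzero x y) = x" "tgt (mzero x y) = y"
proof -
  interpret abelian_group "Hom C x y" using assms hom_group by simp
  have "mzero x y \<in> mor C x y" by (simp add: mzero_def)
  then show "arrow (mzero x y)" "src (mzero x y) = x" "tgt (mzero x y) = y"
    using assms mor_arrow by auto
qed

lemma arrow_mneg [simp]:
  assumes "arrow f"
  shows "arrow (mneg f)" "src (mneg f) = src f" "tgt (mneg f) = tgt f"
proof -
  interpret abelian_group "Hom C (src f) (tgt f)" using assms hom_group by simp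
  have "mneg f \<in> mor C (src f) (tgt f)" using arrow_mor[OF assms] by (simp add: mneg_def)
  then show "arrow (mneg f)" "src (mneg f) = src f" "tgt (mneg f) = tgt f"
    using assms mor_arrow by auto
qed

lemma hom_add_eq: "\<lbrakk>src f = x; tgt f = y\<rbrakk> \<Longrightarrow> f \<oplus>\<^bsub>Hom C x y\<^esub> g = f \<boxplus> g"
  and hom_neg_eq: "\<lbrakk>src f = x; tgt f = y\<rbrakk> \<Longrightarrow> \<ominus>\<^bsub>Hom C x y\<^esub> f = mneg f"
  by (auto simp: madd_def mneg_def)

lemma madd_assoc [simp]:
  assumes "arrow f" "arrow g" "arrow h" "src g = src f" "tgt g = tgt f" "src h = src g" "tgt h = tgt g"
  shows "(f \<boxplus> g) \<boxplus> h = f \<boxplus> (g \<boxplus> h)"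
proof -
  interpret abelian_group "Hom C (src f) (tgt f)" using assms hom_group by simp
  show ?thesis
    using assms arrow_mor[of f] arrow_mor[of g] arrow_mor[of h] arrow_madd[of f g]
    by (simp add: madd_def a_assoc)
qed

lemma madd_comm:
  assumes "arrow f" "arrow g" "src g = src f" "tgt g = tgt f"
  shows "f \<boxplus> g = g \<boxplus> f"
proof -
  interpret abelian_group "Hom C (src f) (tgt f)" using assms hom_group by simp
  show ?thesis using assms arrow_mor[of f] arrow_mor[of g] by (simp add: madd_def a_comm)
qed

lemma madd_lcomm:
  assumes "arrow f" "arrow g" "arrow h" "src g = src f" "tgt g = tgt f" "src h = src f" "tgt h = tgt f"
  shows "f \<boxplus> (g \<boxplus> h) = g \<boxplus> (f \<boxplus> h)"
  using assms madd_assoc[of f g h] madd_assoc[of g f h] madd_comm[of f g] by simp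

lemma madd_zero [simp]:
  assumes "arrow f" "src f = x" "tgt f = y"
  shows "f \<boxplus> mzero x y = f" "mzero x y \<boxplus> f = f"
proof -
  have o: "x \<in> Obj C" "y \<in> Obj C" using assms by auto
  interpret abelian_group "Hom C x y" using o hom_group by simp
  show z: "f \<boxplus> mzero x y = f" using assms arrow_mor[of f] by (simp add: madd_def mzero_def)
  have "mzero x y \<boxplus> f = f \<boxplus> mzero x y" using assms o by (intro madd_comm) simp_all
  then show "mzero x y \<boxplus> f = f" using z by simp
qed

lemma madd_neg [simp]:
  assumes "arrow f"
  shows "f \<boxplus> mneg f = mzero (src f) (tgt f)" "mneg f \<boxplus> f = mzero (src f) (tgt f)"
proof -
  interpret abelian_group "Hom C (src f) (tgt f)" using assms hom_group by simp
  show z: "f \<boxplus> mneg f = mzero (src f) (tgt f)"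
    using arrow_mor[OF assms] by (simp add: madd_def mneg_def mzero_def r_neg)
  have "mneg f \<boxplus> f = f \<boxplus> mneg f" using assms by (intro madd_comm) simp_all
  then show "mneg f \<boxplus> f = mzero (src f) (tgt f)" using z by simp
qed

lemma madd_neg_cancel [simp]:
  assumes "arrow f" "arrow g" "src g = src f" "tgt g = tgt f"
  shows "f \<boxplus> (mneg f \<boxplus> g) = g" "mneg f \<boxplus> (f \<boxplus> g) = g"
proof -
  have "f \<boxplus> (mneg f \<boxplus> g) = (f \<boxplus> mneg f) \<boxplus> g"
    using assms by (intro madd_assoc[symmetric]) simp_all
  also have "\<dots> = g" using assms by (subst madd_neg) simp_all
  finally show "f \<boxplus> (mneg f \<boxplus> g) = g" .
  have "mneg f \<boxplus> (f \<boxplus> g) = (mneg f \<boxplus> f) \<boxplus> g"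
    using assms by (intro madd_assoc[symmetric]) simp_all
  also have "\<dots> = g" using assms by (subst madd_neg) simp_all
  finally show "mneg f \<boxplus> (f \<boxplus> g) = g" .
qed

lemma madd_left_cancel:
  assumes "arrow f" "arrow g" "arrow h" "src g = src f" "tgt g = tgt f" "src h = src f" "tgt h = tgt f"
    and "f \<boxplus> g = f \<boxplus> h"
  shows "g = h"
  using assms madd_neg_cancel(2)[of f g] madd_neg_cancel(2)[of f h] by metis

lemma mneg_eqI:
  assumes "arrow f" "arrow g" "src g = src f" "tgt g = tgt f" "f \<boxplus> g = mzero (src f) (tgt f)"
  shows "g = mneg f"
  using madd_left_cancel[of f g "mneg f"] assms by simp

lemma mneg_mneg [simp]: "arrow f \<Longrightarrow> mneg (mneg f) = f"
  by (rule mneg_eqI[symmetric]) simp_all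

lemma mneg_zero [simp]: "\<lbrakk>x \<in> Obj C; y \<in> Obj C\<rbrakk> \<Longrightarrow> mneg (mzero x y) = mzero x y"
  by (rule mneg_eqI[symmetric]) simp_all

lemma comp_distrib [simp]:
  assumes "arrow f" "arrow g" "src g = src f" "tgt g = tgt f" "arrow h"
  shows "src h = tgt f \<Longrightarrow> h \<cdot> (f \<boxplus> g) = (h \<cdot> f) \<boxplus> (h \<cdot> g)"
    and "tgt h = src f \<Longrightarrow> (f \<boxplus> g) \<cdot> h = (f \<cdot> h) \<boxplus> (g \<cdot> h)"
  using comp_add_right[of "src f" "tgt f" "tgt h" f g h]
    comp_add_left[of "src h" "src f" "tgt f" h f g] assms
  by (simp_all add: madd_def mor_iff)

lemma comp_zero [simp]:
  assumes "arrow f" "x \<in> Obj C"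
  shows "tgt f = y \<Longrightarrow> mzero y x \<cdot> f = mzero (src f) x"
    and "src f = y \<Longrightarrow> f \<cdot> mzero x y = mzero x (tgt f)"
proof -
  show "mzero y x \<cdot> f = mzero (src f) x" if "tgt f = y"
  proof -
    have y: "y \<in> Obj C" using assms that by auto
    have "mzero y x \<cdot> f = (mzero y x \<boxplus> mzero y x) \<cdot> f" using assms y by simp
    also have "\<dots> = mzero y x \<cdot> f \<boxplus> mzero y x \<cdot> f"
      using assms that y by (intro comp_distrib) simp_all
    finally have e: "mzero y x \<cdot> f \<boxplus> mzero y x \<cdot> f = mzero y x \<cdot> f \<boxplus> mzero (src f) x"
      using assms that y by simp
    show ?thesis
      by (rule madd_left_cancel[OF _ _ _ _ _ _ _ e]) (use assms y that in simp_all)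
  qed
  show "f \<cdot> mzero x y = mzero x (tgt f)" if "src f = y"
  proof -
    have y: "y \<in> Obj C" using assms that by auto
    have "f \<cdot> mzero x y = f \<cdot> (mzero x y \<boxplus> mzero x y)" using assms y by simp
    also have "\<dots> = f \<cdot> mzero x y \<boxplus> f \<cdot> mzero x y"
      using assms that y by (intro comp_distrib) simp_all
    finally have e: "f \<cdot> mzero x y \<boxplus> f \<cdot> mzero x y = f \<cdot> mzero x y \<boxplus> mzero x (tgt f)"
      using assms that y by simp
    show ?thesis
      by (rule madd_left_cancel[OF _ _ _ _ _ _ _ e]) (use assms y that in simp_all)
  qed
qed

lemma comp_neg [simp]:
  assumes "arrow f" "arrow g" "src g = tgt f"
  shows "mneg g \<cdot> f = mneg (g \<cdot> f)" "g \<cdot> mneg f = mneg (g \<cdot> f)"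
proof -
  have "(g \<boxplus> mneg g) \<cdot> f = g \<cdot> f \<boxplus> mneg g \<cdot> f" using assms by (intro comp_distrib) simp_all
  then show "mneg g \<cdot> f = mneg (g \<cdot> f)" using assms by (intro mneg_eqI) simp_all
  have "g \<cdot> (f \<boxplus> mneg f) = g \<cdot> f \<boxplus> g \<cdot> mneg f" using assms by (intro comp_distrib) simp_all
  then show "g \<cdot> mneg f = mneg (g \<cdot> f)" using assms by (intro mneg_eqI) simp_all
qed

text \<open>Simplification brackets composites to the right, where a known product
  \<open>g \<cdot> f\<close> is no longer a subterm; this restates the equation in the position
  where it then has to be applied.\<close>

lemma reassoc:
  assumes "g \<cdot> f = k" "arrow f" "arrow g" "src g = tgt f"
  shows "\<lbrakk>arrow h; tgt h = src f\<rbrakk> \<Longrightarrow> g \<cdot> (f \<cdot> h) = k \<cdot> h"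
  using assms assoc[of h f g] by simp


section \<open>Biproducts and change of their structure maps\<close>

lemma biproduct_iff:
  "biproduct C x A B i j p q \<longleftrightarrow>
     x \<in> Obj C \<and> A \<in> Obj C \<and> B \<in> Obj C \<and>
     arrow i \<and> src i = A \<and> tgt i = x \<and> arrow j \<and> src j = B \<and> tgt j = x \<and>
     arrow p \<and> src p = x \<and> tgt p = A \<and> arrow q \<and> src q = x \<and> tgt q = B \<and>
     p \<cdot> i = Idn C A \<and> q \<cdot> j = Idn C B \<and> q \<cdot> i = mzero A B \<and> p \<cdot> j = mzero B A \<and>
     (i \<cdot> p) \<boxplus> (j \<cdot> q) = Idn C x"
  unfolding biproduct_def
  by (rule iffI; clarsimp simp: mor_iff mzero_def madd_def)

text \<open>Later proofs cite these facts by position: 1-15 are typing, 16-19 orthogonality, 20 the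
  decomposition of the identity, and 21-24 orthogonality again inside right-bracketed
  composites.\<close>

lemma biproduct_comps:
  assumes "biproduct C x A B i j p q"
  shows "x \<in> Obj C" "A \<in> Obj C" "B \<in> Obj C"
     "arrow i" "src i = A" "tgt i = x" "arrow j" "src j = B" "tgt j = x"
     "arrow p" "src p = x" "tgt p = A" "arrow q" "src q = x" "tgt q = B"
     "p \<cdot> i = Idn C A" "q \<cdot> j = Idn C B" "q \<cdot> i = mzero A B" "p \<cdot> j = mzero B A"
     "(i \<cdot> p) \<boxplus> (j \<cdot> q) = Idn C x"
     "\<And>h. arrow h \<Longrightarrow> tgt h = A \<Longrightarrow> p \<cdot> (i \<cdot> h) = h"
     "\<And>h. arrow h \<Longrightarrow> tgt h = B \<Longrightarrow> q \<cdot> (j \<cdot> h) = h"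
     "\<And>h. arrow h \<Longrightarrow> tgt h = A \<Longrightarrow> q \<cdot> (i \<cdot> h) = mzero (src h) B"
     "\<And>h. arrow h \<Longrightarrow> tgt h = B \<Longrightarrow> p \<cdot> (j \<cdot> h) = mzero (src h) A"
  using assms by (auto simp: biproduct_iff reassoc)

lemma biproduct_decomp:
  assumes "biproduct C x A B i j p q" "arrow h"
  shows "tgt h = x \<Longrightarrow> (i \<cdot> (p \<cdot> h)) \<boxplus> (j \<cdot> (q \<cdot> h)) = h"
    and "src h = x \<Longrightarrow> (h \<cdot> (i \<cdot> p)) \<boxplus> (h \<cdot> (j \<cdot> q)) = h"
proof -
  note b = biproduct_comps[OF assms(1)]
  show "(i \<cdot> (p \<cdot> h)) \<boxplus> (j \<cdot> (q \<cdot> h)) = h" if "tgt h = x"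
    using b(1-19) assms(2) that comp_distrib(2)[of "i \<cdot> p" "j \<cdot> q" h] b(20) by simp
  show "(h \<cdot> (i \<cdot> p)) \<boxplus> (h \<cdot> (j \<cdot> q)) = h" if "src h = x"
    using b(1-19) assms(2) that comp_distrib(1)[of "i \<cdot> p" "j \<cdot> q" h] b(20) by simp
qed

lemma biproduct_commute:
  assumes "biproduct C x A B i j p q"
  shows "biproduct C x B A j i q p"
  using biproduct_comps[OF assms] madd_comm[of "i \<cdot> p" "j \<cdot> q"] by (simp add: biproduct_iff)

text \<open>Any retraction \<open>r\<close> of \<open>i\<close> can replace \<open>p\<close>:
  correcting \<open>j\<close> by \<open>- i r j\<close> moves the complement into the kernel of
  \<open>r\<close>, and \<open>q\<close> survives because \<open>q i = 0\<close>.\<close>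

lemma biproduct_change_projection:
  assumes "biproduct C x A B i j p q" "arrow r" "src r = x" "tgt r = A" "r \<cdot> i = Idn C A"
  shows "\<exists>j'. biproduct C x A B i j' r q"
proof -
  note b = biproduct_comps[OF assms(1)]
  define j' where "j' = j \<boxplus> mneg (i \<cdot> (r \<cdot> j))"
  have r: "(i \<cdot> p) \<boxplus> (i \<cdot> (r \<cdot> (j \<cdot> q))) = i \<cdot> r"
  proof -
    have "i \<cdot> r = i \<cdot> ((r \<cdot> (i \<cdot> p)) \<boxplus> (r \<cdot> (j \<cdot> q)))"
      using biproduct_decomp(2)[OF assms(1), of r] assms by simp
    also have "\<dots> = (i \<cdot> p) \<boxplus> (i \<cdot> (r \<cdot> (j \<cdot> q)))"
      using b assms(2-) reassoc[OF assms(5)] by simp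
    finally show ?thesis by simp
  qed
  have "i \<cdot> r \<boxplus> j' \<cdot> q = (i \<cdot> p) \<boxplus> ((i \<cdot> (r \<cdot> (j \<cdot> q))) \<boxplus> ((j \<cdot> q) \<boxplus> mneg (i \<cdot> (r \<cdot> (j \<cdot> q)))))"
    unfolding j'_def r[symmetric] using b(1-15) assms(2-4) by simp
  also have "\<dots> = (i \<cdot> p) \<boxplus> (j \<cdot> q)"
    using b(1-15) assms(2-4) madd_comm[of "j \<cdot> q" "mneg (i \<cdot> (r \<cdot> (j \<cdot> q)))"] by simp
  finally have "i \<cdot> r \<boxplus> j' \<cdot> q = Idn C x" using b by simp
  moreover have "r \<cdot> j' = mzero B A" "q \<cdot> j' = Idn C B"
    "arrow j'" "src j' = B" "tgt j' = x"
    using b(1-19) b(21-) assms(2-) reassoc[OF assms(5)] by (simp_all add: j'_def)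
  ultimately have "biproduct C x A B i j' r q"
    unfolding biproduct_iff using b(1-19) assms(2-) by simp
  then show ?thesis by blast
qed

text \<open>The dual correction: a section \<open>k\<close> of \<open>p\<close> can replace
  \<open>i\<close> once \<open>q\<close> is corrected by \<open>- q k p\<close>; \<open>j\<close>
  survives because \<open>p j = 0\<close>.\<close>

lemma biproduct_change_inclusion:
  assumes "biproduct C x A B i j p q" "arrow k" "src k = A" "tgt k = x" "p \<cdot> k = Idn C A"
  shows "\<exists>q'. biproduct C x A B k j p q'"
proof -
  note b = biproduct_comps[OF assms(1)]
  define q' where "q' = q \<boxplus> mneg (q \<cdot> (k \<cdot> p))"
  have r: "(i \<cdot> p) \<boxplus> (j \<cdot> (q \<cdot> (k \<cdot> p))) = k \<cdot> p"
  proof -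
    have "k \<cdot> p = (i \<cdot> (p \<cdot> (k \<cdot> p))) \<boxplus> (j \<cdot> (q \<cdot> (k \<cdot> p)))"
      using biproduct_decomp(1)[OF assms(1), of "k \<cdot> p"] assms b by simp
    also have "\<dots> = (i \<cdot> p) \<boxplus> (j \<cdot> (q \<cdot> (k \<cdot> p)))"
      using b assms(2-) reassoc[OF assms(5)] by simp
    finally show ?thesis by simp
  qed
  have "k \<cdot> p \<boxplus> j \<cdot> q' = ((i \<cdot> p) \<boxplus> (j \<cdot> (q \<cdot> (k \<cdot> p)))) \<boxplus> j \<cdot> q'" by (simp only: r)
  also have "\<dots> = (i \<cdot> p) \<boxplus> ((j \<cdot> (q \<cdot> (k \<cdot> p))) \<boxplus> ((j \<cdot> q) \<boxplus> mneg (j \<cdot> (q \<cdot> (k \<cdot> p)))))"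
    unfolding q'_def using b(1-15) assms(2-4) by simp
  also have "\<dots> = (i \<cdot> p) \<boxplus> (j \<cdot> q)"
    using b(1-15) assms(2-4) madd_comm[of "j \<cdot> q" "mneg (j \<cdot> (q \<cdot> (k \<cdot> p)))"] by simp
  finally have "k \<cdot> p \<boxplus> j \<cdot> q' = Idn C x" using b by simp
  moreover have "q' \<cdot> k = mzero A B" "q' \<cdot> j = Idn C B"
    "arrow q'" "src q' = x" "tgt q' = B"
    using b(1-19) b(21-) assms(2-) reassoc[OF assms(5)] by (simp_all add: q'_def)
  ultimately have "biproduct C x A B k j p q'"
    unfolding biproduct_iff using b(1-19) assms(2-) by simp
  then show ?thesis by blast
qed

section \<open>Isomorphisms, zero objects and regrouping of sums\<close>

lemma iso_obj_iff:
  "iso_obj C x y \<longleftrightarrow> (\<exists>f g. arrow f \<and> arrow g \<and> src f = x \<and> tgt f = y \<and> src g = y \<and> tgt g = x \<and>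
     g \<cdot> f = Idn C x \<and> f \<cdot> g = Idn C y)"
proof
  show "iso_obj C x y \<Longrightarrow> \<exists>f g. arrow f \<and> arrow g \<and> src f = x \<and> tgt f = y \<and> src g = y \<and> tgt g = x \<and>
     g \<cdot> f = Idn C x \<and> f \<cdot> g = Idn C y"
    unfolding iso_obj_def iso_mor_def by (metis mor_iff)
  assume "\<exists>f g. arrow f \<and> arrow g \<and> src f = x \<and> tgt f = y \<and> src g = y \<and> tgt g = x \<and>
     g \<cdot> f = Idn C x \<and> f \<cdot> g = Idn C y"
  then obtain f g where *: "arrow f" "arrow g" "src f = x" "tgt f = y" "src g = y" "tgt g = x"
     "g \<cdot> f = Idn C x" "f \<cdot> g = Idn C y" by blast
  then have "x \<in> Obj C" "y \<in> Obj C" by auto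
  with * show "iso_obj C x y"
    unfolding iso_obj_def iso_mor_def by (intro conjI exI[of _ f] bexI[of _ g]) (auto simp: mor_iff)
qed

lemma iso_obj_refl: "x \<in> Obj C \<Longrightarrow> iso_obj C x x"
  unfolding iso_obj_iff by (intro exI[of _ "Idn C x"]) simp

lemma biproduct_iso_left:
  assumes "biproduct C x A B i j p q" "arrow f" "arrow g" "src f = A" "tgt f = A'"
    "src g = A'" "tgt g = A" "g \<cdot> f = Idn C A" "f \<cdot> g = Idn C A'"
  shows "biproduct C x A' B (i \<cdot> g) j (f \<cdot> p) q"
proof -
  have "A' \<in> Obj C" using assms by auto
  then show ?thesis
    using biproduct_comps[OF assms(1)] assms(2-) reassoc[OF assms(8)] reassoc[OF assms(9)]
    by (simp add: biproduct_iff)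
qed

lemma zero_object_iff: "zero_object C z \<longleftrightarrow> z \<in> Obj C \<and> Idn C z = mzero z z"
proof
  assume "zero_object C z"
  then have z: "z \<in> Obj C" and "\<exists>!f. f \<in> mor C z z" by (auto simp: zero_object_def)
  then have "Idn C z = mzero z z"
    using mor_iff[OF z z, of "Idn C z"] mor_iff[OF z z, of "mzero z z"] by auto
  with z show "z \<in> Obj C \<and> Idn C z = mzero z z" by simp
next
  assume z: "z \<in> Obj C \<and> Idn C z = mzero z z"
  have "f = mzero x z" if "arrow f" "src f = x" "tgt f = z" for f x
  proof -
    have "f = Idn C z \<cdot> f" using that by simp
    also have "\<dots> = mzero x z" using z that by auto
    finally show ?thesis .
  qed
  moreover have "f = mzero z x" if "arrow f" "src f = z" "tgt f = x" for f x
  proof -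
    have "f = f \<cdot> Idn C z" using that by simp
    also have "\<dots> = mzero z x" using z that by auto
    finally show ?thesis .
  qed
  ultimately have "f \<in> mor C x z \<longleftrightarrow> f = mzero x z" "f \<in> mor C z x \<longleftrightarrow> f = mzero z x"
    if "x \<in> Obj C" for f x
    using that z arrow_mzero by (metis mor_iff)+
  then show "zero_object C z" using z by (simp add: zero_object_def)
qed

lemma zero_object_arrow:
  assumes "zero_object C z" "arrow f"
  shows "tgt f = z \<Longrightarrow> f = mzero (src f) z" "src f = z \<Longrightarrow> f = mzero z (tgt f)"
  using assms id_comp[of f z] comp_id[of f z] by (auto simp: zero_object_iff)

lemma is_sum_objs: "is_sum C x A B \<Longrightarrow> x \<in> Obj C \<and> A \<in> Obj C \<and> B \<in> Obj C"
  by (auto simp: is_sum_def biproduct_iff)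

text \<open>Turns isomorphism into a sum, so that closure under sums and the defining relations of
  the split Grothendieck group also cover isomorphic objects.\<close>

lemma is_sum_zero:
  assumes "iso_obj C x y" "zero_object C z"
  shows "is_sum C y x z"
proof -
  obtain f g where *: "arrow f" "arrow g" "src f = x" "tgt f = y" "src g = y" "tgt g = x"
     "g \<cdot> f = Idn C x" "f \<cdot> g = Idn C y" using assms(1) unfolding iso_obj_iff by blast
  then have "x \<in> Obj C" "y \<in> Obj C" by auto
  then have "biproduct C y x z f (mzero z y) g (mzero y z)"
    using * assms(2) by (auto simp: biproduct_iff zero_object_iff)
  then show ?thesis by (auto simp: is_sum_def)
qed

lemma zero_object_sum:
  assumes "is_sum C x A B" "zero_object C A" "zero_object C B"
  shows "zero_object C x"
proof -
  obtain i j p q where b: "biproduct C x A B i j p q" using assms(1) by (auto simp: is_sum_def)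
  note b = biproduct_comps[OF b]
  have "i = mzero A x" "j = mzero B x"
    using zero_object_arrow(2)[OF assms(2) b(4,5)] zero_object_arrow(2)[OF assms(3) b(7,8)]
    unfolding b(6,9) by blast+
  then show ?thesis using b by (auto simp: zero_object_iff)
qed

lemma is_sum_unique:
  assumes "is_sum C x A B" "is_sum C y A B"
  shows "iso_obj C x y"
proof -
  obtain i j p q where "biproduct C x A B i j p q" using assms(1) by (auto simp: is_sum_def)
  note b = biproduct_comps[OF this]
  obtain i' j' p' q' where "biproduct C y A B i' j' p' q'" using assms(2) by (auto simp: is_sum_def)
  note b' = biproduct_comps[OF this]
  show ?thesis unfolding iso_obj_iff
    by (intro exI[of _ "i' \<cdot> p \<boxplus> j' \<cdot> q"] exI[of _ "i \<cdot> p' \<boxplus> j \<cdot> q'"])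
      (use b b' in simp)
qed

text \<open>Membership in \<open>add_closure\<close> is witnessed by a complement; this assembles a
  complement of a sum from the complements of its two parts.\<close>

lemma is_sum_interchange:
  assumes "is_sum C z a b" "is_sum C a x x'" "is_sum C b y y'" "is_sum C w x y" "is_sum C w' x' y'"
  shows "is_sum C z w w'"
proof -
  obtain iz jz pz qz where "biproduct C z a b iz jz pz qz" using assms(1) by (auto simp: is_sum_def)
  note z = biproduct_comps[OF this] and zd = biproduct_decomp[OF this]
  obtain ia ja pa qa where "biproduct C a x x' ia ja pa qa" using assms(2) by (auto simp: is_sum_def)
  note a = biproduct_comps[OF this] and ad = biproduct_decomp[OF this]
  obtain ib jb pb qb where "biproduct C b y y' ib jb pb qb" using assms(3) by (auto simp: is_sum_def)
  note b = biproduct_comps[OF this] and bd = biproduct_decomp[OF this]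
  obtain iw jw pw qw where "biproduct C w x y iw jw pw qw" using assms(4) by (auto simp: is_sum_def)
  note w = biproduct_comps[OF this]
  obtain iv jv pv qv where "biproduct C w' x' y' iv jv pv qv" using assms(5) by (auto simp: is_sum_def)
  note v = biproduct_comps[OF this]
  let ?i = "iz \<cdot> (ia \<cdot> pw) \<boxplus> jz \<cdot> (ib \<cdot> qw)" and ?j = "iz \<cdot> (ja \<cdot> pv) \<boxplus> jz \<cdot> (jb \<cdot> qv)"
  let ?p = "iw \<cdot> (pa \<cdot> pz) \<boxplus> jw \<cdot> (pb \<cdot> qz)" and ?q = "iv \<cdot> (qa \<cdot> pz) \<boxplus> jv \<cdot> (qb \<cdot> qz)"
  have "(?i \<cdot> ?p) \<boxplus> (?j \<cdot> ?q) = Idn C z"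
  proof -
    have "(?i \<cdot> ?p) \<boxplus> (?j \<cdot> ?q) = (iz \<cdot> (ia \<cdot> (pa \<cdot> pz)) \<boxplus> jz \<cdot> (ib \<cdot> (pb \<cdot> qz))) \<boxplus>
        (iz \<cdot> (ja \<cdot> (qa \<cdot> pz)) \<boxplus> jz \<cdot> (jb \<cdot> (qb \<cdot> qz)))"
      using z(1-15) a(1-15) b(1-15) w(1-19) w(21-) v(1-19) v(21-) by simp
    also have "\<dots> = (iz \<cdot> (ia \<cdot> (pa \<cdot> pz)) \<boxplus> iz \<cdot> (ja \<cdot> (qa \<cdot> pz))) \<boxplus>
        (jz \<cdot> (ib \<cdot> (pb \<cdot> qz)) \<boxplus> jz \<cdot> (jb \<cdot> (qb \<cdot> qz)))"
      using z(1-15) a(1-15) b(1-15) by (simp add: madd_lcomm)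
    also have "\<dots> = iz \<cdot> (ia \<cdot> (pa \<cdot> pz) \<boxplus> ja \<cdot> (qa \<cdot> pz)) \<boxplus>
        jz \<cdot> (ib \<cdot> (pb \<cdot> qz) \<boxplus> jb \<cdot> (qb \<cdot> qz))"
      using z(1-15) a(1-15) b(1-15) by simp
    also have "\<dots> = iz \<cdot> pz \<boxplus> jz \<cdot> qz"
      using ad(1)[of pz] bd(1)[of qz] z(1-15) by simp
    finally show ?thesis using z(20) by simp
  qed
  then have "biproduct C z w w' ?i ?j ?p ?q"
    unfolding biproduct_iff
    using z(1-19) a(1-19) b(1-19) w v z(21-) a(21-) b(21-) by simp
  then show ?thesis by (auto simp: is_sum_def)
qed

section \<open>Finite direct sums and closure properties of add(T)\<close>

lemma finsum_comp:
  assumes "finite A" "x \<in> Obj C" "y \<in> Obj C" "w \<in> Obj C" "z \<in> Obj C"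
    "\<And>k. k \<in> A \<Longrightarrow> f k \<in> mor C x y" "g \<in> mor C y z" "h \<in> mor C w x"
  shows "finsum (Hom C w z) (\<lambda>k. g \<cdot> (f k \<cdot> h)) A = g \<cdot> (finsum (Hom C x y) f A \<cdot> h)"
  using assms(1,6)
proof (induction A rule: finite_induct)
  case empty
  then show ?case using assms by (auto simp: mor_iff mzero_def[symmetric] abelian_group.axioms
        abelian_monoid.finsum_empty hom_group)
next
  case (insert a A)
  interpret xy: abelian_group "Hom C x y" using assms hom_group by simp
  interpret wz: abelian_group "Hom C w z" using assms hom_group by simp
  have cl: "g \<cdot> (f k \<cdot> h) \<in> mor C w z" if "k \<in> insert a A" for k
    using insert.prems[OF that] assms by (auto simp: mor_iff)
  have s: "finsum (Hom C x y) f A \<in> mor C x y"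
    using insert.prems by (intro xy.finsum_closed) auto
  have "finsum (Hom C w z) (\<lambda>k. g \<cdot> (f k \<cdot> h)) (insert a A) =
      g \<cdot> (f a \<cdot> h) \<oplus>\<^bsub>Hom C w z\<^esub> g \<cdot> (finsum (Hom C x y) f A \<cdot> h)"
    using insert cl by (subst wz.finsum_insert) auto
  also have "\<dots> = g \<cdot> (f a \<cdot> h) \<boxplus> g \<cdot> (finsum (Hom C x y) f A \<cdot> h)"
    using cl[of a] assms by (simp add: madd_def mor_iff)
  also have "\<dots> = g \<cdot> ((f a \<boxplus> finsum (Hom C x y) f A) \<cdot> h)"
    using insert.prems[of a] s assms by (simp add: mor_iff)
  also have "f a \<boxplus> finsum (Hom C x y) f A = finsum (Hom C x y) f (insert a A)"
    using insert assms by (subst xy.finsum_insert) (auto simp: madd_def mor_iff)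
  finally show ?case .
qed

lemma is_direct_sum_append:
  assumes "is_direct_sum C x xs" "is_direct_sum C y ys" "is_sum C z x y"
  shows "is_direct_sum C z (xs @ ys)"
proof -
  obtain I J P Q where b: "biproduct C z x y I J P Q" using assms(3) by (auto simp: is_sum_def)
  note b = biproduct_comps[OF b]
  let ?n = "length xs" and ?m = "length ys"
  obtain i p where x: "x \<in> Obj C" "set xs \<subseteq> Obj C"
    and i: "\<And>k. k < ?n \<Longrightarrow> i k \<in> mor C (xs ! k) x \<and> p k \<in> mor C x (xs ! k)"
    and ip: "\<And>k l. k < ?n \<Longrightarrow> l < ?n \<Longrightarrow>
           p l \<cdot> i k = (if k = l then Idn C (xs ! k) else mzero (xs ! k) (xs ! l))"
    and isum: "finsum (Hom C x x) (\<lambda>k. i k \<cdot> p k) {..<?n} = Idn C x"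
    using assms(1) unfolding is_direct_sum_def mzero_def[symmetric] by blast
  obtain j q where y: "y \<in> Obj C" "set ys \<subseteq> Obj C"
    and j: "\<And>k. k < ?m \<Longrightarrow> j k \<in> mor C (ys ! k) y \<and> q k \<in> mor C y (ys ! k)"
    and jq: "\<And>k l. k < ?m \<Longrightarrow> l < ?m \<Longrightarrow>
           q l \<cdot> j k = (if k = l then Idn C (ys ! k) else mzero (ys ! k) (ys ! l))"
    and js: "finsum (Hom C y y) (\<lambda>k. j k \<cdot> q k) {..<?m} = Idn C y"
    using assms(2) unfolding is_direct_sum_def mzero_def[symmetric] by blast
  have xo: "xs ! k \<in> Obj C" if "k < ?n" for k using x that by auto
  have yo: "ys ! k \<in> Obj C" if "k < ?m" for k using y that by auto
  have ia: "arrow (i k) \<and> src (i k) = xs ! k \<and> tgt (i k) = x \<and>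
      arrow (p k) \<and> src (p k) = x \<and> tgt (p k) = xs ! k" if "k < ?n" for k
    using i[OF that] x xo[OF that] by (auto simp: mor_iff)
  have ja: "arrow (j k) \<and> src (j k) = ys ! k \<and> tgt (j k) = y \<and>
      arrow (q k) \<and> src (q k) = y \<and> tgt (q k) = ys ! k" if "k < ?m" for k
    using j[OF that] y yo[OF that] by (auto simp: mor_iff)
  define e where "e k = (if k < ?n then I \<cdot> i k else J \<cdot> j (k - ?n))" for k
  define r where "r k = (if k < ?n then p k \<cdot> P else q (k - ?n) \<cdot> Q)" for k
  have er: "arrow (e k) \<and> src (e k) = (xs @ ys) ! k \<and> tgt (e k) = z \<and>
      arrow (r k) \<and> src (r k) = z \<and> tgt (r k) = (xs @ ys) ! k" if "k < ?n + ?m" for k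
    using that ia ja b by (auto simp: e_def r_def nth_append)
  interpret zz: abelian_group "Hom C z z" using b hom_group by simp
  interpret xx: abelian_group "Hom C x x" using b hom_group by simp
  interpret yy: abelian_group "Hom C y y" using b hom_group by simp
  have er_mor: "e k \<cdot> r k \<in> mor C z z" if "k < ?n + ?m" for k
    using er[OF that] b by (simp add: mor_iff)
  \<comment> \<open>The index set is cut at \<open>length xs\<close>; the second block is reindexed
    from 0 to match the structure maps of \<open>y\<close>.\<close>
  have "finsum (Hom C z z) (\<lambda>k. e k \<cdot> r k) {..<?n + ?m} =
      finsum (Hom C z z) (\<lambda>k. e k \<cdot> r k) ({..<?n} \<union> (\<lambda>k. ?n + k) ` {..<?m})"
    by (simp add: lessThan_atLeast0 ivl_disj_un image_add_atLeastLessThan add.commute)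
  also have "\<dots> = finsum (Hom C z z) (\<lambda>k. e k \<cdot> r k) {..<?n} \<oplus>\<^bsub>Hom C z z\<^esub>
      finsum (Hom C z z) (\<lambda>k. e k \<cdot> r k) ((\<lambda>k. ?n + k) ` {..<?m})"
    using er_mor by (intro zz.finsum_Un_disjoint) auto
  also have "finsum (Hom C z z) (\<lambda>k. e k \<cdot> r k) ((\<lambda>k. ?n + k) ` {..<?m}) =
      finsum (Hom C z z) (\<lambda>k. e (?n + k) \<cdot> r (?n + k)) {..<?m}"
    using er_mor by (intro zz.finsum_reindex) auto
  also have "\<dots> = finsum (Hom C z z) (\<lambda>k. J \<cdot> ((j k \<cdot> q k) \<cdot> Q)) {..<?m}"
    using ja b(1-15) by (intro zz.finsum_cong') (auto simp: e_def r_def mor_iff)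
  also have "\<dots> = J \<cdot> (finsum (Hom C y y) (\<lambda>k. j k \<cdot> q k) {..<?m} \<cdot> Q)"
    using ja b by (intro finsum_comp) (auto simp: mor_iff)
  also have "\<dots> = J \<cdot> Q" using js b by simp
  also have "finsum (Hom C z z) (\<lambda>k. e k \<cdot> r k) {..<?n} =
      finsum (Hom C z z) (\<lambda>k. I \<cdot> ((i k \<cdot> p k) \<cdot> P)) {..<?n}"
    using ia b(1-15) by (intro zz.finsum_cong') (auto simp: e_def r_def mor_iff)
  also have "\<dots> = I \<cdot> (finsum (Hom C x x) (\<lambda>k. i k \<cdot> p k) {..<?n} \<cdot> P)"
    using ia b by (intro finsum_comp) (auto simp: mor_iff)
  also have "\<dots> = I \<cdot> P" using isum b by simp
  also have "I \<cdot> P \<oplus>\<^bsub>Hom C z z\<^esub> J \<cdot> Q = Idn C z"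
    using b(1-15) b(20) by (simp add: madd_def)
  finally have s: "finsum (Hom C z z) (\<lambda>k. e k \<cdot> r k) {..<?n + ?m} = Idn C z" .
  have orth: "r l \<cdot> e k = (if k = l then Idn C ((xs @ ys) ! k) else mzero ((xs @ ys) ! k) ((xs @ ys) ! l))"
    if kl: "k < ?n + ?m" "l < ?n + ?m" for k l
  proof -
    consider "k < ?n" "l < ?n" | "k < ?n" "\<not> l < ?n" | "\<not> k < ?n" "l < ?n" | "\<not> k < ?n" "\<not> l < ?n"
      by blast
    then show ?thesis
    proof cases
      case 1
      then show ?thesis using ia[of k] ia[of l] ip[of k l] b by (simp add: e_def r_def nth_append)
    next
      case 2
      then show ?thesis using kl ia[of k] ja[of "l - ?n"] xo[of k] yo[of "l - ?n"] b
        by (auto simp: e_def r_def nth_append)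
    next
      case 3
      then show ?thesis using kl ia[of l] ja[of "k - ?n"] xo[of l] yo[of "k - ?n"] b
        by (auto simp: e_def r_def nth_append)
    next
      case 4
      then have "k - ?n = l - ?n \<longleftrightarrow> k = l" by auto
      with 4 show ?thesis using kl ja[of "k - ?n"] ja[of "l - ?n"] jq[of "k - ?n" "l - ?n"] b
        by (auto simp: e_def r_def nth_append)
    qed
  qed
  have oo: "(xs @ ys) ! k \<in> Obj C" if "k < ?n + ?m" for k
    using that xo yo by (auto simp: nth_append)
  show ?thesis
    unfolding is_direct_sum_def
    using s orth er oo b(1) x(2) y(2)
    by (intro conjI exI[of _ e] exI[of _ r]) (auto simp: mor_iff mzero_def)
qed

lemma add_closure_Obj: "x \<in> add_closure C T \<Longrightarrow> x \<in> Obj C"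
  by (auto simp: add_closure_def dest: is_sum_objs)

lemma zero_object_in_add_closure:
  assumes "zero_object C z" shows "z \<in> add_closure C T"
proof -
  interpret abelian_group "Hom C z z" using assms hom_group by (simp add: zero_object_iff)
  have "is_direct_sum C z (replicate 0 T)"
    using assms by (auto simp: is_direct_sum_def zero_object_iff mzero_def)
  moreover have "is_sum C z z z"
    using assms iso_obj_refl is_sum_zero by (auto simp: zero_object_iff)
  ultimately show ?thesis unfolding add_closure_def by blast
qed

lemma add_closure_sum:
  assumes "x \<in> add_closure C T" "y \<in> add_closure C T" "is_sum C w x y"
  shows "w \<in> add_closure C T"
proof -
  obtain n a x' where x: "is_direct_sum C a (replicate n T)" "is_sum C a x x'"
    using assms(1) by (auto simp: add_closure_def)
  obtain m b y' where y: "is_direct_sum C b (replicate m T)" "is_sum C b y y'"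
    using assms(2) by (auto simp: add_closure_def)
  obtain z where z: "is_sum C z a b" using x y ex_biproduct is_sum_objs by metis
  obtain w' where w': "is_sum C w' x' y'" using x y ex_biproduct is_sum_objs by metis
  have "is_direct_sum C z (replicate (n + m) T)"
    using is_direct_sum_append[OF x(1) y(1) z] by (simp add: replicate_add)
  moreover have "is_sum C z w w'" by (rule is_sum_interchange[OF z x(2) y(2) assms(3) w'])
  ultimately show ?thesis unfolding add_closure_def by blast
qed

lemma add_closure_iso:
  assumes "x \<in> add_closure C T" "iso_obj C x y"
  shows "y \<in> add_closure C T"
  using add_closure_sum[OF assms(1) zero_object_in_add_closure is_sum_zero[OF assms(2)]]
    ex_zero_object by blast


section \<open>Additive functors\<close>

lemma functor_obj: "\<lbrakk>additive_functor C G; x \<in> Obj C\<rbrakk> \<Longrightarrow> fobj G x \<in> Obj C"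
  by (auto simp: additive_functor_def is_functor_def)

lemma functor_id: "\<lbrakk>additive_functor C G; x \<in> Obj C\<rbrakk> \<Longrightarrow> fmor G (Idn C x) = Idn C (fobj G x)"
  by (auto simp: additive_functor_def is_functor_def)

lemma functor_arrow:
  assumes "additive_functor C G" "arrow f"
  shows "arrow (fmor G f)" "src (fmor G f) = fobj G (src f)" "tgt (fmor G f) = fobj G (tgt f)"
proof -
  have o: "src f \<in> Obj C" "tgt f \<in> Obj C" using assms by auto
  have "fmor G f \<in> mor C (fobj G (src f)) (fobj G (tgt f))"
    using assms(1) o arrow_mor[OF assms(2)] unfolding additive_functor_def is_functor_def by blast
  then show "arrow (fmor G f)" "src (fmor G f) = fobj G (src f)" "tgt (fmor G f) = fobj G (tgt f)"
    using mor_arrow functor_obj[OF assms(1)] o by blast+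
qed

lemma functor_comp:
  assumes "additive_functor C G" "arrow f" "arrow g" "src g = tgt f"
  shows "fmor G (g \<cdot> f) = fmor G g \<cdot> fmor G f"
proof -
  have o: "src f \<in> Obj C" "tgt f \<in> Obj C" "tgt g \<in> Obj C" using assms by auto
  have "f \<in> mor C (src f) (tgt f)" "g \<in> mor C (tgt f) (tgt g)" using arrow_mor assms by metis+
  then show ?thesis
    using assms(1) o unfolding additive_functor_def is_functor_def by blast
qed

lemma functor_madd:
  assumes "additive_functor C G" "arrow f" "arrow g" "src g = src f" "tgt g = tgt f"
  shows "fmor G (f \<boxplus> g) = fmor G f \<boxplus> fmor G g"
proof -
  have o: "src f \<in> Obj C" "tgt f \<in> Obj C" using assms by auto
  have "f \<in> mor C (src f) (tgt f)" "g \<in> mor C (src f) (tgt f)" using arrow_mor assms by metis+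
  then have "fmor G (f \<oplus>\<^bsub>Hom C (src f) (tgt f)\<^esub> g) =
      fmor G f \<oplus>\<^bsub>Hom C (fobj G (src f)) (fobj G (tgt f))\<^esub> fmor G g"
    using assms(1) o unfolding additive_functor_def by blast
  then show ?thesis using functor_arrow[OF assms(1,2)] by (simp add: madd_def)
qed

lemma functor_mzero:
  assumes "additive_functor C G" "x \<in> Obj C" "y \<in> Obj C"
  shows "fmor G (mzero x y) = mzero (fobj G x) (fobj G y)"
proof -
  let ?z = "fmor G (mzero x y)"
  have z: "arrow ?z" "src ?z = fobj G x" "tgt ?z = fobj G y"
    using functor_arrow[OF assms(1), of "mzero x y"] assms(2,3) by auto
  have "fmor G (mzero x y \<boxplus> mzero x y) = ?z \<boxplus> ?z"
    by (rule functor_madd[OF assms(1)]) (use assms(2,3) in auto)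
  then have "?z \<boxplus> ?z = ?z \<boxplus> mzero (fobj G x) (fobj G y)" using z assms(2,3) by simp
  then show ?thesis
    using madd_left_cancel[of ?z ?z "mzero (fobj G x) (fobj G y)"] z functor_obj[OF assms(1)] assms(2,3)
    by simp
qed

lemma functor_mneg:
  assumes "additive_functor C G" "arrow f"
  shows "fmor G (mneg f) = mneg (fmor G f)"
proof (rule mneg_eqI)
  have "fmor G f \<boxplus> fmor G (mneg f) = fmor G (f \<boxplus> mneg f)"
    by (rule functor_madd[symmetric]) (use assms in auto)
  then show "fmor G f \<boxplus> fmor G (mneg f) = mzero (src (fmor G f)) (tgt (fmor G f))"
    using assms functor_mzero functor_arrow by simp
qed (use assms functor_arrow in auto)

lemma functor_biproduct:
  assumes "additive_functor C G" "biproduct C x A B i j p q"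
  shows "biproduct C (fobj G x) (fobj G A) (fobj G B) (fmor G i) (fmor G j) (fmor G p) (fmor G q)"
proof -
  note b = biproduct_comps(1-20)[OF assms(2)]
  note c = functor_comp[OF assms(1), symmetric]
  have "fmor G i \<cdot> fmor G p \<boxplus> fmor G j \<cdot> fmor G q = fmor G (i \<cdot> p \<boxplus> j \<cdot> q)"
    using b(1-15) by (simp add: functor_madd[OF assms(1)] functor_comp[OF assms(1)])
  also have "\<dots> = Idn C (fobj G x)" using b(1,20) functor_id[OF assms(1)] by simp
  finally show ?thesis
    unfolding biproduct_iff using b(1-19)
    by (simp add: functor_arrow[OF assms(1)] functor_obj[OF assms(1)] c functor_id[OF assms(1)]
        functor_mzero[OF assms(1)])
qed

lemma functor_is_sum:
  "\<lbrakk>additive_functor C G; is_sum C x A B\<rbrakk> \<Longrightarrow> is_sum C (fobj G x) (fobj G A) (fobj G B)"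
  unfolding is_sum_def using functor_biproduct by blast

lemma functor_zero_object:
  "\<lbrakk>additive_functor C G; zero_object C z\<rbrakk> \<Longrightarrow> zero_object C (fobj G z)"
  unfolding zero_object_iff using functor_obj functor_id functor_mzero by metis

end

section \<open>Angles\<close>

context angulated_category
begin

lemma F_functor: "additive_functor C F"
  using shift by (auto simp: automorphism_def)

lemmas F_simps [simp] = functor_obj[OF F_functor] functor_id[OF F_functor] functor_arrow[OF F_functor]
  functor_comp[OF F_functor] functor_madd[OF F_functor] functor_mzero[OF F_functor]
  functor_mneg[OF F_functor]

text \<open>The inverse of the automorphism \<open>F\<close> on the nose, so that rotations can be
  undone without replacing objects by isomorphic ones.\<close>

definition G :: "('o, 'm) endofunctor" where
  "G = (SOME G. additive_functor C G \<and> eq_functor C (comp_functor G F) id_functor \<and>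
          eq_functor C (comp_functor F G) id_functor)"

lemma G_spec: "additive_functor C G \<and> eq_functor C (comp_functor G F) id_functor \<and>
    eq_functor C (comp_functor F G) id_functor"
  unfolding G_def by (rule someI_ex) (use shift in \<open>auto simp: automorphism_def\<close>)

lemma G_functor: "additive_functor C G"
  using G_spec by blast

lemmas G_simps [simp] = functor_obj[OF G_functor] functor_id[OF G_functor] functor_arrow[OF G_functor]
  functor_comp[OF G_functor] functor_madd[OF G_functor] functor_mzero[OF G_functor]
  functor_mneg[OF G_functor]

lemma GF_obj [simp]: "x \<in> Obj C \<Longrightarrow> fobj G (fobj F x) = x"
  and FG_obj [simp]: "x \<in> Obj C \<Longrightarrow> fobj F (fobj G x) = x"
  using G_spec by (auto simp: eq_functor_def comp_functor_def id_functor_def)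

lemma GF_mor [simp]: "arrow f \<Longrightarrow> fmor G (fmor F f) = f"
  and FG_mor [simp]: "arrow f \<Longrightarrow> fmor F (fmor G f) = f"
  using G_spec arrow_mor[of f] arrow_objs[of f]
  unfolding eq_functor_def comp_functor_def id_functor_def by force+

text \<open>The integer multiple occurring in \<open>left_rotation\<close>, but with the Hom group
  read off from the morphism; \<open>rot_sign_eq\<close> reduces it to the parity of
  \<open>d\<close>.\<close>

definition rot_sign :: "'m \<Rightarrow> 'm" where
  "rot_sign f = add_pow (Hom C (src f) (tgt f)) ((-1) ^ d :: int) f"

lemma rot_sign_eq: "arrow f \<Longrightarrow> rot_sign f = (if even d then f else mneg f)"
proof -
  assume f: "arrow f"
  then interpret abelian_group "Hom C (src f) (tgt f)" using hom_group by simp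
  have "f \<in> carrier (add_monoid (Hom C (src f) (tgt f)))" using arrow_mor[OF f] by simp
  then show ?thesis
    using group.int_pow_1[OF a_group, of f] group.int_pow_neg[OF a_group, of f 1]
    by (auto simp: rot_sign_def add_pow_def mneg_def a_inv_def)
qed

section \<open>Entries of angles, rotations and trivial angles\<close>

lemma angle_length:
  assumes "s \<in> Angles"
  shows "length (objs s) = d + 2" "length (mors s) = d + 2"
  using angle_sequence[OF assms] by (auto simp: is_sequence_def)

lemma xobj_less: "length (objs s) = d + 2 \<Longrightarrow> k < d + 2 \<Longrightarrow> xobj F s k = objs s ! k"
  by (simp add: xobj_def nth_append)

lemma xobj_last: "length (objs s) = d + 2 \<Longrightarrow> xobj F s (d + 2) = fobj F (objs s ! 0)"
  by (cases "objs s") (simp_all add: xobj_def nth_append)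

lemma xmor_less: "length fs = d + 2 \<Longrightarrow> k < d + 2 \<Longrightarrow> xmor F fs k = fs ! k"
  by (simp add: xmor_def nth_append)

lemma xmor_last: "length fs = d + 2 \<Longrightarrow> xmor F fs (d + 2) = fmor F (fs ! 0)"
  by (cases "fs") (simp_all add: xmor_def nth_append)

lemma sequence_obj:
  assumes "is_sequence C F d s"
  shows "k < d + 2 \<Longrightarrow> objs s ! k \<in> Obj C" "k \<le> d + 2 \<Longrightarrow> xobj F s k \<in> Obj C"
proof -
  have l: "length (objs s) = d + 2" "set (objs s) \<subseteq> Obj C" using assms by (auto simp: is_sequence_def)
  show o: "objs s ! k \<in> Obj C" if "k < d + 2" for k using l that by auto
  have "xobj F s (d + 2) \<in> Obj C" using xobj_last[OF l(1)] o[of 0] by simp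
  moreover have "xobj F s k \<in> Obj C" if "k < d + 2" using xobj_less[OF l(1) that] o[OF that] by simp
  ultimately show "k \<le> d + 2 \<Longrightarrow> xobj F s k \<in> Obj C" by (cases "k = d + 2") simp_all
qed

lemma sequence_arrow:
  assumes "is_sequence C F d s" "k < d + 2"
  shows "arrow (mors s ! k)" "src (mors s ! k) = objs s ! k" "tgt (mors s ! k) = xobj F s (k + 1)"
proof -
  have "mors s ! k \<in> mor C (objs s ! k) (xobj F s (k + 1))" "length (objs s) = d + 2"
    using assms xobj_less[of s k] by (auto simp: is_sequence_def)
  moreover have "objs s ! k \<in> Obj C" "xobj F s (k + 1) \<in> Obj C"
    using sequence_obj[OF assms(1)] assms(2) by simp_all
  ultimately show "arrow (mors s ! k)" "src (mors s ! k) = objs s ! k" "tgt (mors s ! k) = xobj F s (k + 1)"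
    using mor_arrow xobj_less[of s k] assms(2) by auto
qed

lemmas angle_obj = sequence_obj[OF angle_sequence]
lemmas angle_arrow = sequence_arrow[OF angle_sequence]

lemma left_rotation_angle: "s \<in> Angles \<Longrightarrow> left_rotation C F d s \<in> Angles"
  using N2 angle_sequence by blast

lemma left_rotation_nth:
  assumes "s \<in> Angles" "k < d + 2"
  shows "objs (left_rotation C F d s) ! k =
      (if k < d + 1 then objs s ! (k + 1) else fobj F (objs s ! 0))"
    and "mors (left_rotation C F d s) ! k =
      (if k < d + 1 then mors s ! (k + 1) else rot_sign (fmor F (mors s ! 0)))"
proof -
  note l = angle_length[OF assms(1)]
  show "objs (left_rotation C F d s) ! k =
      (if k < d + 1 then objs s ! (k + 1) else fobj F (objs s ! 0))"
    using assms(2) l by (auto simp: left_rotation_def nth_append nth_tl)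
  have "tgt (mors s ! 0) = objs s ! 1"
    using angle_arrow(3)[OF assms(1), of 0] xobj_less[OF l(1), of 1] by simp
  then show "mors (left_rotation C F d s) ! k =
      (if k < d + 1 then mors s ! (k + 1) else rot_sign (fmor F (mors s ! 0)))"
    using assms(2) l angle_arrow[OF assms(1), of 0]
    by (auto simp: left_rotation_def nth_append nth_tl rot_sign_def)
qed

text \<open>The bound \<open>n \<le> d + 2\<close> makes each entry wrap around at most once, so
  that it carries at most one \<open>F\<close> and one sign.\<close>

lemma rotate_angle:
  assumes "s \<in> Angles" "n \<le> d + 2"
  shows "\<exists>s' \<in> Angles. (\<forall>k < d + 2. objs s' ! k =
        (if k + n < d + 2 then objs s ! (k + n) else fobj F (objs s ! (k + n - (d + 2))))) \<and>
      (\<forall>k < d + 2. mors s' ! k =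
        (if k + n < d + 2 then mors s ! (k + n) else rot_sign (fmor F (mors s ! (k + n - (d + 2))))))"
  using assms(2)
proof (induction n)
  case 0
  then show ?case using assms(1) by (intro bexI[of _ s]) auto
next
  case (Suc n)
  then obtain s' where s': "s' \<in> Angles"
    and o: "\<And>k. k < d + 2 \<Longrightarrow> objs s' ! k =
        (if k + n < d + 2 then objs s ! (k + n) else fobj F (objs s ! (k + n - (d + 2))))"
    and m: "\<And>k. k < d + 2 \<Longrightarrow> mors s' ! k =
        (if k + n < d + 2 then mors s ! (k + n) else rot_sign (fmor F (mors s ! (k + n - (d + 2)))))"
    by auto
  have "objs (left_rotation C F d s') ! k = (if k + Suc n < d + 2 then objs s ! (k + Suc n)
      else fobj F (objs s ! (k + Suc n - (d + 2))))" if "k < d + 2" for k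
  proof (cases "k < d + 1")
    case True
    then show ?thesis using left_rotation_nth(1)[OF s' that] o[of "k + 1"] by simp
  next
    case False
    with that have "k = d + 1" by simp
    then show ?thesis using left_rotation_nth(1)[OF s' that] o[of 0] Suc.prems by simp
  qed
  moreover have "mors (left_rotation C F d s') ! k = (if k + Suc n < d + 2 then mors s ! (k + Suc n)
      else rot_sign (fmor F (mors s ! (k + Suc n - (d + 2)))))" if "k < d + 2" for k
  proof (cases "k < d + 1")
    case True
    then show ?thesis using left_rotation_nth(2)[OF s' that] m[of "k + 1"] by simp
  next
    case False
    with that have "k = d + 1" by simp
    then show ?thesis using left_rotation_nth(2)[OF s' that] m[of 0] Suc.prems by simp
  qed
  ultimately show ?case using left_rotation_angle[OF s'] by blast
qed

lemma trivial_nth: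
  assumes "c \<in> Obj C" "zero_object C z"
  shows "k < d + 2 \<Longrightarrow> objs (trivial_sequence C F d c z) ! k = (if k < 2 then c else z)"
    and "mors (trivial_sequence C F d c z) ! 0 = Idn C c"
    and "1 \<le> k \<Longrightarrow> k < d + 2 \<Longrightarrow> mors (trivial_sequence C F d c z) ! k =
      mzero (objs (trivial_sequence C F d c z) ! k) (xobj F (trivial_sequence C F d c z) (k + 1))"
proof -
  let ?t = "trivial_sequence C F d c z"
  show "objs ?t ! k = (if k < 2 then c else z)" if "k < d + 2"
    using that by (auto simp: trivial_sequence_def Let_def nth_Cons split: nat.split)
  show "mors ?t ! 0 = Idn C c" by (simp add: trivial_sequence_def Let_def)
  assume k: "1 \<le> k" "k < d + 2"
  then obtain l where l: "k = Suc l" by (cases k) auto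
  have "mors ?t ! k = mzero ((objs ?t @ [fobj F c]) ! k) ((objs ?t @ [fobj F c]) ! (k + 1))"
    using k l by (simp add: trivial_sequence_def Let_def mzero_def del: upt_Suc append_Cons)
  moreover have "xobj F ?t k = (objs ?t @ [fobj F c]) ! k" for k
    by (simp add: xobj_def trivial_sequence_def Let_def)
  moreover have "xobj F ?t k = objs ?t ! k"
    using k angle_length(1)[OF N1_trivial[OF assms]] xobj_less by simp
  ultimately show "mors ?t ! k = mzero (objs ?t ! k) (xobj F ?t (k + 1))" by simp
qed

section \<open>Consequences of (N3): vanishing composites and weak kernels\<close>

lemma sequence_mor_arrow:
  assumes "is_sequence_mor C F d b c \<phi>" "is_sequence C F d b" "is_sequence C F d c"
  shows "k < d + 2 \<Longrightarrow> arrow (\<phi> ! k)" "k < d + 2 \<Longrightarrow> src (\<phi> ! k) = objs b ! k"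
    "k < d + 2 \<Longrightarrow> tgt (\<phi> ! k) = objs c ! k"
proof -
  show "arrow (\<phi> ! k)" "src (\<phi> ! k) = objs b ! k" "tgt (\<phi> ! k) = objs c ! k" if k: "k < d + 2" for k
  proof -
    have "\<phi> ! k \<in> mor C (objs b ! k) (objs c ! k)" using assms(1) k by (simp add: is_sequence_mor_def)
    then show "arrow (\<phi> ! k)" "src (\<phi> ! k) = objs b ! k" "tgt (\<phi> ! k) = objs c ! k"
      using mor_arrow sequence_obj(1)[OF assms(2) k] sequence_obj(1)[OF assms(3) k] by blast+
  qed
qed

text \<open>By (N3), the pair of the identity and \<open>mors s ! 0\<close> extends to a morphism
  from the trivial angle on the first object to \<open>s\<close>; its second square factors the
  composite through a zero object.\<close>

lemma angle_comp_zero_first: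
  assumes "s \<in> Angles"
  shows "mors s ! 1 \<cdot> mors s ! 0 = mzero (objs s ! 0) (objs s ! 2)"
proof -
  obtain z where z: "zero_object C z" using ex_zero_object by blast
  define c0 where "c0 = objs s ! 0"
  define t where "t = trivial_sequence C F d c0 z"
  have c0: "c0 \<in> Obj C" using angle_obj(1)[OF assms] by (simp add: c0_def)
  have t: "t \<in> Angles" using N1_trivial[OF c0 z] by (simp add: t_def)
  note l = angle_length[OF assms] angle_length[OF t]
  have o: "objs t ! 0 = c0" "objs t ! 1 = c0" "objs t ! 2 = z"
    using trivial_nth(1)[OF c0 z] d_pos by (auto simp: t_def)
  note a = angle_arrow[OF assms, of 0] angle_arrow[OF assms, of 1]
  note x = xobj_less[OF l(1), of 1] xobj_less[OF l(1), of 2] xobj_less[OF l(3), of 2]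
  have m: "mors t ! 0 = Idn C c0" "mors t ! 1 = mzero c0 z"
    using trivial_nth(2)[OF c0 z] trivial_nth(3)[OF c0 z, of 1] o x(3) d_pos by (auto simp: t_def numeral_2_eq_2)
  have "\<exists>\<phi>. is_sequence_mor C F d t s \<phi> \<and> \<phi> ! 0 = Idn C c0 \<and> \<phi> ! 1 = mors s ! 0"
    by (rule N3[OF t assms]) (use o m a x c0 angle_obj(1)[OF assms] in \<open>auto simp: mor_iff c0_def\<close>)
  then obtain \<phi> where \<phi>: "is_sequence_mor C F d t s \<phi>" "\<phi> ! 1 = mors s ! 0" by blast
  note pa = sequence_mor_arrow[OF \<phi>(1) angle_sequence[OF t] angle_sequence[OF assms]]
  have "length \<phi> = d + 2" and "xmor F \<phi> (1 + 1) \<cdot> mors t ! 1 = mors s ! 1 \<cdot> \<phi> ! 1"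
    using \<phi>(1) d_pos unfolding is_sequence_mor_def by force+
  then have "mors s ! 1 \<cdot> mors s ! 0 = \<phi> ! 2 \<cdot> mzero c0 z"
    using d_pos m \<phi>(2) xmor_less[of \<phi> 2] by (simp add: numeral_2_eq_2)
  then show ?thesis using pa[of 2] o d_pos c0 z by (simp add: c0_def)
qed

text \<open>Rotating \<open>d + 1\<close> times brings the last morphism to the front and reduces
  this to the first composite, up to a sign that a zero morphism absorbs.\<close>

lemma angle_comp_zero_last:
  assumes "s \<in> Angles"
  shows "fmor F (mors s ! 0) \<cdot> mors s ! (d + 1) = mzero (objs s ! (d + 1)) (fobj F (objs s ! 1))"
proof -
  obtain s' where s': "s' \<in> Angles"
    and o: "\<And>k. k < d + 2 \<Longrightarrow> objs s' ! k =
        (if k + (d + 1) < d + 2 then objs s ! (k + (d + 1)) else fobj F (objs s ! (k + (d + 1) - (d + 2))))"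
    and m: "\<And>k. k < d + 2 \<Longrightarrow> mors s' ! k =
        (if k + (d + 1) < d + 2 then mors s ! (k + (d + 1))
         else rot_sign (fmor F (mors s ! (k + (d + 1) - (d + 2)))))"
    using rotate_angle[OF assms, of "d + 1"] by auto
  have "mors s' ! 0 = mors s ! (d + 1)" "mors s' ! 1 = rot_sign (fmor F (mors s ! 0))"
    "objs s' ! 0 = objs s ! (d + 1)" "objs s' ! 2 = fobj F (objs s ! 1)"
    using m[of 0] m[of 1] o[of 0] o[of 2] d_pos by auto
  then have z: "rot_sign (fmor F (mors s ! 0)) \<cdot> mors s ! (d + 1) =
      mzero (objs s ! (d + 1)) (fobj F (objs s ! 1))"
    using angle_comp_zero_first[OF s'] by simp
  note l = angle_length[OF assms]
  note a = angle_arrow[OF assms, of 0] angle_arrow[OF assms, of "d + 1"] xobj_less[OF l(1), of 1]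
    xobj_last[OF l(1)]
  show ?thesis
  proof (cases "even d")
    case True
    then show ?thesis using z a by (simp add: rot_sign_eq)
  next
    case False
    then have "mneg (fmor F (mors s ! 0) \<cdot> mors s ! (d + 1)) =
        mzero (objs s ! (d + 1)) (fobj F (objs s ! 1))"
      using z a by (simp add: rot_sign_eq)
    then have "mneg (mneg (fmor F (mors s ! 0) \<cdot> mors s ! (d + 1))) =
        mneg (mzero (objs s ! (d + 1)) (fobj F (objs s ! 1)))" by simp
    then show ?thesis using a angle_obj(1)[OF assms] by simp
  qed
qed

text \<open>(N3) prescribes the first two components, so \<open>g\<close> must come first: in the
  left rotations of the trivial angle on \<open>src g\<close> and of \<open>s\<close>, the pair of
  \<open>g\<close> and zero commutes exactly because \<open>mors s ! 1\<close> kills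
  \<open>g\<close>. The wanted factor appears, shifted by \<open>F\<close>, as the last component of
  the resulting morphism.\<close>

lemma angle_weak_kernel:
  assumes s: "s \<in> Angles" and g: "arrow g" "tgt g = objs s ! 1"
    and 0: "mors s ! 1 \<cdot> g = mzero (src g) (objs s ! 2)"
  shows "\<exists>h. arrow h \<and> src h = src g \<and> tgt h = objs s ! 0 \<and> mors s ! 0 \<cdot> h = g"
proof -
  obtain z where z: "zero_object C z" using ex_zero_object by blast
  define x where "x = src g"
  have x: "x \<in> Obj C" using g by (simp add: x_def)
  define t where "t = trivial_sequence C F d x z"
  have t: "t \<in> Angles" using N1_trivial[OF x z] by (simp add: t_def)
  define b where "b = left_rotation C F d t"
  define c where "c = left_rotation C F d s"
  have bc: "b \<in> Angles" "c \<in> Angles" using left_rotation_angle s t by (simp_all add: b_def c_def)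
  note l = angle_length[OF s] angle_length[OF t]
  have so: "\<And>k. k < d + 2 \<Longrightarrow> objs s ! k \<in> Obj C" using angle_obj(1)[OF s] .
  have to: "objs t ! 0 = x" "objs t ! 1 = x" "objs t ! 2 = z" "xobj F t 2 = z"
    using trivial_nth(1)[OF x z] d_pos xobj_less[OF l(3), of 2] by (auto simp: t_def)
  have tm: "mors t ! 0 = Idn C x" "mors t ! 1 = mzero x z"
    using trivial_nth(2)[OF x z] trivial_nth(3)[OF x z, of 1] to d_pos by (auto simp: t_def numeral_2_eq_2)
  have bo: "objs b ! 0 = x" "objs b ! 1 = z" "objs b ! (d + 1) = fobj F x"
    "mors b ! 0 = mzero x z" "mors b ! (d + 1) = rot_sign (fmor F (Idn C x))"
    using left_rotation_nth[OF t, of 0] left_rotation_nth[OF t, of 1]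
      left_rotation_nth[OF t, of "d + 1"] to tm d_pos by (auto simp: b_def numeral_2_eq_2)
  have co: "objs c ! 0 = objs s ! 1" "objs c ! 1 = objs s ! 2" "objs c ! (d + 1) = fobj F (objs s ! 0)"
    "mors c ! 0 = mors s ! 1" "mors c ! (d + 1) = rot_sign (fmor F (mors s ! 0))"
    using left_rotation_nth[OF s, of 0] left_rotation_nth[OF s, of 1]
      left_rotation_nth[OF s, of "d + 1"] d_pos by (auto simp: c_def numeral_2_eq_2)
  have zo: "z \<in> Obj C" using z by (simp add: zero_object_iff)
  have "\<exists>\<phi>. is_sequence_mor C F d b c \<phi> \<and> \<phi> ! 0 = g \<and> \<phi> ! 1 = mzero z (objs s ! 2)"
    by (rule N3[OF bc])
      (use 0 g d_pos zo in \<open>auto simp: bo co x so mor_iff x_def simp del: One_nat_def\<close>)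
  then obtain \<phi> where \<phi>: "is_sequence_mor C F d b c \<phi>" "\<phi> ! 0 = g" by blast
  define h where "h = \<phi> ! (d + 1)"
  have h: "arrow h" "src h = fobj F x" "tgt h = fobj F (objs s ! 0)"
    using sequence_mor_arrow[OF \<phi>(1) angle_sequence[OF bc(1)] angle_sequence[OF bc(2)], of "d + 1"]
      bo co by (simp_all add: h_def)
  have "length \<phi> = d + 2" and "xmor F \<phi> (d + 1 + 1) \<cdot> mors b ! (d + 1) = mors c ! (d + 1) \<cdot> \<phi> ! (d + 1)"
    using \<phi>(1) unfolding is_sequence_mor_def by force+
  \<comment> \<open>The last square involves the morphisms that wrapped around in both rotations;
    they carry the same sign, which therefore cancels.\<close>
  then have e: "fmor F g \<cdot> rot_sign (fmor F (Idn C x)) = rot_sign (fmor F (mors s ! 0)) \<cdot> h"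
    using \<phi>(2) xmor_last[of \<phi>] bo co by (simp add: h_def)
  note m = angle_arrow[OF s, of 0, simplified]
  have mo: "src (mors s ! 0) = objs s ! 0" "tgt (mors s ! 0) = objs s ! 1"
    using m xobj_less[OF l(1), of 1] by auto
  have "fmor F g = fmor F (mors s ! 0) \<cdot> h"
  proof (cases "even d")
    case True
    then show ?thesis using e m mo h g x by (simp add: rot_sign_eq x_def)
  next
    case False
    then have "mneg (fmor F g) = mneg (fmor F (mors s ! 0) \<cdot> h)"
      using e m(1) mo h g x by (simp add: rot_sign_eq x_def)
    then have "mneg (mneg (fmor F g)) = mneg (mneg (fmor F (mors s ! 0) \<cdot> h))" by simp
    then show ?thesis using m(1) mo h g by simp
  qed
  then have "fmor G (fmor F g) = fmor G (fmor F (mors s ! 0) \<cdot> h)" by simp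
  then have "g = mors s ! 0 \<cdot> fmor G h" using m(1) mo h g by simp
  moreover have "arrow (fmor G h)" "src (fmor G h) = src g" "tgt (fmor G h) = objs s ! 0"
    using h x so by (simp_all add: x_def)
  ultimately show ?thesis by metis
qed


text \<open>The morphism \<open>f\<close> out of place \<open>d\<close> is followed by a map into
  \<open>F\<close> of a zero object, so the identity lifts along \<open>f\<close> and gives a right
  inverse \<open>g\<close>. Then \<open>g f - 1\<close> is killed by \<open>f\<close>, hence factors
  through the zero object at place \<open>d - 1\<close>.\<close>

lemma zero_head_angle_iso:
  assumes s: "s \<in> Angles" and z: "\<And>k. k < d \<Longrightarrow> zero_object C (objs s ! k)"
  shows "iso_obj C (objs s ! d) (objs s ! (d + 1))"
proof -
  note l = angle_length[OF s] and so = angle_obj(1)[OF s]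
  define f where "f = mors s ! d"
  have f: "arrow f" "src f = objs s ! d" "tgt f = objs s ! (d + 1)"
    using angle_arrow[OF s, of d] xobj_less[OF l(1), of "d + 1"] by (simp_all add: f_def)
  obtain s' where s': "s' \<in> Angles"
    and o: "\<And>k. k < d + 2 \<Longrightarrow> objs s' ! k =
        (if k + d < d + 2 then objs s ! (k + d) else fobj F (objs s ! (k + d - (d + 2))))"
    and m: "\<And>k. k < d + 2 \<Longrightarrow> mors s' ! k =
        (if k + d < d + 2 then mors s ! (k + d) else rot_sign (fmor F (mors s ! (k + d - (d + 2)))))"
    using rotate_angle[OF s, of d] by auto
  have s'o: "objs s' ! 0 = objs s ! d" "objs s' ! 1 = objs s ! (d + 1)" "mors s' ! 0 = f"
    "objs s' ! 2 = fobj F (objs s ! 0)"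
    using o[of 0] o[of 1] o[of 2] m[of 0] d_pos by (auto simp: f_def)
  have z2: "zero_object C (objs s' ! 2)" using s'o(4) functor_zero_object[OF F_functor z] d_pos by simp
  have m1: "arrow (mors s' ! 1)" "src (mors s' ! 1) = objs s ! (d + 1)" "tgt (mors s' ! 1) = objs s' ! 2"
    using angle_arrow[OF s', of 1] s'o xobj_less[OF angle_length(1)[OF s'], of 2] d_pos
    by (auto simp: numeral_2_eq_2)
  have "mors s' ! 1 \<cdot> Idn C (objs s ! (d + 1)) = mzero (objs s ! (d + 1)) (objs s' ! 2)"
    using zero_object_arrow(1)[OF z2 m1(1) m1(3)] m1 by simp
  then obtain g where g: "arrow g" "src g = objs s ! (d + 1)" "tgt g = objs s ! d"
      "f \<cdot> g = Idn C (objs s ! (d + 1))"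
    using angle_weak_kernel[OF s', of "Idn C (objs s ! (d + 1))"] s'o so[of "d + 1"] by auto
  have d1: "d - 1 \<le> d + 2" by simp
  \<comment> \<open>Rotation by \<open>d\<close> put \<open>f\<close> first; rotation by
    \<open>d - 1\<close> puts it second, where the weak kernel property describes the maps killed by
    \<open>f\<close>.\<close>
  obtain s'' where s'': "s'' \<in> Angles"
    and o: "\<And>k. k < d + 2 \<Longrightarrow> objs s'' ! k =
        (if k + (d - 1) < d + 2 then objs s ! (k + (d - 1)) else fobj F (objs s ! (k + (d - 1) - (d + 2))))"
    and m: "\<And>k. k < d + 2 \<Longrightarrow> mors s'' ! k =
        (if k + (d - 1) < d + 2 then mors s ! (k + (d - 1)) else rot_sign (fmor F (mors s ! (k + (d - 1) - (d + 2)))))"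
    using rotate_angle[OF s, of "d - 1", OF d1] by blast
  have s''o: "objs s'' ! 0 = objs s ! (d - 1)" "objs s'' ! 1 = objs s ! d"
    "objs s'' ! 2 = objs s ! (d + 1)" "mors s'' ! 1 = f"
    using o[of 0] o[of 1] o[of 2] m[of 1] d_pos by (auto simp: f_def)
  define h where "h = g \<cdot> f \<boxplus> mneg (Idn C (objs s ! d))"
  have od: "objs s ! d \<in> Obj C" using so by simp
  have h: "arrow h" "src h = objs s ! d" "tgt h = objs s ! d"
    "f \<cdot> h = mzero (objs s ! d) (objs s ! (d + 1))"
    using f g od reassoc[OF g(4)] by (simp_all add: h_def)
  then obtain h' where h': "arrow h'" "src h' = objs s ! d" "tgt h' = objs s ! (d - 1)"
      "mors s'' ! 0 \<cdot> h' = h"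
    using angle_weak_kernel[OF s'', of h] s''o by auto
  have "zero_object C (objs s ! (d - 1))" using z d_pos by simp
  from zero_object_arrow(1)[OF this h'(1,3)] h'(2)
  have h'0: "h' = mzero (objs s ! d) (objs s ! (d - 1))" by simp
  have "h = mzero (objs s ! d) (objs s ! d)"
    unfolding h'(4)[symmetric] h'0
    using angle_arrow[OF s'', of 0] s''o od xobj_less[OF angle_length(1)[OF s''], of 1] by simp
  then have "mneg (g \<cdot> f) = mneg (Idn C (objs s ! d))"
    using f g od mneg_eqI[of "g \<cdot> f" "mneg (Idn C (objs s ! d))"] unfolding h_def by simp
  then have "mneg (mneg (g \<cdot> f)) = mneg (mneg (Idn C (objs s ! d)))" by simp
  then have "g \<cdot> f = Idn C (objs s ! d)" using f g od by simp
  then show ?thesis unfolding iso_obj_iff using f g by blast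
qed

section \<open>Splitting off a trivial angle\<close>

text \<open>The maps \<open>J\<close> and \<open>Q\<close> are given only place by place.
  Compressing the differential of \<open>s\<close> to \<open>Q m J\<close> turns the complements
  into a sequence, and \<open>J\<close>, \<open>Q\<close> commute with it automatically: the
  component \<open>P m J\<close> of \<open>m J\<close> in \<open>t\<close> vanishes because
  \<open>P\<close> is a morphism of sequences, and dually for \<open>Q m I\<close>. So closure under
  summands applies.\<close>

lemma angle_complement:
  assumes s: "s \<in> Angles" and t: "is_sequence C F d t"
    and I: "is_sequence_mor C F d t s I" and P: "is_sequence_mor C F d s t P"
    and len: "length as = d + 2" "length J = d + 2" "length Q = d + 2"
    and b: "\<And>k. k < d + 2 \<Longrightarrow>
      biproduct C (objs s ! k) (objs t ! k) (as ! k) (I ! k) (J ! k) (P ! k) (Q ! k)"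
  shows "\<exists>a \<in> Angles. objs a = as"
proof -
  define a where "a = \<lparr>objs = as, mors = map (\<lambda>k. xmor F Q (k + 1) \<cdot> (mors s ! k \<cdot> J ! k)) [0..<d + 2]\<rparr>"
  have am: "mors a ! k = xmor F Q (k + 1) \<cdot> (mors s ! k \<cdot> J ! k)" if "k < d + 2" for k
    using that by (simp add: a_def del: upt_Suc)
  have ao: "objs a = as" by (simp add: a_def)
  note ss = angle_sequence[OF s]
  have lenIP: "length I = d + 2" "length P = d + 2" "length (objs t) = d + 2"
    using I P t by (auto simp: is_sequence_mor_def is_sequence_def)
  note l = angle_length[OF s] lenIP len
  have ax: "length (objs a) = d + 2" using ao len by simp
  \<comment> \<open>One place more than in \<open>b\<close>: at \<open>d + 2\<close> the biproduct
    is the image under \<open>F\<close> of the one at 0.\<close>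
  have bx: "biproduct C (xobj F s k) (xobj F t k) (xobj F a k)
      (xmor F I k) (xmor F J k) (xmor F P k) (xmor F Q k)" if "k \<le> d + 2" for k
  proof (cases "k = d + 2")
    case True
    then show ?thesis
      using functor_biproduct[OF F_functor b[of 0]] l ax ao by (simp add: xobj_last xmor_last del: add_2_eq_Suc')
  next
    case False
    with that have "k < d + 2" by simp
    then show ?thesis using b[of k] l ax ao by (simp add: xobj_less xmor_less)
  qed
  have bk: "biproduct C (objs s ! k) (objs t ! k) (objs a ! k) (I ! k) (J ! k) (P ! k) (Q ! k)"
    if "k < d + 2" for k using b[OF that] ao by simp
  have aa: "arrow (mors a ! k)" "src (mors a ! k) = objs a ! k" "tgt (mors a ! k) = xobj F a (k + 1)"
    if k: "k < d + 2" for k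
    using biproduct_comps(1-15)[OF bk[OF k]] biproduct_comps(1-15)[OF bx[of "k + 1"]]
      sequence_arrow[OF ss k] k by (simp_all add: am[OF k])
  have aseq: "is_sequence C F d a"
    unfolding is_sequence_def
  proof (intro conjI allI impI)
    show "length (objs a) = d + 2" "length (mors a) = d + 2" using len by (simp_all add: a_def)
    show "set (objs a) \<subseteq> Obj C"
      using biproduct_comps(3)[OF b] len ao by (auto simp: set_conv_nth)
    show "mors a ! k \<in> mor C (xobj F a k) (xobj F a (k + 1))" if k: "k < d + 2" for k
      using aa[OF k] xobj_less[OF ax k] arrow_mor by metis
  qed
  have Jcomm: "xmor F J (k + 1) \<cdot> (mors a ! k) = (mors s ! k) \<cdot> (J ! k)" if k: "k < d + 2" for k
  proof -
    note bb = bx[of "k + 1"]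
    note c = biproduct_comps(1-15)[OF bk[OF k]] biproduct_comps(1-15)[OF bb]
      sequence_arrow[OF ss k] sequence_arrow[OF t k]
    have "xmor F P (k + 1) \<cdot> mors s ! k = mors t ! k \<cdot> P ! k"
      using P k by (auto simp: is_sequence_mor_def)
    then have "xmor F P (k + 1) \<cdot> (mors s ! k \<cdot> J ! k) = mors t ! k \<cdot> (P ! k \<cdot> J ! k)"
      using reassoc[of "xmor F P (k + 1)" "mors s ! k" _ "J ! k"] c k by simp
    also have "\<dots> = mzero (src (J ! k)) (xobj F t (k + 1))"
      using biproduct_comps(19)[OF bk[OF k]] c k by simp
    finally have z: "xmor F P (k + 1) \<cdot> (mors s ! k \<cdot> J ! k) = mzero (src (J ! k)) (xobj F t (k + 1))" .
    have "(xmor F I (k + 1) \<cdot> (xmor F P (k + 1) \<cdot> (mors s ! k \<cdot> J ! k))) \<boxplus>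
        (xmor F J (k + 1) \<cdot> (xmor F Q (k + 1) \<cdot> (mors s ! k \<cdot> J ! k))) = mors s ! k \<cdot> J ! k"
      by (rule biproduct_decomp(1)[OF bb]) (use c k in simp_all)
    then show ?thesis using z c k by (simp add: am[OF k])
  qed
  have Qcomm: "xmor F Q (k + 1) \<cdot> (mors s ! k) = (mors a ! k) \<cdot> (Q ! k)" if k: "k < d + 2" for k
  proof -
    note bb = bx[of "k + 1"]
    note c = biproduct_comps(1-15)[OF bk[OF k]] biproduct_comps(1-15)[OF bb]
      sequence_arrow[OF ss k] sequence_arrow[OF t k]
    let ?h = "xmor F Q (k + 1) \<cdot> mors s ! k"
    have "xmor F I (k + 1) \<cdot> mors t ! k = mors s ! k \<cdot> I ! k"
      using I k by (auto simp: is_sequence_mor_def)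
    then have "?h \<cdot> (I ! k \<cdot> P ! k) = xmor F Q (k + 1) \<cdot> ((xmor F I (k + 1) \<cdot> mors t ! k) \<cdot> P ! k)"
      using c k by simp
    also have "\<dots> = mzero (objs s ! k) (xobj F a (k + 1))"
      using biproduct_comps(23)[OF bb] c k by simp
    finally have z: "?h \<cdot> (I ! k \<cdot> P ! k) = mzero (objs s ! k) (xobj F a (k + 1))" .
    have "(?h \<cdot> (I ! k \<cdot> P ! k)) \<boxplus> (?h \<cdot> (J ! k \<cdot> Q ! k)) = ?h"
      by (rule biproduct_decomp(2)[OF bk[OF k]]) (use c k in simp_all)
    then show ?thesis unfolding z using c k by (simp add: am[OF k])
  qed
  have "is_sequence_mor C F d a s J" "is_sequence_mor C F d s a Q"
    unfolding is_sequence_mor_def using Jcomm Qcomm len bk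
    by (auto simp: biproduct_def)
  then have "is_sequence_sum C F d s t a"
    unfolding is_sequence_sum_def using ss t aseq I P bk by blast
  then have "a \<in> Angles" using N1_summand[OF s] by blast
  then show ?thesis using ao by blast
qed

text \<open>Gaussian elimination: an identity component of the first morphism exhibits the trivial
  angle on \<open>c\<close> as a direct summand, and the complement is read off.\<close>

lemma angle_cancel:
  assumes s: "s \<in> Angles"
    and b0: "biproduct C (objs s ! 0) c A i j p q"
    and b1: "biproduct C (objs s ! 1) B c i' j' p' q'"
    and id: "q' \<cdot> (mors s ! 0 \<cdot> i) = Idn C c"
  shows "\<exists>a \<in> Angles. objs a = A # B # drop 2 (objs s)"
proof -
  obtain z where z: "zero_object C z" using ex_zero_object by blast
  then have zo: "z \<in> Obj C" "Idn C z = mzero z z" by (auto simp: zero_object_iff)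
  note l = angle_length[OF s]
  note c0 = biproduct_comps[OF b0] and c1 = biproduct_comps[OF b1]
  define m where "m = mors s ! 0"
  have m: "arrow m" "src m = objs s ! 0" "tgt m = objs s ! 1"
    using angle_arrow[OF s, of 0] xobj_less[OF l(1), of 1] by (simp_all add: m_def)
  \<comment> \<open>Commuting with the identity of the trivial angle forces the new structure maps:
    \<open>i\<close> must be paired with \<open>m i\<close>, and \<open>q'\<close> with
    \<open>q' m\<close>. The two biproducts are re-chosen to contain them.\<close>
  define r where "r = q' \<cdot> m"
  define k where "k = m \<cdot> i"
  have r: "arrow r" "src r = objs s ! 0" "tgt r = c" "r \<cdot> i = Idn C c"
    using m c0 c1 id by (simp_all add: r_def m_def)
  have k: "arrow k" "src k = c" "tgt k = objs s ! 1" "q' \<cdot> k = Idn C c"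
    using m c0 c1 id by (simp_all add: k_def m_def)
  obtain j1 where B0: "biproduct C (objs s ! 0) c A i j1 r q"
    using biproduct_change_projection[OF b0 r] by blast
  obtain p1 where B1: "biproduct C (objs s ! 1) c B k i' q' p1"
    using biproduct_change_inclusion[OF biproduct_commute[OF b1] k] by blast
  define t where "t = trivial_sequence C F d c z"
  have t: "t \<in> Angles" using N1_trivial[OF c0(2) z] by (simp add: t_def)
  note to = trivial_nth(1)[OF c0(2) z, folded t_def] and tm0 = trivial_nth(2)[OF c0(2) z, folded t_def]
    and tm = trivial_nth(3)[OF c0(2) z, folded t_def]
  \<comment> \<open>From place 2 on the trivial angle is zero, so there the complement is the whole
    object.\<close>
  define I where "I = map (\<lambda>n. if n = 0 then i else if n = 1 then k else mzero z (objs s ! n)) [0..<d + 2]"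
  define J where "J = map (\<lambda>n. if n = 0 then j1 else if n = 1 then i' else Idn C (objs s ! n)) [0..<d + 2]"
  define P where "P = map (\<lambda>n. if n = 0 then r else if n = 1 then q' else mzero (objs s ! n) z) [0..<d + 2]"
  define Q where "Q = map (\<lambda>n. if n = 0 then q else if n = 1 then p1 else Idn C (objs s ! n)) [0..<d + 2]"
  define as where "as = A # B # drop 2 (objs s)"
  have nth: "I ! n = (if n = 0 then i else if n = 1 then k else mzero z (objs s ! n))"
    "J ! n = (if n = 0 then j1 else if n = 1 then i' else Idn C (objs s ! n))"
    "P ! n = (if n = 0 then r else if n = 1 then q' else mzero (objs s ! n) z)"
    "Q ! n = (if n = 0 then q else if n = 1 then p1 else Idn C (objs s ! n))"
    if "n < d + 2" for n
    using that by (simp_all add: I_def J_def P_def Q_def del: upt_Suc)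
  have len: "length I = d + 2" "length J = d + 2" "length P = d + 2" "length Q = d + 2" "length as = d + 2"
    using l by (simp_all add: I_def J_def P_def Q_def as_def)
  have asn: "as ! n = (if n = 0 then A else if n = 1 then B else objs s ! n)" if "n < d + 2" for n
  proof -
    consider "n = 0" | "n = 1" | m where "n = Suc (Suc m)" by (metis One_nat_def old.nat.exhaust)
    then show ?thesis using that l by cases (simp_all add: as_def)
  qed
  have so: "objs s ! n \<in> Obj C" if "n < d + 2" for n using angle_obj(1)[OF s that] .
  have b: "biproduct C (objs s ! n) (objs t ! n) (as ! n) (I ! n) (J ! n) (P ! n) (Q ! n)"
    if n: "n < d + 2" for n
  proof -
    consider "n = 0" | "n = 1" | "n \<ge> 2" by linarith
    then show ?thesis
    proof cases
      case 1 then show ?thesis using B0 nth[OF n] to[OF n] asn[OF n] by simp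
    next
      case 2 then show ?thesis using B1 nth[OF n] to[OF n] asn[OF n] by simp
    next
      case 3
      then show ?thesis using nth[OF n] to[OF n] asn[OF n] so[OF n] zo
        by (simp add: biproduct_iff)
    qed
  qed
  note arrows = biproduct_comps(1-15)[OF b]
  note sa = angle_arrow[OF s] and ta = angle_arrow[OF t]
  have bx: "arrow (xmor F I n) \<and> src (xmor F I n) = xobj F t n \<and> tgt (xmor F I n) = xobj F s n"
    if "n \<le> d + 2" for n
  proof (cases "n = d + 2")
    case True
    then show ?thesis
      using arrows[of 0] len l angle_length(1)[OF t] by (simp add: xobj_last xmor_last del: add_2_eq_Suc')
  next
    case False
    with that have "n < d + 2" by simp
    then show ?thesis using arrows[of n] len l angle_length(1)[OF t] by (simp add: xobj_less xmor_less)
  qed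
  \<comment> \<open>The two squares not settled by the definitions, the second for \<open>I\<close>
    and the last for \<open>P\<close>, commute because consecutive composites in \<open>s\<close>
    vanish.\<close>
  have mz: "mors s ! 1 \<cdot> (m \<cdot> i) = mzero c (objs s ! 2)"
  proof -
    have "mors s ! 1 \<cdot> m = mzero (objs s ! 0) (objs s ! 2)"
      using angle_comp_zero_first[OF s] by (simp add: m_def)
    then show ?thesis
      using reassoc[of "mors s ! 1" m _ i] m c0 sa[of 1] so[of 2] d_pos by simp
  qed
  have rz: "fmor F r \<cdot> mors s ! (d + 1) = mzero (objs s ! (d + 1)) (fobj F c)"
  proof -
    have "fmor F r \<cdot> mors s ! (d + 1) = fmor F q' \<cdot> (fmor F m \<cdot> mors s ! (d + 1))"
      using m c1 sa[of "d + 1"] xobj_last[OF l(1)] by (simp add: r_def)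
    also have "fmor F m \<cdot> mors s ! (d + 1) = mzero (objs s ! (d + 1)) (fobj F (objs s ! 1))"
      using angle_comp_zero_last[OF s] by (simp add: m_def)
    finally show ?thesis using c1 so[of "d + 1"] by simp
  qed
  have "is_sequence_mor C F d t s I"
    unfolding is_sequence_mor_def
  proof (intro conjI allI impI)
    show "I ! n \<in> mor C (objs t ! n) (objs s ! n)" if "n < d + 2" for n
      using b[OF that] by (simp add: biproduct_def)
    show "xmor F I (n + 1) \<cdot> mors t ! n = mors s ! n \<cdot> I ! n" if n: "n < d + 2" for n
    proof (cases "n = 0")
      case True
      then show ?thesis
        using tm0 nth[of 0] nth[of 1] len k by (simp add: xmor_less k_def m_def)
    next
      case False
      then have "xmor F I (n + 1) \<cdot> mors t ! n = mzero (objs t ! n) (xobj F s (n + 1))"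
        using tm[of n] n bx[of "n + 1"] angle_obj(1)[OF t n] by simp
      moreover have "mors s ! n \<cdot> I ! n = mzero (objs t ! n) (xobj F s (n + 1))"
      proof (cases "n = 1")
        case True
        then show ?thesis
          using nth[of 1] to[of 1] mz xobj_less[OF l(1), of 2] d_pos by (simp add: k_def numeral_2_eq_2)
      next
        case F: False
        then show ?thesis using \<open>n \<noteq> 0\<close> n nth(1)[OF n] to[OF n] sa[OF n] zo by simp
      qed
      ultimately show ?thesis by simp
    qed
  qed (rule len)
  moreover have "is_sequence_mor C F d s t P"
    unfolding is_sequence_mor_def
  proof (intro conjI allI impI)
    show "P ! n \<in> mor C (objs s ! n) (objs t ! n)" if "n < d + 2" for n
      using b[OF that] by (simp add: biproduct_def)
    show "xmor F P (n + 1) \<cdot> mors s ! n = mors t ! n \<cdot> P ! n" if n: "n < d + 2" for n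
    proof (cases "n = 0")
      case True
      then show ?thesis
        using tm0 nth[of 0] nth[of 1] len r by (simp add: xmor_less r_def m_def)
    next
      case False
      then have "mors t ! n \<cdot> P ! n = mzero (objs s ! n) (xobj F t (n + 1))"
        using tm[of n] n arrows[OF n] angle_obj(2)[OF t, of "n + 1"] by simp
      moreover have "xmor F P (n + 1) \<cdot> mors s ! n = mzero (objs s ! n) (xobj F t (n + 1))"
      proof (cases "n = d + 1")
        case True
        then show ?thesis
          using rz nth[of 0] to[of 0] len xmor_last[of P] xobj_last[OF angle_length(1)[OF t]] by simp
      next
        case F: False
        then have "n + 1 < d + 2" using n by simp
        then show ?thesis
          using \<open>n \<noteq> 0\<close> n nth(3)[of "n + 1"] to[of "n + 1"] sa[OF n] zo len l
            xobj_less[OF angle_length(1)[OF t]] by (simp add: xmor_less xobj_less)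
      qed
      ultimately show ?thesis by simp
    qed
  qed (rule len)
  ultimately show ?thesis
    using angle_complement[OF s angle_sequence[OF t] _ _ len(5,2,4) b] by (auto simp: as_def)
qed


section \<open>Angles recorded by their objects\<close>

text \<open>Grothendieck groups see only objects, so morphisms and rotation signs are forgotten
  here. A function on all naturals makes rotation an index computation; its values beyond
  \<open>d + 1\<close> are arbitrary.\<close>

definition angle_on :: "(nat \<Rightarrow> 'o) \<Rightarrow> bool" where
  "angle_on c \<longleftrightarrow> (\<exists>s \<in> Angles. \<forall>k < d + 2. objs s ! k = c k)"

lemma angle_on_obj: "angle_on c \<Longrightarrow> k < d + 2 \<Longrightarrow> c k \<in> Obj C"
  unfolding angle_on_def using angle_obj(1) by fastforce

lemma angle_on_cong: "\<lbrakk>angle_on c; \<And>k. k < d + 2 \<Longrightarrow> c k = c' k\<rbrakk> \<Longrightarrow> angle_on c'"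
  by (auto simp: angle_on_def)

lemma angle_on_zero_head:
  assumes "angle_on c" "\<And>k. k < d \<Longrightarrow> zero_object C (c k)"
  shows "iso_obj C (c d) (c (d + 1))"
proof -
  obtain s where "s \<in> Angles" "\<And>k. k < d + 2 \<Longrightarrow> objs s ! k = c k"
    using assms(1) by (auto simp: angle_on_def)
  then show ?thesis using zero_head_angle_iso[of s] assms(2) by simp
qed

lemma angle_on_rotate:
  assumes "angle_on c" "n \<le> d + 2"
  shows "angle_on (\<lambda>k. if k + n < d + 2 then c (k + n) else fobj F (c (k + n - (d + 2))))"
proof -
  obtain s where s: "s \<in> Angles" "\<And>k. k < d + 2 \<Longrightarrow> objs s ! k = c k"
    using assms(1) by (auto simp: angle_on_def)
  obtain s' where s': "s' \<in> Angles"
    and o: "\<And>k. k < d + 2 \<Longrightarrow> objs s' ! k =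
        (if k + n < d + 2 then objs s ! (k + n) else fobj F (objs s ! (k + n - (d + 2))))"
    using rotate_angle[OF s(1) assms(2)] by auto
  have "objs s' ! k = (if k + n < d + 2 then c (k + n) else fobj F (c (k + n - (d + 2))))"
    if "k < d + 2" for k
    using o[OF that] s(2)[of "k + n"] s(2)[of "k + n - (d + 2)"] assms(2) that by auto
  then show ?thesis using s' unfolding angle_on_def by blast
qed

text \<open>The backward direction of (N2) needs a sequence whose left rotation is literally
  \<open>s\<close>; it is built with the strict inverse \<open>G\<close>.\<close>

lemma angle_on_unrotate1:
  assumes "angle_on c"
  shows "angle_on (\<lambda>k. if k = 0 then fobj G (c (d + 1)) else c (k - 1))"
proof -
  obtain s where s: "s \<in> Angles" and c: "\<And>k. k < d + 2 \<Longrightarrow> objs s ! k = c k"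
    using assms(1) by (auto simp: angle_on_def)
  note l = angle_length[OF s]
  define m where "m = mors s ! (d + 1)"
  have m: "arrow m" "src m = objs s ! (d + 1)" "tgt m = fobj F (objs s ! 0)"
    using angle_arrow[OF s, of "d + 1"] xobj_last[OF l(1)] by (simp_all add: m_def)
  have so: "objs s ! k \<in> Obj C" if "k < d + 2" for k using angle_obj(1)[OF s that] .
  \<comment> \<open>The sign is its own inverse, so this one cancels the sign inserted by
    \<open>left_rotation\<close>.\<close>
  define g where "g = rot_sign (fmor G m)"
  have g: "arrow g" "src g = fobj G (objs s ! (d + 1))" "tgt g = objs s ! 0" "rot_sign (fmor F g) = m"
    using m so by (auto simp: g_def rot_sign_eq)
  define s' where "s' = \<lparr>objs = fobj G (objs s ! (d + 1)) # butlast (objs s), mors = g # butlast (mors s)\<rparr>"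
  have oo: "objs s' ! k = (if k = 0 then fobj G (objs s ! (d + 1)) else objs s ! (k - 1))" if "k < d + 2" for k
    using that l by (cases k) (simp_all add: s'_def nth_butlast)
  have mm: "mors s' ! k = (if k = 0 then g else mors s ! (k - 1))" if "k < d + 2" for k
    using that l by (cases k) (simp_all add: s'_def nth_butlast)
  have l': "length (objs s') = d + 2" "length (mors s') = d + 2" using l by (simp_all add: s'_def)
  have seq: "is_sequence C F d s'"
    unfolding is_sequence_def
  proof (intro conjI allI impI)
    show "length (objs s') = d + 2" "length (mors s') = d + 2" using l' .
    have "objs s' ! k \<in> Obj C" if "k < d + 2" for k
      using oo[OF that] so[of "k - 1"] so[of "d + 1"] that by auto
    then show "set (objs s') \<subseteq> Obj C" using l' by (auto simp: set_conv_nth)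
    show "mors s' ! k \<in> mor C (xobj F s' k) (xobj F s' (k + 1))" if k: "k < d + 2" for k
    proof (cases "k = 0")
      case True
      then show ?thesis
        using g so[of 0] so[of "d + 1"] oo[of 0] oo[of 1] mm[of 0] xobj_less[OF l'(1), of 0] xobj_less[OF l'(1), of 1]
        by (simp add: mor_iff)
    next
      case False
      have "xobj F s' (k + 1) = objs s ! k"
      proof (cases "k = d + 1")
        case True
        then show ?thesis using xobj_last[OF l'(1)] oo[of 0] so[of "d + 1"] by simp
      next
        case False
        then show ?thesis using xobj_less[OF l'(1), of "k + 1"] oo[of "k + 1"] k by simp
      qed
      moreover have "xobj F s' k = objs s ! (k - 1)" using xobj_less[OF l'(1) k] oo[OF k] False by simp
      ultimately show ?thesis
        using angle_arrow[OF s, of "k - 1"] xobj_less[OF l(1) k] False k so[OF k] so[of "k - 1"] mm[OF k]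
        by (simp add: mor_iff)
    qed
  qed
  have "left_rotation C F d s' = s"
  proof -
    have "objs (left_rotation C F d s') = butlast (objs s) @ [objs s ! (d + 1)]"
      using so[of "d + 1"] by (simp add: left_rotation_def s'_def)
    also have "\<dots> = objs s"
      using l by (metis Suc_eq_plus1 add_2_eq_Suc' append_butlast_last_id diff_Suc_1 last_conv_nth
          length_0_conv nat.distinct(1))
    finally have 1: "objs (left_rotation C F d s') = objs s" .
    have "Hom C (fobj F (objs s' ! 0)) (fobj F (objs s' ! 1)) = Hom C (src (fmor F g)) (tgt (fmor F g))"
      using oo[of 0] oo[of 1] g by simp
    then have "mors (left_rotation C F d s') = butlast (mors s) @ [m]"
      using g(4) by (simp add: left_rotation_def s'_def rot_sign_def)
    also have "\<dots> = mors s"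
      using l unfolding m_def by (metis Suc_eq_plus1 add_2_eq_Suc' append_butlast_last_id diff_Suc_1 last_conv_nth
          length_0_conv nat.distinct(1))
    finally show ?thesis using 1 by simp
  qed
  then have "s' \<in> Angles" using N2[OF seq] s by simp
  moreover have "objs s' ! k = (if k = 0 then fobj G (c (d + 1)) else c (k - 1))" if "k < d + 2" for k
    using oo[OF that] c that by auto
  ultimately show ?thesis unfolding angle_on_def by blast
qed

lemma angle_on_unrotate:
  assumes "angle_on c" "n \<le> d + 2"
  shows "angle_on (\<lambda>k. if k < n then fobj G (c (k + d + 2 - n)) else c (k - n))"
  using assms(2)
proof (induction n)
  case 0
  then show ?case using assms(1) by simp
next
  case (Suc n)
  then have "angle_on (\<lambda>k. if k < n then fobj G (c (k + d + 2 - n)) else c (k - n))" by simp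
  from angle_on_unrotate1[OF this] show ?case
    by (rule angle_on_cong) (use Suc.prems in \<open>auto simp: Suc_diff_Suc\<close>)
qed

text \<open>Undoing \<open>d\<close> rotations moves the two copies of \<open>x\<close> to the end.
  This is the angle used for coning off a last object, and it is a resolution of \<open>x\<close>
  when \<open>x\<close> is in add(T).\<close>

lemma angle_on_trivial:
  assumes "x \<in> Obj C"
  shows "\<exists>c. angle_on c \<and> (\<forall>k < d. zero_object C (c k)) \<and> c d = x \<and> c (d + 1) = x"
proof -
  obtain z where z: "zero_object C z" using ex_zero_object by blast
  let ?t = "trivial_sequence C F d x z"
  have "angle_on (\<lambda>k. if k < 2 then x else z)"
    unfolding angle_on_def using N1_trivial[OF assms z] trivial_nth(1)[OF assms z] by blast
  from angle_on_unrotate[OF this, of d, OF le_add1]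
  have "angle_on (\<lambda>k. if k < d then fobj G z else x)" by (rule angle_on_cong) auto
  then show ?thesis using functor_zero_object[OF G_functor z]
    by (intro exI[of _ "\<lambda>k. if k < d then fobj G z else x"]) simp
qed

text \<open>Obtained as a mapping cone of a morphism whose first two components are zero. A cone
  pairs place k + 1 of its source with place k of its target, which is compensated by undoing one
  rotation of \<open>b\<close>. Only the objects matter, so the remaining components may be
  anything.\<close>

lemma angle_on_sum:
  assumes b: "angle_on b" and c: "angle_on c"
  shows "\<exists>e. angle_on e \<and> (\<forall>k < d + 2. is_sum C (e k) (b k) (c k))"
proof -
  obtain s where s: "s \<in> Angles"
    and so: "\<And>k. k < d + 2 \<Longrightarrow> objs s ! k = (if k = 0 then fobj G (b (d + 1)) else b (k - 1))"
    using angle_on_unrotate1[OF b] by (auto simp: angle_on_def)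
  obtain t where t: "t \<in> Angles" and to: "\<And>k. k < d + 2 \<Longrightarrow> objs t ! k = c k"
    using c by (auto simp: angle_on_def)
  note ob = angle_obj(1)[OF s] angle_obj(1)[OF t]
  note l = angle_length[OF s] angle_length[OF t]
  have "\<exists>\<phi>. is_sequence_mor C F d s t \<phi> \<and> \<phi> ! 0 = mzero (objs s ! 0) (objs t ! 0) \<and>
      \<phi> ! 1 = mzero (objs s ! 1) (objs t ! 1) \<and> (\<exists>e \<in> Angles. is_mapping_cone C F d s t \<phi> e)"
  proof (rule N4[OF s t])
    show "mzero (objs s ! 1) (objs t ! 1) \<cdot> mors s ! 0 = mors t ! 0 \<cdot> mzero (objs s ! 0) (objs t ! 0)"
      using angle_arrow[OF s, of 0] angle_arrow[OF t, of 0] ob(1)[of 0] ob(2)[of 0] ob(1)[of 1] ob(2)[of 1]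
        xobj_less[OF l(1), of 1] xobj_less[OF l(3), of 1] by simp
  qed (use ob(1)[of 0] ob(2)[of 0] ob(1)[of 1] ob(2)[of 1] in \<open>simp_all add: mor_iff\<close>)
  then obtain \<phi> e where e: "e \<in> Angles" "is_mapping_cone C F d s t \<phi> e" by blast
  have "is_sum C (objs e ! k) (b k) (c k)" if k: "k < d + 2" for k
  proof -
    have "is_sum C (objs e ! k) (xobj F s (k + 1)) (objs t ! k)"
      using e(2) k unfolding is_mapping_cone_def is_sum_def by blast
    moreover have "xobj F s (k + 1) = b k"
    proof (cases "k = d + 1")
      case True
      then show ?thesis using xobj_last[OF l(1)] so[of 0] angle_on_obj[OF b, of "d + 1"] by simp
    next
      case False
      then show ?thesis using xobj_less[OF l(1), of "k + 1"] so[of "k + 1"] k by simp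
    qed
    ultimately show ?thesis using to[OF k] by simp
  qed
  then show ?thesis using e(1) unfolding angle_on_def by (intro exI[of _ "\<lambda>k. objs e ! k"]) blast
qed

text \<open>
  After rotation, the cone of a morphism of angles that is an isomorphism on the last objects has a
  common summand in its first two terms, which is cancelled.
\<close>

lemma angle_on_cone:
  assumes b: "angle_on b" and c: "angle_on c" and iso: "iso_obj C (b (d + 1)) (c (d + 1))"
    and vanish: "mor C (b d) (fobj F (c 0)) = {\<zero>\<^bsub>Hom C (b d) (fobj F (c 0))\<^esub>}"
  shows "\<exists>e. angle_on e \<and> e 0 = b 0 \<and> e (d + 1) = c d \<and>
    (\<forall>k. 1 \<le> k \<and> k \<le> d \<longrightarrow> is_sum C (e k) (b k) (c (k - 1)))"
proof -
  note ob = angle_on_obj[OF b] and oc = angle_on_obj[OF c]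
  \<comment> \<open>Rotation by \<open>d\<close> puts the morphism from place \<open>d\<close> to
    place \<open>d + 1\<close> first, where (N4) accepts prescribed components.\<close>
  obtain s where s: "s \<in> Angles"
    and so: "\<And>k. k < d + 2 \<Longrightarrow> objs s ! k = (if k + d < d + 2 then b (k + d) else fobj F (b (k + d - (d + 2))))"
    using angle_on_rotate[OF b, of d] by (auto simp: angle_on_def)
  obtain t where t: "t \<in> Angles"
    and to: "\<And>k. k < d + 2 \<Longrightarrow> objs t ! k = (if k + d < d + 2 then c (k + d) else fobj F (c (k + d - (d + 2))))"
    using angle_on_rotate[OF c, of d] by (auto simp: angle_on_def)
  note ls = angle_length[OF s] and lt = angle_length[OF t]
  have s0: "objs s ! 0 = b d" "objs s ! 1 = b (d + 1)" "objs s ! 2 = fobj F (b 0)"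
    using so[of 0] so[of 1] so[of 2] d_pos by (auto simp: add.commute)
  have t0: "objs t ! 0 = c d" "objs t ! 1 = c (d + 1)" "objs t ! 2 = fobj F (c 0)"
    using to[of 0] to[of 1] to[of 2] d_pos by (auto simp: add.commute)
  obtain \<theta> \<theta>' where \<theta>: "arrow \<theta>" "arrow \<theta>'" "src \<theta> = b (d + 1)" "tgt \<theta> = c (d + 1)"
    "src \<theta>' = c (d + 1)" "tgt \<theta>' = b (d + 1)" "\<theta>' \<cdot> \<theta> = Idn C (b (d + 1))" "\<theta> \<cdot> \<theta>' = Idn C (c (d + 1))"
    using iso unfolding iso_obj_iff by blast
  define \<beta> where "\<beta> = mors s ! 0"
  define \<gamma> where "\<gamma> = mors t ! 0"
  have \<beta>: "arrow \<beta>" "src \<beta> = b d" "tgt \<beta> = b (d + 1)"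
    using angle_arrow[OF s, of 0] xobj_less[OF ls(1), of 1] s0 by (simp_all add: \<beta>_def)
  have \<gamma>: "arrow \<gamma>" "src \<gamma> = c d" "tgt \<gamma> = c (d + 1)"
    using angle_arrow[OF t, of 0] xobj_less[OF lt(1), of 1] t0 by (simp_all add: \<gamma>_def)
  have t1: "arrow (mors t ! 1)" "src (mors t ! 1) = c (d + 1)" "tgt (mors t ! 1) = fobj F (c 0)"
    using angle_arrow[OF t, of 1] xobj_less[OF lt(1), of 2] t0 d_pos by (simp_all add: numeral_2_eq_2)
  \<comment> \<open>The hypothesis \<open>vanish\<close> is used here: it makes the weak kernel
    property of \<open>t\<close> supply the component \<open>\<mu>\<close> completing the square
    with \<open>\<theta>\<close>.\<close>
  have "mors t ! 1 \<cdot> (\<theta> \<cdot> \<beta>) \<in> mor C (b d) (fobj F (c 0))"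
    using t1 \<theta> \<beta> ob[of d] oc[of 0] by (simp add: mor_iff)
  then have "mors t ! 1 \<cdot> (\<theta> \<cdot> \<beta>) = mzero (b d) (fobj F (c 0))"
    using vanish by (simp add: mzero_def)
  then obtain \<mu> where \<mu>: "arrow \<mu>" "src \<mu> = b d" "tgt \<mu> = c d" "\<gamma> \<cdot> \<mu> = \<theta> \<cdot> \<beta>"
    using angle_weak_kernel[OF t, of "\<theta> \<cdot> \<beta>"] \<theta> \<beta> t0 by (auto simp: \<gamma>_def)
  have "\<exists>\<phi>. is_sequence_mor C F d s t \<phi> \<and> \<phi> ! 0 = \<mu> \<and> \<phi> ! 1 = \<theta> \<and> (\<exists>e \<in> Angles. is_mapping_cone C F d s t \<phi> e)"
    by (rule N4[OF s t]) (use s0 t0 \<mu> \<theta> ob[of d] ob[of "d + 1"] oc[of d] oc[of "d + 1"] in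
        \<open>simp_all add: mor_iff \<beta>_def \<gamma>_def\<close>)
  then obtain \<phi> e where \<phi>: "is_sequence_mor C F d s t \<phi>" "\<phi> ! 1 = \<theta>"
    and e: "e \<in> Angles" "is_mapping_cone C F d s t \<phi> e" by blast
  note le = angle_length[OF e(1)] and oe = angle_obj(1)[OF e(1)]
  have l\<phi>: "length \<phi> = d + 2" using \<phi>(1) by (simp add: is_sequence_mor_def)
  obtain i j p q where lij: "length i = d + 2" "length j = d + 2" "length p = d + 2" "length q = d + 2"
    and bi': "\<forall>k < d + 2. biproduct C (objs e ! k) (xobj F s (k + 1)) (objs t ! k) (i ! k) (j ! k) (p ! k) (q ! k)"
    and em: "\<forall>k < d + 2. let H = Hom C (xobj F e k) (xobj F e (k + 1)) in
           mors e ! k = (\<ominus>\<^bsub>H\<^esub> (xmor F i (k + 1) \<cdot> xmor F (mors s) (k + 1) \<cdot> (p ! k)))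
             \<oplus>\<^bsub>H\<^esub> (xmor F j (k + 1) \<cdot> xmor F \<phi> (k + 1) \<cdot> (p ! k))
             \<oplus>\<^bsub>H\<^esub> (xmor F j (k + 1) \<cdot> (mors t ! k) \<cdot> (q ! k))"
    using e(2) unfolding is_mapping_cone_def by (elim conjE exE) (rule that)
  have bi: "biproduct C (objs e ! k) (xobj F s (k + 1)) (objs t ! k) (i ! k) (j ! k) (p ! k) (q ! k)"
    if "k < d + 2" for k using bi' that by simp
  have es: "is_sum C (objs e ! k) (xobj F s (k + 1)) (objs t ! k)" if "k < d + 2" for k
    using bi[OF that] unfolding is_sum_def by blast
  have x: "xobj F s 1 = b (d + 1)" "xobj F s 2 = fobj F (b 0)"
    using xobj_less[OF ls(1), of 1] xobj_less[OF ls(1), of 2] s0 d_pos by auto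
  have b0: "biproduct C (objs e ! 0) (b (d + 1)) (c d) (i ! 0) (j ! 0) (p ! 0) (q ! 0)"
    using bi[of 0] x t0 by simp
  have b1: "biproduct C (objs e ! 1) (fobj F (b 0)) (c (d + 1)) (i ! 1) (j ! 1) (p ! 1) (q ! 1)"
    using bi[of 1] x t0 by (simp add: numeral_2_eq_2)
  note c0 = biproduct_comps[OF b0] and c1 = biproduct_comps[OF b1]
  have s1: "arrow (mors s ! 1)" "src (mors s ! 1) = b (d + 1)" "tgt (mors s ! 1) = fobj F (b 0)"
    using angle_arrow[OF s, of 1] s0 x d_pos by (simp_all add: numeral_2_eq_2)
  have xe: "xobj F e 0 = objs e ! 0" "xobj F e 1 = objs e ! 1"
    using xobj_less[OF le(1)] by simp_all
  have m0: "mors e ! 0 = mneg (i ! 1 \<cdot> (mors s ! 1 \<cdot> p ! 0)) \<boxplus> (j ! 1 \<cdot> (\<theta> \<cdot> p ! 0)) \<boxplus> (j ! 1 \<cdot> (\<gamma> \<cdot> q ! 0))"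
    using em[rule_format, of 0] xe \<phi>(2) lij l\<phi> ls c0(1-15) c1(1-15) s1 \<theta>(1-6) \<gamma>
    by (simp add: xmor_less Let_def \<gamma>_def hom_add_eq hom_neg_eq del: madd_assoc)
  \<comment> \<open>In the matrix of the first cone morphism the entry from b^{d+1} to c^{d+1} is
    \<open>\<theta>\<close>. As \<open>angle_cancel\<close> wants literally the same summand twice,
    b^{d+1} is renamed to c^{d+1} through \<open>\<theta>'\<close>.\<close>
  have "q ! 1 \<cdot> (mors e ! 0 \<cdot> (i ! 0 \<cdot> \<theta>')) = Idn C (c (d + 1))"
    unfolding m0 using c0 c1 s1 \<theta> \<gamma> by simp
  from angle_cancel[OF e(1) biproduct_iso_left[OF b0 \<theta>(1,2,3,4,5,6,7,8)] b1 this]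
  obtain a where a: "a \<in> Angles" "objs a = c d # fobj F (b 0) # drop 2 (objs e)" by blast
  have "angle_on (\<lambda>k. objs a ! k)" using a(1) by (auto simp: angle_on_def)
  \<comment> \<open>The rotation by \<open>d\<close> and the shift by one place in the cone are
    undone together.\<close>
  from angle_on_unrotate[OF this, of "d + 1"] have "angle_on
      (\<lambda>k. if k < d + 1 then fobj G (objs a ! (k + d + 2 - (d + 1))) else objs a ! (k - (d + 1)))" by simp
  then
  have A: "angle_on (\<lambda>k. if k < d + 1 then fobj G (objs a ! (k + 1)) else objs a ! (k - (d + 1)))"
    by (rule angle_on_cong) (simp add: numeral_2_eq_2)
  have "is_sum C (fobj G (objs a ! (k + 1))) (b k) (c (k - 1))" if k: "1 \<le> k" "k \<le> d" for k
  proof -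
    obtain k' where k': "k = Suc k'" using k by (cases k) auto
    have "objs a ! (k + 1) = objs e ! (k + 1)" using a(2) k le by (simp add: k')
    moreover have "xobj F s (k + 1 + 1) = fobj F (b k)"
    proof (cases "k = d")
      case True
      then show ?thesis using xobj_last[OF ls(1)] s0 by simp
    next
      case False
      then show ?thesis using xobj_less[OF ls(1), of "k + 2"] so[of "k + 2"] k by simp
    qed
    moreover have "objs t ! (k + 1) = fobj F (c (k - 1))" using to[of "k + 1"] k by (simp add: k')
    ultimately have "is_sum C (objs a ! (k + 1)) (fobj F (b k)) (fobj F (c (k - 1)))"
      using es[of "k + 1"] k by simp
    from functor_is_sum[OF G_functor this] show ?thesis using ob[of k] oc[of "k - 1"] k by simp
  qed
  then show ?thesis using A a(2) ob[of 0]
    by (intro exI[of _ "\<lambda>k. if k < d + 1 then fobj G (objs a ! (k + 1)) else objs a ! (k - (d + 1))"]) simp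
qed

end

section \<open>Split Grothendieck groups\<close>

abbreviation K0_coset :: "('o, 'm, 'k) category \<Rightarrow> 'o set \<Rightarrow> ('o \<Rightarrow>\<^sub>0 int) \<Rightarrow> ('o \<Rightarrow>\<^sub>0 int) set" where
  "K0_coset C A x \<equiv> K0_relations C A #>\<^bsub>free_Abelian_group A\<^esub> x"

lemma K0_relations_subgroup: "subgroup (K0_relations C A) (free_Abelian_group A)"
  unfolding K0_relations_def
proof (rule group.generate_is_subgroup[OF group_free_Abelian_group], clarify)
  fix a a0 a1 assume "a \<in> A" "a0 \<in> A" "a1 \<in> A"
  then show "frag_of a - (frag_of a0 + frag_of a1) \<in> carrier (free_Abelian_group A)"
    using keys_diff[of "frag_of a" "frag_of a0 + frag_of a1"] keys_add[of "frag_of a0" "frag_of a1"]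
    by (auto simp: keys_frag_of)
qed

lemma K0_relations_normal: "K0_relations C A \<lhd> free_Abelian_group A"
  using comm_group.subgroup_imp_normal[OF abelian_free_Abelian_group K0_relations_subgroup] .

lemma K0_relations_keys: "x \<in> K0_relations C A \<Longrightarrow> Poly_Mapping.keys x \<subseteq> A"
  using subgroup.mem_carrier[OF K0_relations_subgroup] by fastforce

lemma K0_relations_zero: "0 \<in> K0_relations C A"
  using subgroup.one_closed[OF K0_relations_subgroup[of C A]] by simp

lemma K0_relations_add: "\<lbrakk>x \<in> K0_relations C A; y \<in> K0_relations C A\<rbrakk> \<Longrightarrow> x + y \<in> K0_relations C A"
  using subgroup.m_closed[OF K0_relations_subgroup[of C A]] by simp

lemma K0_relations_minus: "x \<in> K0_relations C A \<Longrightarrow> - x \<in> K0_relations C A"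
  using subgroup.m_inv_closed[OF K0_relations_subgroup[of C A], of x] K0_relations_keys[of x C A] by simp

lemma K0_relations_diff: "\<lbrakk>x \<in> K0_relations C A; y \<in> K0_relations C A\<rbrakk> \<Longrightarrow> x - y \<in> K0_relations C A"
  using K0_relations_add[OF _ K0_relations_minus] by fastforce

lemma K0_relations_sign: "x \<in> K0_relations C A \<Longrightarrow> frag_cmul ((-1) ^ k) x \<in> K0_relations C A"
  by (cases "even k") (auto intro: K0_relations_minus)

lemma K0_relations_sum:
  "(\<And>i. i \<in> I \<Longrightarrow> f i \<in> K0_relations C A) \<Longrightarrow> sum f I \<in> K0_relations C A"
  by (induction I rule: infinite_finite_induct) (auto intro: K0_relations_zero K0_relations_add)

lemma K0_relations_trans:
  "\<lbrakk>x - y \<in> K0_relations C A; y - z \<in> K0_relations C A\<rbrakk> \<Longrightarrow> x - z \<in> K0_relations C A"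
  using K0_relations_add[of "x - y" C A "y - z"] by simp

lemma K0_relations_generator:
  "\<lbrakk>a \<in> A; a0 \<in> A; a1 \<in> A; is_sum C a a0 a1\<rbrakk> \<Longrightarrow> frag_of a - (frag_of a0 + frag_of a1) \<in> K0_relations C A"
  unfolding K0_relations_def by (rule generate.incl) blast

text \<open>Turns equations in the quotient into memberships of differences in
  \<open>K0_relations\<close>. All later identities are proved in that form, on representatives in
  the free group.\<close>

lemma K0_coset_eq_iff:
  assumes "Poly_Mapping.keys x \<subseteq> A" "Poly_Mapping.keys y \<subseteq> A"
  shows "K0_coset C A x = K0_coset C A y \<longleftrightarrow> x - y \<in> K0_relations C A"
proof -
  interpret group "free_Abelian_group A" by simp
  note N = K0_relations_subgroup[of C A]
  have "x \<in> K0_coset C A y \<longleftrightarrow> x - y \<in> K0_relations C A"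
    using subgroup.rcos_module[OF N is_group, of y x] assms by simp
  moreover have "x \<in> K0_coset C A y \<longleftrightarrow> K0_coset C A x = K0_coset C A y"
    using repr_independence[of x "K0_relations C A" y] rcos_self[of x "K0_relations C A"] N assms by auto
  ultimately show ?thesis by blast
qed

lemma comm_group_K0: "comm_group (K0 C A)"
  unfolding K0_def using comm_group.abelian_FactGroup[OF abelian_free_Abelian_group K0_relations_subgroup] .

lemma group_K0: "group (K0 C A)"
  using comm_group_K0 by (rule comm_group.axioms(2))

lemma carrier_K0: "carrier (K0 C A) = {K0_coset C A x | x. Poly_Mapping.keys x \<subseteq> A}"
  unfolding K0_def carrier_FactGroup by auto

lemma K0_coset_hom: "K0_coset C A \<in> hom (free_Abelian_group A) (K0 C A)"
  unfolding K0_def using normal.r_coset_hom_Mod[OF K0_relations_normal] .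

lemma K0_coset_zero: "K0_coset C A 0 = \<one>\<^bsub>K0 C A\<^esub>"
  using hom_one[OF K0_coset_hom[where C = C and A = A] group_free_Abelian_group group_K0] by simp

lemma K0_coset_closed: "Poly_Mapping.keys x \<subseteq> A \<Longrightarrow> K0_coset C A x \<in> carrier (K0 C A)"
  by (auto simp: carrier_K0)

lemma K0_coset_add:
  assumes "Poly_Mapping.keys x \<subseteq> A" "Poly_Mapping.keys y \<subseteq> A"
  shows "K0_coset C A x \<otimes>\<^bsub>K0 C A\<^esub> K0_coset C A y = K0_coset C A (x + y)"
  using hom_mult[OF K0_coset_hom[where C = C and A = A], of x y] assms by simp

lemma K0_coset_int_pow:
  assumes "Poly_Mapping.keys x \<subseteq> A"
  shows "K0_coset C A x [^]\<^bsub>K0 C A\<^esub> (n :: int) = K0_coset C A (frag_cmul n x)"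
  unfolding K0_def using normal.FactGroup_int_pow[OF K0_relations_normal, of x A C n] assms by simp

lemma keys_sum_subset:
  fixes f :: "'i \<Rightarrow> 'o \<Rightarrow>\<^sub>0 int"
  shows "(\<And>i. i \<in> I \<Longrightarrow> Poly_Mapping.keys (f i) \<subseteq> A) \<Longrightarrow> Poly_Mapping.keys (sum f I) \<subseteq> A"
  using sum_closed_free_Abelian_group[of I f A] by simp

lemma keys_cmul_subset: "Poly_Mapping.keys x \<subseteq> A \<Longrightarrow> Poly_Mapping.keys (frag_cmul n x) \<subseteq> A"
  using keys_cmul by blast

lemma keys_frag_extend_subset:
  assumes "Poly_Mapping.keys x \<subseteq> A" "\<And>a. a \<in> A \<Longrightarrow> Poly_Mapping.keys (f a) \<subseteq> B"
  shows "Poly_Mapping.keys (frag_extend f x) \<subseteq> B"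
  using keys_frag_extend[of f x] assms by blast

lemma K0_coset_finprod:
  assumes "finite I" "\<And>i. i \<in> I \<Longrightarrow> Poly_Mapping.keys (f i) \<subseteq> A"
  shows "finprod (K0 C A) (\<lambda>i. K0_coset C A (f i)) I = K0_coset C A (sum f I)"
  using assms
proof (induction I rule: finite_induct)
  case empty
  interpret comm_group "K0 C A" by (rule comm_group_K0)
  show ?case by (simp add: K0_coset_zero)
next
  case (insert i I)
  interpret comm_group "K0 C A" by (rule comm_group_K0)
  have c: "K0_coset C A (f j) \<in> carrier (K0 C A)" if "j \<in> insert i I" for j
    using insert.prems[OF that] by (auto simp: carrier_K0)
  have "finprod (K0 C A) (\<lambda>i. K0_coset C A (f i)) (insert i I) =
      K0_coset C A (f i) \<otimes>\<^bsub>K0 C A\<^esub> K0_coset C A (sum f I)"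
    using insert c by (subst finprod_insert) auto
  also have "\<dots> = K0_coset C A (sum f (insert i I))"
    using insert keys_sum_subset[of I f A] by (subst K0_coset_add) auto
  finally show ?case .
qed

section \<open>Homomorphisms computed on representatives\<close>

lemma K0_hom_lift:
  assumes f: "\<And>x. Poly_Mapping.keys x \<subseteq> A \<Longrightarrow> f (K0_coset C A x) = K0_coset C B (L x)"
    and L: "\<And>x. Poly_Mapping.keys x \<subseteq> A \<Longrightarrow> Poly_Mapping.keys (L x) \<subseteq> B"
    and add: "\<And>x y. L (x + y) = L x + L y"
  shows "f \<in> hom (K0 C A) (K0 C B)"
proof (rule homI)
  fix u assume "u \<in> carrier (K0 C A)"
  then obtain x where "Poly_Mapping.keys x \<subseteq> A" "u = K0_coset C A x" by (auto simp: carrier_K0)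
  then show "f u \<in> carrier (K0 C B)" using f[of x] K0_coset_closed[OF L[of x]] by simp
next
  fix u v assume "u \<in> carrier (K0 C A)" "v \<in> carrier (K0 C A)"
  then obtain x y where xy: "Poly_Mapping.keys x \<subseteq> A" "Poly_Mapping.keys y \<subseteq> A"
    and u: "u = K0_coset C A x" "v = K0_coset C A y" by (auto simp: carrier_K0)
  have "Poly_Mapping.keys (x + y) \<subseteq> A" using keys_add[of x y] xy by blast
  then show "f (u \<otimes>\<^bsub>K0 C A\<^esub> v) = f u \<otimes>\<^bsub>K0 C B\<^esub> f v"
    using xy by (simp add: u K0_coset_add f L add)
qed

lemma frag_extend_relations:
  assumes "x \<in> K0_relations C A"
    and add: "\<And>a a0 a1. \<lbrakk>a \<in> A; a0 \<in> A; a1 \<in> A; is_sum C a a0 a1\<rbrakk> \<Longrightarrow>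
      r a - (r a0 + r a1) \<in> K0_relations C B"
  shows "frag_extend r x \<in> K0_relations C B"
  using assms(1) unfolding K0_relations_def[of C A]
proof (induction rule: generate.induct)
  case one
  then show ?case by (simp add: K0_relations_zero)
next
  case (incl h)
  then show ?case using add by (auto simp: frag_extend_diff frag_extend_add)
next
  case (inv h)
  have "h \<in> K0_relations C A" using inv unfolding K0_relations_def by (rule generate.incl)
  then have "Poly_Mapping.keys h \<subseteq> A" by (rule K0_relations_keys)
  moreover have "frag_extend r h \<in> K0_relations C B"
    using inv add by (auto simp: frag_extend_diff frag_extend_add)
  ultimately show ?case by (simp add: frag_extend_minus K0_relations_minus)
next
  case (eng h1 h2)
  then show ?case by (simp add: frag_extend_add K0_relations_add)
qed

text \<open>Evaluates the \<open>THE\<close> in \<open>K0_induced\<close>: the universal property of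
  the quotient gives existence, values on generators give uniqueness on the carrier, and
  extensionality fixes the rest. Here \<open>r\<close> chooses representatives of the values of
  \<open>h\<close>.\<close>

lemma K0_induced_coset:
  assumes keys: "\<And>a. a \<in> A \<Longrightarrow> Poly_Mapping.keys (r a) \<subseteq> B"
    and h: "\<And>a. a \<in> A \<Longrightarrow> h a = K0_coset C B (r a)"
    and add: "\<And>a a0 a1. \<lbrakk>a \<in> A; a0 \<in> A; a1 \<in> A; is_sum C a a0 a1\<rbrakk> \<Longrightarrow>
      r a - (r a0 + r a1) \<in> K0_relations C B"
    and x: "Poly_Mapping.keys x \<subseteq> A"
  shows "K0_induced C A (K0 C B) h (K0_coset C A x) = K0_coset C B (frag_extend r x)"
proof -
  let ?H = "\<lambda>x. K0_coset C B (frag_extend r x)"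
  have kx: "Poly_Mapping.keys (frag_extend r x) \<subseteq> B" if "Poly_Mapping.keys x \<subseteq> A" for x
    using keys_frag_extend_subset[OF that keys] .
  have "?H \<in> hom (free_Abelian_group A) (K0 C B)"
    using kx by (intro homI) (auto simp: carrier_K0 K0_coset_add frag_extend_add)
  moreover have "?H x = ?H y" if "x \<in> carrier (free_Abelian_group A)" "y \<in> carrier (free_Abelian_group A)"
      "K0_coset C A x = K0_coset C A y" for x y
  proof -
    have "x - y \<in> K0_relations C A" using that K0_coset_eq_iff[of x A y C] by simp
    from frag_extend_relations[OF this add] show ?thesis
      using that kx by (subst K0_coset_eq_iff) (auto simp: frag_extend_diff)
  qed
  ultimately obtain g where g: "g \<in> hom (K0 C A) (K0 C B)"
    and gx: "\<And>x. x \<in> carrier (free_Abelian_group A) \<Longrightarrow> g (K0_coset C A x) = ?H x"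
    using FactGroup_universal[OF _ K0_relations_normal, of ?H A "K0 C B" C]
    unfolding K0_def[of C A] by blast
  define \<Phi> where "\<Phi> = restrict g (carrier (K0 C A))"
  have \<Phi>x: "\<Phi> (K0_coset C A x) = ?H x" if "Poly_Mapping.keys x \<subseteq> A" for x
    using gx[of x] that by (auto simp: \<Phi>_def carrier_K0)
  have "K0_induced C A (K0 C B) h = \<Phi>"
    unfolding K0_induced_def
  proof (rule the_equality)
    have "\<Phi> \<in> hom (K0 C A) (K0 C B)"
      by (rule K0_hom_lift[where L = "frag_extend r"]) (use \<Phi>x kx in \<open>auto simp: frag_extend_add\<close>)
    then show "\<Phi> \<in> hom (K0 C A) (K0 C B) \<and> \<Phi> \<in> extensional (carrier (K0 C A)) \<and>
        (\<forall>a \<in> A. \<Phi> (K0_class C A a) = h a)"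
      using \<Phi>x by (auto simp: \<Phi>_def K0_class_def h keys_frag_of)
  next
    fix \<Psi> assume \<Psi>: "\<Psi> \<in> hom (K0 C A) (K0 C B) \<and> \<Psi> \<in> extensional (carrier (K0 C A)) \<and>
        (\<forall>a \<in> A. \<Psi> (K0_class C A a) = h a)"
    have \<Psi>h: "\<Psi> \<circ> K0_coset C A \<in> hom (free_Abelian_group A) (K0 C B)"
      using hom_compose[OF K0_coset_hom] \<Psi> by blast
    have "\<Psi> (K0_coset C A x) = ?H x" if "Poly_Mapping.keys x \<subseteq> A" for x
      using that
    proof (induction x rule: free_Abelian_group_induct[consumes 1])
      case 1
      show ?case
        using hom_one[OF \<Psi>h group_free_Abelian_group group_K0] by (simp add: K0_coset_zero)
    next
      case (2 x y)
      \<comment> \<open>The induction proceeds by differences, while a homomorphism is only known to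
        respect products; so the value at \<open>x - y\<close> is found by cancelling the value at
        \<open>y\<close>.\<close>
      have k: "Poly_Mapping.keys (x - y) \<subseteq> A" using 2 keys_diff[of x y] by blast
      interpret B: comm_group "K0 C B" by (rule comm_group_K0)
      have c: "\<Psi> (K0_coset C A (x - y)) \<in> carrier (K0 C B)"
        using hom_in_carrier[OF \<Psi>h, of "x - y"] k by simp
      have "\<Psi> (K0_coset C A (x - y)) \<otimes>\<^bsub>K0 C B\<^esub> \<Psi> (K0_coset C A y) = \<Psi> (K0_coset C A x)"
        using hom_mult[OF \<Psi>h, of "x - y" y] k 2 by simp
      moreover have "?H (x - y) \<otimes>\<^bsub>K0 C B\<^esub> ?H y = ?H x"
        using kx[OF k] kx[of y] 2 by (simp add: K0_coset_add frag_extend_diff)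
      moreover have "?H (x - y) \<in> carrier (K0 C B)" "?H y \<in> carrier (K0 C B)"
        using kx[OF k] kx[of y] 2 by (auto simp: carrier_K0)
      ultimately show ?case using c 2 by (metis B.r_cancel)
    next
      case (3 a)
      then show ?case using \<Psi> by (simp add: K0_class_def h)
    qed
    then have eq: "\<Psi> (K0_coset C A x) = \<Phi> (K0_coset C A x)" if "Poly_Mapping.keys x \<subseteq> A" for x
      using \<Phi>x that by simp
    show "\<Psi> = \<Phi>"
    proof (rule extensionalityI[of _ "carrier (K0 C A)"])
      show "\<Phi> \<in> extensional (carrier (K0 C A))" by (simp add: \<Phi>_def)
      show "\<Psi> u = \<Phi> u" if "u \<in> carrier (K0 C A)" for u
        using that eq unfolding carrier_K0 by blast
    qed (use \<Psi> in blast)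
  qed
  then show ?thesis using \<Phi>x[OF x] by simp
qed

section \<open>Alternating sums\<close>

definition alt_sum :: "nat \<Rightarrow> (nat \<Rightarrow> 'o \<Rightarrow>\<^sub>0 int) \<Rightarrow> 'o \<Rightarrow>\<^sub>0 int" where
  "alt_sum n f = (\<Sum>k\<le>n. frag_cmul ((-1) ^ k) (f k))"

lemma alt_sum_Suc: "alt_sum (Suc n) f = alt_sum n f + frag_cmul ((-1) ^ Suc n) (f (Suc n))"
  by (simp add: alt_sum_def)

lemma alt_sum_cong: "(\<And>k. k \<le> n \<Longrightarrow> f k = g k) \<Longrightarrow> alt_sum n f = alt_sum n g"
  by (simp add: alt_sum_def)

lemma alt_sum_add: "alt_sum n (\<lambda>k. f k + g k) = alt_sum n f + alt_sum n g"
  by (simp add: alt_sum_def frag_cmul_distrib2 sum.distrib)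

lemma alt_sum_shift: "alt_sum (Suc n) f = f 0 - alt_sum n (\<lambda>k. f (Suc k))"
proof (induction n)
  case 0
  then show ?case by (simp add: alt_sum_def)
next
  case (Suc n)
  then show ?case
    by (simp add: alt_sum_Suc[of "Suc n" f] alt_sum_Suc[of n "\<lambda>k. f (Suc k)"])
qed

text \<open>Mediates between places in an angle, counted from the left, and terms of a resolution,
  counted from the right.\<close>

lemma alt_sum_rev: "alt_sum n (\<lambda>k. f (n - k)) = frag_cmul ((-1) ^ n) (alt_sum n f)"
proof -
  have "alt_sum n (\<lambda>k. f (n - k)) = (\<Sum>k\<le>n. frag_cmul ((-1) ^ (n - k)) (f (n - (n - k))))"
    unfolding alt_sum_def by (rule sum.reindex_bij_witness[where i = "\<lambda>k. n - k" and j = "\<lambda>k. n - k"]) auto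
  also have "\<dots> = (\<Sum>k\<le>n. frag_cmul ((-1) ^ n) (frag_cmul ((-1) ^ k) (f k)))"
    by (intro sum.cong) (auto simp: minus_one_power_iff)
  also have "\<dots> = frag_cmul ((-1) ^ n) (alt_sum n f)"
    unfolding alt_sum_def by (simp add: frag_cmul_sum o_def)
  finally show ?thesis .
qed

lemma frag_extend_alt_sum: "frag_extend r (alt_sum n f) = alt_sum n (\<lambda>k. frag_extend r (f k))"
  by (simp add: alt_sum_def frag_extend_sum o_def frag_extend_cmul)

lemma alt_sum_relations:
  assumes "\<And>k. k \<le> n \<Longrightarrow> f k - g k \<in> K0_relations C A"
  shows "alt_sum n f - alt_sum n g \<in> K0_relations C A"
proof -
  have "alt_sum n f - alt_sum n g = (\<Sum>k\<le>n. frag_cmul ((-1) ^ k) (f k - g k))"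
    unfolding alt_sum_def sum_subtractf[symmetric]
    by (intro sum.cong refl) (simp add: minus_one_power_iff)
  then show ?thesis using assms by (auto intro!: K0_relations_sum K0_relations_sign)
qed

lemma keys_alt_sum:
  "(\<And>k. k \<le> n \<Longrightarrow> Poly_Mapping.keys (f k) \<subseteq> A) \<Longrightarrow> Poly_Mapping.keys (alt_sum n f) \<subseteq> A"
  unfolding alt_sum_def by (intro keys_sum_subset keys_cmul_subset) auto

lemma sign_sign: "frag_cmul ((-1) ^ n) (frag_cmul ((-1) ^ n) x) = x"
  by (simp add: minus_one_power_iff)

lemma sign_diff: "frag_cmul ((-1) ^ n) (x - y) = frag_cmul ((-1) ^ n) x - frag_cmul ((-1) ^ n) y"
  by (simp add: minus_one_power_iff)

section \<open>The index\<close>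

locale tilting = angulated_category C F d Angles
  for C :: "('o, 'm, 'k) category" (structure)
    and F :: "('o, 'm) endofunctor"
    and d :: nat
    and Angles :: "('o, 'm) sequence set" +
  fixes T :: 'o
  assumes tilting: "cluster_tilting C F d Angles T"
begin

abbreviation "\<A> \<equiv> add_closure C T"
abbreviation "\<N> \<equiv> K0_relations C \<A>"

text \<open>Here \<open>b k\<close> is the term \<open>t\<^sub>d\<^sub>-\<^sub>k\<close> of a resolution; hence the sign \<open>(-1)\<^sup>d\<close> in the index below.\<close>

definition resolves :: "(nat \<Rightarrow> 'o) \<Rightarrow> 'o \<Rightarrow> bool" where
  "resolves b c \<longleftrightarrow> angle_on b \<and> (\<forall>k \<le> d. b k \<in> \<A>) \<and> b (d + 1) = c"

lemma vanish:
  "\<lbrakk>x \<in> \<A>; y \<in> \<A>\<rbrakk> \<Longrightarrow> mor C x (fobj F y) = {\<zero>\<^bsub>Hom C x (fobj F y)\<^esub>}"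
  using tilting by (auto simp: cluster_tilting_def)

lemma resolution_resolves:
  assumes "is_resolution C d Angles T c t s"
  shows "resolves (\<lambda>k. if k \<le> d then t (d - k) else c) c"
proof -
  have s: "s \<in> Angles" "objs s = map t (rev [0..<Suc d]) @ [c]" "\<And>i. i \<le> d \<Longrightarrow> t i \<in> \<A>"
    using assms by (auto simp: is_resolution_def)
  have "objs s ! k = (if k \<le> d then t (d - k) else c)" if "k < d + 2" for k
    using that unfolding s(2) by (auto simp: nth_append rev_nth less_Suc_eq_le simp del: upt_Suc)
  then have "angle_on (\<lambda>k. if k \<le> d then t (d - k) else c)"
    using s(1) unfolding angle_on_def by blast
  then show ?thesis using s(3) by (simp add: resolves_def)
qed

lemma ex_resolves: "c \<in> Obj C \<Longrightarrow> \<exists>b. resolves b c"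
  using tilting resolution_resolves unfolding cluster_tilting_def by blast

lemma ex_resolution: "c \<in> Obj C \<Longrightarrow> \<exists>t s. is_resolution C d Angles T c t s"
  using tilting unfolding cluster_tilting_def by blast

section \<open>Relations from zero objects, isomorphisms and cones\<close>

text \<open>A zero object is the sum of two copies of itself, and the corresponding relation is
  minus its generator.\<close>

lemma relation_zero:
  assumes "zero_object C z"
  shows "frag_of z \<in> \<N>"
proof -
  have z: "z \<in> \<A>" using zero_object_in_add_closure[OF assms] .
  then have "is_sum C z z z" by (intro is_sum_zero iso_obj_refl add_closure_Obj assms)
  from K0_relations_minus[OF K0_relations_generator[OF z z z this]] show ?thesis by simp
qed

lemma relation_iso:
  assumes "iso_obj C x y" "x \<in> \<A>"
  shows "frag_of x - frag_of y \<in> \<N>"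
proof -
  obtain z where z: "zero_object C z" using ex_zero_object by blast
  have "frag_of y - (frag_of x + frag_of z) \<in> \<N>"
    by (rule K0_relations_generator[OF add_closure_iso[OF assms(2,1)] assms(2)
          zero_object_in_add_closure[OF z] is_sum_zero[OF assms(1) z]])
  from K0_relations_minus[OF K0_relations_add[OF this relation_zero[OF z]]] show ?thesis by simp
qed

text \<open>The numerical content of \<open>angle_on_cone\<close>, for any \<open>v\<close> that is
  additive modulo relations; it is used with both \<open>frag_of\<close> and
  \<open>ind\<close>.\<close>

lemma cone_alt_sum:
  assumes ends: "e 0 = b 0" "e (d + 1) = c d"
    and v: "\<And>k. \<lbrakk>1 \<le> k; k \<le> d\<rbrakk> \<Longrightarrow> v (e k) - (v (b k) + v (c (k - 1))) \<in> \<N>"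
  shows "alt_sum (d + 1) (\<lambda>k. v (e k)) - (alt_sum d (\<lambda>k. v (b k)) - alt_sum d (\<lambda>k. v (c k))) \<in> \<N>"
proof -
  \<comment> \<open>Padding by 0 lets the two end places, which have a single summand each, be
    treated like the others.\<close>
  let ?b = "\<lambda>k. if k \<le> d then v (b k) else 0" and ?c = "\<lambda>k. if k = 0 then 0 else v (c (k - 1))"
  have "v (e k) - (?b k + ?c k) \<in> \<N>" if "k \<le> d + 1" for k
  proof -
    have "k = 0 \<or> 1 \<le> k \<and> k \<le> d \<or> k = d + 1" using that by auto
    then consider "k = 0" | "1 \<le> k" "k \<le> d" | "k = d + 1" by blast
    then show ?thesis using ends v K0_relations_zero by cases auto
  qed
  then have "alt_sum (d + 1) (\<lambda>k. v (e k)) - alt_sum (d + 1) (\<lambda>k. ?b k + ?c k) \<in> \<N>"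
    by (rule alt_sum_relations)
  moreover have "alt_sum (d + 1) ?b = alt_sum d (\<lambda>k. v (b k))"
    using alt_sum_cong[of d ?b "\<lambda>k. v (b k)"] by (simp add: alt_sum_Suc)
  moreover have "alt_sum (d + 1) ?c = - alt_sum d (\<lambda>k. v (c k))" by (simp add: alt_sum_shift)
  ultimately show ?thesis by (simp add: alt_sum_add)
qed

lemma relation_sum:
  "\<lbrakk>a0 \<in> \<A>; a1 \<in> \<A>; is_sum C a a0 a1\<rbrakk> \<Longrightarrow> frag_of a - (frag_of a0 + frag_of a1) \<in> \<N>"
  by (rule K0_relations_generator[OF add_closure_sum])

text \<open>
  Coning off \<open>0 \<rightarrow> \<dots> \<rightarrow> 0 \<rightarrow> c\<^sup>d\<^sup>+\<^sup>1 = c\<^sup>d\<^sup>+\<^sup>1\<close> repeatedly collects the terms of even and of odd degree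
  in the last two places, until the angle is an isomorphism.
\<close>

lemma angle_in_tilting_alt_sum_from:
  assumes "j \<le> d"
  shows "\<forall>c. angle_on c \<and> (\<forall>k < d + 2. c k \<in> \<A>) \<and> (\<forall>k < j. zero_object C (c k)) \<longrightarrow>
    alt_sum (d + 1) (\<lambda>k. frag_of (c k)) \<in> \<N>"
  using assms
proof (induction j rule: inc_induct)
  case base
  show ?case
  proof (intro allI impI, elim conjE)
    fix c assume c: "angle_on c" "\<forall>k < d + 2. c k \<in> \<A>" "\<forall>k < d. zero_object C (c k)"
    obtain n where n: "d = Suc n" using d_pos by (cases d) auto
    \<comment> \<open>Only the last two objects can be nonzero, and they are isomorphic and carry
      opposite signs.\<close>
    have iso: "frag_of (c d) - frag_of (c (d + 1)) \<in> \<N>"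
      using relation_iso angle_on_zero_head[OF c(1)] c by simp
    have "alt_sum n (\<lambda>k. frag_of (c k)) \<in> \<N>"
      unfolding alt_sum_def using c(3) n
      by (intro K0_relations_sum K0_relations_sign relation_zero) auto
    from K0_relations_add[OF this K0_relations_sign[OF iso, of d]]
    show "alt_sum (d + 1) (\<lambda>k. frag_of (c k)) \<in> \<N>"
      by (cases "even n") (simp_all add: alt_sum_Suc n algebra_simps)
  qed
next
  case (step j)
  show ?case
  proof (intro allI impI, elim conjE)
    fix c assume c: "angle_on c" "\<forall>k < d + 2. c k \<in> \<A>" "\<forall>k < j. zero_object C (c k)"
    have cl: "c (d + 1) \<in> Obj C" using angle_on_obj[OF c(1)] by simp
    obtain b where b: "angle_on b" "\<forall>k < d. zero_object C (b k)" "b d = c (d + 1)" "b (d + 1) = c (d + 1)"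
      using angle_on_trivial[OF cl] by blast
    have bA: "b k \<in> \<A>" if "k \<le> d" for k
      using that b c(2) zero_object_in_add_closure by (cases "k = d") auto
    obtain e where e: "angle_on e" "e 0 = b 0" "e (d + 1) = c d"
      and es: "\<And>k. \<lbrakk>1 \<le> k; k \<le> d\<rbrakk> \<Longrightarrow> is_sum C (e k) (b k) (c (k - 1))"
      using angle_on_cone[OF b(1) c(1)] b(3,4) iso_obj_refl[OF cl] vanish[of "b d" "c 0"] bA[of d] c(2)
      by auto
    have eA: "e k \<in> \<A>" if "k < d + 2" for k
    proof -
      have "k = 0 \<or> 1 \<le> k \<and> k \<le> d \<or> k = d + 1" using that by auto
    then consider "k = 0" | "1 \<le> k" "k \<le> d" | "k = d + 1" by blast
      then show ?thesis
        using e bA c(2) add_closure_sum[OF _ _ es[of k]] by cases auto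
    qed
    \<comment> \<open>The cone moves the terms of \<open>c\<close> one place to the right and fills
      place 0 from \<open>b\<close>, so it has one more leading zero; this drives the descending
      induction.\<close>
    have ez: "zero_object C (e k)" if "k < Suc j" for k
    proof (cases "k = 0")
      case True
      then show ?thesis using e(2) b(2) d_pos by simp
    next
      case False
      then have "zero_object C (b k)" "zero_object C (c (k - 1))" using that step(2) b(2) c(3) by auto
      then show ?thesis using zero_object_sum[OF es[of k]] False that step(2) by simp
    qed
    have E: "alt_sum (d + 1) (\<lambda>k. frag_of (e k)) \<in> \<N>" using step(3) e(1) eA ez by blast
    obtain n where n: "d = Suc n" using d_pos by (cases d) auto
    have "alt_sum n (\<lambda>k. frag_of (b k)) \<in> \<N>"
      unfolding alt_sum_def using b(2) n
      by (intro K0_relations_sum K0_relations_sign relation_zero) auto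
    then have B: "alt_sum d (\<lambda>k. frag_of (b k)) - frag_cmul ((-1) ^ d) (frag_of (c (d + 1))) \<in> \<N>"
      using b(3) by (simp add: alt_sum_Suc n)
    have "alt_sum (d + 1) (\<lambda>k. frag_of (e k)) -
        (alt_sum d (\<lambda>k. frag_of (b k)) - alt_sum d (\<lambda>k. frag_of (c k))) \<in> \<N>"
      using e es relation_sum bA c(2) by (intro cone_alt_sum) auto
    \<comment> \<open>The alternating sum of \<open>e\<close> vanishes by induction, so those of
      \<open>b\<close> and \<open>c\<close> up to place \<open>d\<close> agree; the one for
      \<open>b\<close> has only the signed generator of the last object of \<open>c\<close>
      left.\<close>
    from K0_relations_add[OF K0_relations_diff[OF this E] B]
    have "alt_sum d (\<lambda>k. frag_of (c k)) - frag_cmul ((-1) ^ d) (frag_of (c (d + 1))) \<in> \<N>"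
      by (simp add: algebra_simps)
    then show "alt_sum (d + 1) (\<lambda>k. frag_of (c k)) \<in> \<N>"
      by (cases "even d") (simp_all add: alt_sum_Suc)
  qed
qed

lemma angle_in_tilting_alt_sum:
  assumes "angle_on c" "\<And>k. k < d + 2 \<Longrightarrow> c k \<in> \<A>"
  shows "alt_sum (d + 1) (\<lambda>k. frag_of (c k)) \<in> \<N>"
  using angle_in_tilting_alt_sum_from[of 0] assms by simp

text \<open>Stated for isomorphic rather than equal ends, since adding two resolutions determines
  the resolved object only up to isomorphism.\<close>

lemma resolves_alt_sum_unique:
  assumes "resolves b x" "resolves c y" "iso_obj C x y"
  shows "alt_sum d (\<lambda>k. frag_of (b k)) - alt_sum d (\<lambda>k. frag_of (c k)) \<in> \<N>"
proof -
  have b: "angle_on b" "\<And>k. k \<le> d \<Longrightarrow> b k \<in> \<A>" "b (d + 1) = x"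
    and c: "angle_on c" "\<And>k. k \<le> d \<Longrightarrow> c k \<in> \<A>" "c (d + 1) = y"
    using assms(1,2) by (auto simp: resolves_def)
  obtain e where e: "angle_on e" "e 0 = b 0" "e (d + 1) = c d"
    and es: "\<And>k. \<lbrakk>1 \<le> k; k \<le> d\<rbrakk> \<Longrightarrow> is_sum C (e k) (b k) (c (k - 1))"
    using angle_on_cone[OF b(1) c(1)] b c assms(3) vanish[of "b d" "c 0"] by auto
  have eA: "e k \<in> \<A>" if "k < d + 2" for k
  proof -
    have "k = 0 \<or> 1 \<le> k \<and> k \<le> d \<or> k = d + 1" using that by auto
    then consider "k = 0" | "1 \<le> k" "k \<le> d" | "k = d + 1" by blast
    then show ?thesis
      using e b c add_closure_sum[OF _ _ es[of k]] by cases auto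
  qed
  have "alt_sum (d + 1) (\<lambda>k. frag_of (e k)) -
      (alt_sum d (\<lambda>k. frag_of (b k)) - alt_sum d (\<lambda>k. frag_of (c k))) \<in> \<N>"
    using e es relation_sum b c by (intro cone_alt_sum) auto
  from K0_relations_diff[OF angle_in_tilting_alt_sum[OF e(1) eA] this] show ?thesis by simp
qed

section \<open>The index on representatives and its additivity\<close>

text \<open>A representative of the index in the free group, taken from an arbitrary resolution. It
  is meaningful only modulo \<open>\<N>\<close>, but as a function on objects it can be extended
  linearly by \<open>frag_extend\<close>.\<close>

definition ind :: "'o \<Rightarrow> 'o \<Rightarrow>\<^sub>0 int" where
  "ind c = frag_cmul ((-1) ^ d) (alt_sum d (\<lambda>k. frag_of ((SOME b. resolves b c) k)))"

lemma ex_ind: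
  assumes "c \<in> Obj C"
  shows "\<exists>b. resolves b c \<and> ind c = frag_cmul ((-1) ^ d) (alt_sum d (\<lambda>k. frag_of (b k)))"
  using someI_ex[OF ex_resolves[OF assms]] unfolding ind_def by blast

lemma ind_resolves:
  assumes "resolves b x" "iso_obj C x c"
  shows "frag_cmul ((-1) ^ d) (alt_sum d (\<lambda>k. frag_of (b k))) - ind c \<in> \<N>"
proof -
  obtain b' where b': "resolves b' c" "ind c = frag_cmul ((-1) ^ d) (alt_sum d (\<lambda>k. frag_of (b' k)))"
    using ex_ind[of c] assms(2) by (auto simp: iso_obj_def)
  show ?thesis
    using K0_relations_sign[OF resolves_alt_sum_unique[OF assms(1) b'(1) assms(2)], of d]
    unfolding b'(2) sign_diff .
qed

lemma keys_ind:
  assumes "c \<in> Obj C" shows "Poly_Mapping.keys (ind c) \<subseteq> \<A>"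
proof -
  obtain b where "resolves b c" "ind c = frag_cmul ((-1) ^ d) (alt_sum d (\<lambda>k. frag_of (b k)))"
    using ex_ind[OF assms] by blast
  then show ?thesis by (auto simp: resolves_def keys_frag_of intro!: keys_cmul_subset keys_alt_sum)
qed

text \<open>The sum of resolutions of \<open>a0\<close> and \<open>a1\<close> has its terms in
  add(T) again and resolves an object isomorphic to \<open>a\<close>.\<close>

lemma ind_sum:
  assumes "is_sum C a a0 a1"
  shows "ind a - (ind a0 + ind a1) \<in> \<N>"
proof -
  have o: "a \<in> Obj C" "a0 \<in> Obj C" "a1 \<in> Obj C" using is_sum_objs[OF assms] by auto
  obtain b where b: "resolves b a0" "ind a0 = frag_cmul ((-1) ^ d) (alt_sum d (\<lambda>k. frag_of (b k)))"
    using ex_ind[OF o(2)] by blast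
  obtain c where c: "resolves c a1" "ind a1 = frag_cmul ((-1) ^ d) (alt_sum d (\<lambda>k. frag_of (c k)))"
    using ex_ind[OF o(3)] by blast
  obtain e where e: "angle_on e" and es: "\<And>k. k < d + 2 \<Longrightarrow> is_sum C (e k) (b k) (c k)"
    using angle_on_sum[of b c] b(1) c(1) by (auto simp: resolves_def)
  have A: "b k \<in> \<A>" "c k \<in> \<A>" if "k \<le> d" for k using b(1) c(1) that by (auto simp: resolves_def)
  have "e k \<in> \<A>" if "k \<le> d" for k using add_closure_sum[OF A[OF that] es] that by simp
  then have e': "resolves e (e (d + 1))" using e by (simp add: resolves_def)
  have "is_sum C (e (d + 1)) a0 a1" using es[of "d + 1"] b(1) c(1) by (simp add: resolves_def)
  then have "iso_obj C (e (d + 1)) a" using is_sum_unique assms by blast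
  from ind_resolves[OF e' this]
  have 1: "frag_cmul ((-1) ^ d) (alt_sum d (\<lambda>k. frag_of (e k))) - ind a \<in> \<N>" .
  have "alt_sum d (\<lambda>k. frag_of (e k)) - alt_sum d (\<lambda>k. frag_of (b k) + frag_of (c k)) \<in> \<N>"
    using A es by (intro alt_sum_relations relation_sum) auto
  from K0_relations_sign[OF this, of d]
  have "frag_cmul ((-1) ^ d) (alt_sum d (\<lambda>k. frag_of (e k))) - (ind a0 + ind a1) \<in> \<N>"
    by (simp add: alt_sum_add sign_diff b(2) c(2) frag_cmul_distrib2)
  from K0_relations_diff[OF this 1] show ?thesis by (simp add: algebra_simps)
qed

text \<open>An object of add(T) is resolved by itself: the only term that counts stands at place
  \<open>d\<close>, where its sign cancels the prefactor in \<open>ind\<close>.\<close>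

lemma ind_tilting:
  assumes "t \<in> \<A>"
  shows "ind t - frag_of t \<in> \<N>"
proof -
  have t: "t \<in> Obj C" using add_closure_Obj[OF assms] .
  obtain b where b: "angle_on b" "\<forall>k < d. zero_object C (b k)" "b d = t" "b (d + 1) = t"
    using angle_on_trivial[OF t] by blast
  have "b k \<in> \<A>" if "k \<le> d" for k
    using that b assms zero_object_in_add_closure by (cases "k = d") auto
  then have "resolves b t" using b by (simp add: resolves_def)
  from ind_resolves[OF this iso_obj_refl[OF t]]
  have 1: "frag_cmul ((-1) ^ d) (alt_sum d (\<lambda>k. frag_of (b k))) - ind t \<in> \<N>" .
  obtain n where n: "d = Suc n" using d_pos by (cases d) auto
  have "alt_sum n (\<lambda>k. frag_of (b k)) \<in> \<N>"
    unfolding alt_sum_def using b(2) n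
    by (intro K0_relations_sum K0_relations_sign relation_zero) auto
  then have "alt_sum d (\<lambda>k. frag_of (b k)) - frag_cmul ((-1) ^ d) (frag_of t) \<in> \<N>"
    using b(3) by (simp add: alt_sum_Suc n)
  from K0_relations_sign[OF this, of d]
  have "frag_cmul ((-1) ^ d) (alt_sum d (\<lambda>k. frag_of (b k))) - frag_of t \<in> \<N>"
    by (simp only: sign_diff sign_sign)
  from K0_relations_diff[OF this 1] show ?thesis by simp
qed

text \<open>
  The index is additive on angles starting in \<open>add(T)\<close>: coning off a resolution of the last object
  moves one more of the objects into \<open>add(T)\<close>, and changes the sign of the alternating sum.
\<close>

lemma ind_angle_from:
  assumes "j \<le> d"
  shows "\<forall>c. angle_on c \<and> (\<forall>k \<le> j. c k \<in> \<A>) \<longrightarrow> alt_sum (d + 1) (\<lambda>k. ind (c k)) \<in> \<N>"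
  using assms
proof (induction j rule: inc_induct)
  case base
  show ?case
  proof (intro allI impI, elim conjE)
    fix c assume c: "angle_on c" "\<forall>k \<le> d. c k \<in> \<A>"
    \<comment> \<open>With all objects but the last in add(T), the angle is itself a resolution of
      its last object.\<close>
    then have r: "resolves c (c (d + 1))" by (simp add: resolves_def)
    have "iso_obj C (c (d + 1)) (c (d + 1))" using iso_obj_refl angle_on_obj[OF c(1)] by simp
    from K0_relations_sign[OF ind_resolves[OF r this], of d]
    have 1: "alt_sum d (\<lambda>k. frag_of (c k)) - frag_cmul ((-1) ^ d) (ind (c (d + 1))) \<in> \<N>"
      by (simp only: sign_diff sign_sign)
    have "alt_sum d (\<lambda>k. ind (c k)) - alt_sum d (\<lambda>k. frag_of (c k)) \<in> \<N>"
      using c(2) ind_tilting by (intro alt_sum_relations) auto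
    from K0_relations_trans[OF this 1]
    show "alt_sum (d + 1) (\<lambda>k. ind (c k)) \<in> \<N>" by (cases "even d") (simp_all add: alt_sum_Suc)
  qed
next
  case (step j)
  show ?case
  proof (intro allI impI, elim conjE)
    fix c assume c: "angle_on c" "\<forall>k \<le> j. c k \<in> \<A>"
    have cl: "c (d + 1) \<in> Obj C" using angle_on_obj[OF c(1)] by simp
    obtain b where b: "resolves b (c (d + 1))"
      and bi: "ind (c (d + 1)) = frag_cmul ((-1) ^ d) (alt_sum d (\<lambda>k. frag_of (b k)))"
      using ex_ind[OF cl] by blast
    have b': "angle_on b" "\<And>k. k \<le> d \<Longrightarrow> b k \<in> \<A>" "b (d + 1) = c (d + 1)"
      using b by (auto simp: resolves_def)
    \<comment> \<open>Coning is possible because \<open>b d\<close> and \<open>c 0\<close> both lie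
      in add(T), so there are no nonzero maps from \<open>b d\<close> to \<open>F\<close> of
      \<open>c 0\<close>.\<close>
    obtain e where e: "angle_on e" "e 0 = b 0" "e (d + 1) = c d"
      and es: "\<And>k. \<lbrakk>1 \<le> k; k \<le> d\<rbrakk> \<Longrightarrow> is_sum C (e k) (b k) (c (k - 1))"
      using angle_on_cone[OF b'(1) c(1)] b'(2,3) iso_obj_refl[OF cl] vanish[of "b d" "c 0"] c(2) by auto
    \<comment> \<open>The terms of \<open>c\<close> move one place right and are paired with terms
      of the resolution, which also fills place 0.\<close>
    have "e k \<in> \<A>" if "k \<le> Suc j" for k
      using that e(2) b'(2) c(2) add_closure_sum[OF _ _ es[of k]] step(2) by (cases "k = 0") auto
    then have E: "alt_sum (d + 1) (\<lambda>k. ind (e k)) \<in> \<N>" using step(3) e(1) by blast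
    have "alt_sum d (\<lambda>k. ind (b k)) - alt_sum d (\<lambda>k. frag_of (b k)) \<in> \<N>"
      using b'(2) ind_tilting by (intro alt_sum_relations) auto
    then have B: "alt_sum d (\<lambda>k. ind (b k)) - frag_cmul ((-1) ^ d) (ind (c (d + 1))) \<in> \<N>"
      unfolding bi sign_sign .
    have "alt_sum (d + 1) (\<lambda>k. ind (e k)) -
        (alt_sum d (\<lambda>k. ind (b k)) - alt_sum d (\<lambda>k. ind (c k))) \<in> \<N>"
      using e es ind_sum by (intro cone_alt_sum) auto
    from K0_relations_add[OF K0_relations_diff[OF this E] B]
    have "alt_sum d (\<lambda>k. ind (c k)) - frag_cmul ((-1) ^ d) (ind (c (d + 1))) \<in> \<N>"
      by (simp add: algebra_simps)
    then show "alt_sum (d + 1) (\<lambda>k. ind (c k)) \<in> \<N>"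
      by (cases "even d") (simp_all add: alt_sum_Suc)
  qed
qed

lemma ind_angle:
  "\<lbrakk>angle_on c; c 0 \<in> \<A>\<rbrakk> \<Longrightarrow> alt_sum (d + 1) (\<lambda>k. ind (c k)) \<in> \<N>"
  using ind_angle_from[of 0] by simp

text \<open>Resolves the \<open>THE\<close> in \<open>obj_index\<close>: every resolution yields the
  coset of \<open>ind c\<close>.\<close>

lemma obj_index_eq:
  assumes "c \<in> Obj C"
  shows "obj_index C d Angles T c = K0_coset C \<A> (ind c)"
proof -
  let ?S = "\<lambda>t. finprod (K0 C \<A>) (\<lambda>i. K0_class C \<A> (t i) [^]\<^bsub>K0 C \<A>\<^esub> ((-1) ^ i :: int)) {..d}"
  have *: "?S t = K0_coset C \<A> (ind c)" if r: "is_resolution C d Angles T c t s" for t s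
  proof -
    let ?b = "\<lambda>k. if k \<le> d then t (d - k) else c"
    have t: "t i \<in> \<A>" if "i \<le> d" for i using r that by (simp add: is_resolution_def)
    interpret K: comm_group "K0 C \<A>" by (rule comm_group_K0)
    have k: "Poly_Mapping.keys (frag_of (t i)) \<subseteq> \<A>" if "i \<le> d" for i
      using t[OF that] by (simp add: keys_frag_of)
    have "?S t = finprod (K0 C \<A>) (\<lambda>i. K0_coset C \<A> (frag_cmul ((-1) ^ i) (frag_of (t i)))) {..d}"
      using k keys_cmul_subset[OF k]
      by (intro K.finprod_cong') (auto simp: K0_class_def K0_coset_int_pow intro!: K0_coset_closed)
    also have "\<dots> = K0_coset C \<A> (alt_sum d (\<lambda>i. frag_of (t i)))"
      unfolding alt_sum_def using keys_cmul_subset[OF k] by (intro K0_coset_finprod) auto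
    finally have 1: "?S t = K0_coset C \<A> (alt_sum d (\<lambda>i. frag_of (t i)))" .
    have "alt_sum d (\<lambda>k. frag_of (?b k)) = alt_sum d (\<lambda>k. frag_of (t (d - k)))"
      by (rule alt_sum_cong) simp
    then have 2: "alt_sum d (\<lambda>i. frag_of (t i)) = frag_cmul ((-1) ^ d) (alt_sum d (\<lambda>k. frag_of (?b k)))"
      using alt_sum_rev[of d "\<lambda>i. frag_of (t i)"] by (simp add: sign_sign)
    have "alt_sum d (\<lambda>i. frag_of (t i)) - ind c \<in> \<N>"
      unfolding 2 by (rule ind_resolves[OF resolution_resolves[OF r] iso_obj_refl[OF assms]])
    then show ?thesis
      unfolding 1 using keys_alt_sum[OF k] keys_ind[OF assms] by (subst K0_coset_eq_iff) auto
  qed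
  then show ?thesis
    unfolding obj_index_def Let_def using ex_resolution[OF assms] by (intro the_equality) blast+
qed

lemma Ind_coset:
  assumes "Poly_Mapping.keys x \<subseteq> Obj C"
  shows "Ind C d Angles T (K0_coset C (Obj C) x) = K0_coset C \<A> (frag_extend ind x)"
  unfolding Ind_def
  by (rule K0_induced_coset) (use keys_ind obj_index_eq ind_sum assms in auto)

end

context angulated_category
begin

lemma K0_incl_coset:
  assumes "A \<subseteq> Obj C" "Poly_Mapping.keys x \<subseteq> A"
  shows "K0_incl C A (K0_coset C A x) = K0_coset C (Obj C) x"
proof -
  have "K0_incl C A (K0_coset C A x) = K0_coset C (Obj C) (frag_extend frag_of x)"
    unfolding K0_incl_def
    by (rule K0_induced_coset)
      (use assms in \<open>auto simp: keys_frag_of K0_class_def intro!: K0_relations_generator\<close>)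
  then show ?thesis by (simp flip: frag_expansion)
qed

lemma K0_shift_coset:
  assumes "Poly_Mapping.keys x \<subseteq> Obj C"
  shows "K0_shift C F (K0_coset C (Obj C) x) = K0_coset C (Obj C) (frag_extend (\<lambda>a. frag_of (fobj F a)) x)"
  unfolding K0_shift_def
  by (rule K0_induced_coset)
    (use assms in \<open>auto simp: keys_frag_of K0_class_def
      intro!: K0_relations_generator functor_is_sum[OF F_functor]\<close>)

end

section \<open>Two cluster tilting objects and the two composites\<close>

locale two_tilting = t: tilting C F d Angles T + u: tilting C F d Angles U
  for C :: "('o, 'm, 'k) category" (structure)
    and F :: "('o, 'm) endofunctor"
    and d :: nat
    and Angles :: "('o, 'm) sequence set"
    and T U :: 'o
begin

lemma ind_ind_shift:
  assumes "x \<in> add_closure C T"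
  shows "frag_cmul ((-1) ^ d) (frag_extend t.ind (u.ind (fobj F x))) - frag_of x
    \<in> K0_relations C (add_closure C T)"
proof -
  have x: "x \<in> Obj C" using t.add_closure_Obj[OF assms] .
  obtain b where b: "u.resolves b (fobj F x)"
    and i: "u.ind (fobj F x) = frag_cmul ((-1) ^ d) (alt_sum d (\<lambda>k. frag_of (b k)))"
    using u.ex_ind[of "fobj F x"] x by auto
  have "t.angle_on b" "b (d + 1) = fobj F x" using b by (auto simp: u.resolves_def)
  \<comment> \<open>Undoing one rotation brings the last object to the front as \<open>G\<close> of
    \<open>F x\<close>, which is \<open>x\<close> itself and lies in add(T).\<close>
  with t.angle_on_unrotate1[of b]
  have "t.angle_on (\<lambda>k. if k = 0 then x else b (k - 1))"
    using x by (auto elim!: t.angle_on_cong)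
  from t.ind_angle[OF this] assms
  have "t.ind x - alt_sum d (\<lambda>k. t.ind (b k)) \<in> K0_relations C (add_closure C T)"
    by (simp add: alt_sum_shift)
  from K0_relations_diff[OF t.ind_tilting[OF assms] this]
  have "alt_sum d (\<lambda>k. t.ind (b k)) - frag_of x \<in> K0_relations C (add_closure C T)" by simp
  then show ?thesis unfolding i by (simp add: frag_extend_cmul frag_extend_alt_sum sign_sign)
qed

lemma ind_shift_ind:
  assumes "x \<in> add_closure C U"
  shows "frag_cmul ((-1) ^ d) (frag_extend (\<lambda>a. u.ind (fobj F a)) (t.ind x)) - frag_of x
    \<in> K0_relations C (add_closure C U)"
proof -
  have x: "x \<in> Obj C" using t.add_closure_Obj[OF assms] .
  obtain b where b: "t.resolves b x"
    and i: "t.ind x = frag_cmul ((-1) ^ d) (alt_sum d (\<lambda>k. frag_of (b k)))"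
    using t.ex_ind[OF x] by auto
  have "t.angle_on b" "b (d + 1) = x" using b by (auto simp: t.resolves_def)
  \<comment> \<open>After \<open>d + 1\<close> rotations the last object \<open>x\<close> comes
    first without a shift, while every term of the resolution has picked up one
    \<open>F\<close>.\<close>
  with t.angle_on_rotate[of b "d + 1"]
  have "t.angle_on (\<lambda>k. if k = 0 then x else fobj F (b (k - 1)))"
    by (auto elim!: t.angle_on_cong)
  from u.ind_angle[OF this] assms
  have "u.ind x - alt_sum d (\<lambda>k. u.ind (fobj F (b k))) \<in> K0_relations C (add_closure C U)"
    by (simp add: alt_sum_shift)
  from K0_relations_diff[OF u.ind_tilting[OF assms] this]
  have "alt_sum d (\<lambda>k. u.ind (fobj F (b k))) - frag_of x \<in> K0_relations C (add_closure C U)" by simp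
  then show ?thesis unfolding i by (simp add: frag_extend_cmul frag_extend_alt_sum sign_sign)
qed

text \<open>The action of the first homomorphism of the theorem on representatives, see
  \<open>map_TU_coset\<close>; the group power there is a scalar multiple here.\<close>

definition lift_TU :: "('o \<Rightarrow>\<^sub>0 int) \<Rightarrow> ('o \<Rightarrow>\<^sub>0 int)" where
  "lift_TU x = frag_cmul ((-1) ^ d) (frag_extend (\<lambda>a. u.ind (fobj F a)) x)"

lemma keys_lift_TU:
  "Poly_Mapping.keys x \<subseteq> Obj C \<Longrightarrow> Poly_Mapping.keys (lift_TU x) \<subseteq> add_closure C U"
  unfolding lift_TU_def
  by (intro keys_cmul_subset keys_frag_extend_subset[of _ "Obj C"] u.keys_ind) auto

lemma keys_lift_UT:
  "Poly_Mapping.keys x \<subseteq> Obj C \<Longrightarrow> Poly_Mapping.keys (frag_extend t.ind x) \<subseteq> add_closure C T"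
  by (intro keys_frag_extend_subset[of _ "Obj C"] t.keys_ind) auto

lemma keys_add_closure: "Poly_Mapping.keys x \<subseteq> add_closure C V \<Longrightarrow> Poly_Mapping.keys x \<subseteq> Obj C"
  using t.add_closure_Obj by blast

lemma map_TU_coset:
  assumes "Poly_Mapping.keys x \<subseteq> add_closure C T"
  shows "Ind C d Angles U (K0_shift C F (K0_incl C (add_closure C T) (K0_coset C (add_closure C T) x)))
      [^]\<^bsub>K0 C (add_closure C U)\<^esub> ((-1) ^ d :: int) = K0_coset C (add_closure C U) (lift_TU x)"
proof -
  note k = keys_add_closure[OF assms]
  have k1: "Poly_Mapping.keys (frag_extend (\<lambda>a. frag_of (fobj F a)) x) \<subseteq> Obj C"
    by (rule keys_frag_extend_subset[OF k]) (auto simp: keys_frag_of)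
  have k2: "Poly_Mapping.keys (frag_extend (\<lambda>a. u.ind (fobj F a)) x) \<subseteq> add_closure C U"
    by (rule keys_frag_extend_subset[OF k]) (use u.keys_ind in auto)
  have "frag_extend u.ind (frag_extend (\<lambda>a. frag_of (fobj F a)) x) = frag_extend (\<lambda>a. u.ind (fobj F a)) x"
    using frag_extend_compose[of u.ind "fobj F" x] by (simp add: o_def)
  moreover have "K0_incl C (add_closure C T) (K0_coset C (add_closure C T) x) = K0_coset C (Obj C) x"
    using t.K0_incl_coset[OF _ assms] t.add_closure_Obj by blast
  ultimately show ?thesis
    using k k1 k2 by (simp add: t.K0_shift_coset u.Ind_coset K0_coset_int_pow lift_TU_def)
qed

lemma map_UT_coset:
  assumes "Poly_Mapping.keys x \<subseteq> add_closure C U"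
  shows "Ind C d Angles T (K0_incl C (add_closure C U) (K0_coset C (add_closure C U) x)) =
    K0_coset C (add_closure C T) (frag_extend t.ind x)"
proof -
  have "K0_incl C (add_closure C U) (K0_coset C (add_closure C U) x) = K0_coset C (Obj C) x"
    using t.K0_incl_coset[OF _ assms] t.add_closure_Obj by blast
  then show ?thesis using t.Ind_coset[OF keys_add_closure[OF assms]] by simp
qed

text \<open>Both sides are additive and the relations are closed under differences, so it is enough
  to check generators, where \<open>ind_ind_shift\<close> applies.\<close>

lemma lift_UT_TU:
  assumes "Poly_Mapping.keys x \<subseteq> add_closure C T"
  shows "frag_extend t.ind (lift_TU x) - x \<in> K0_relations C (add_closure C T)"
  using assms
proof (induction x rule: free_Abelian_group_induct[consumes 1])
  case 1
  then show ?case by (simp add: lift_TU_def K0_relations_zero)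
next
  case (2 x y)
  from K0_relations_diff[OF 2(3,4)] show ?case
    by (simp add: lift_TU_def frag_extend_diff sign_diff algebra_simps)
next
  case (3 a)
  then show ?case using ind_ind_shift[of a] by (simp add: lift_TU_def frag_extend_cmul)
qed

lemma lift_TU_UT:
  assumes "Poly_Mapping.keys x \<subseteq> add_closure C U"
  shows "lift_TU (frag_extend t.ind x) - x \<in> K0_relations C (add_closure C U)"
  using assms
proof (induction x rule: free_Abelian_group_induct[consumes 1])
  case 1
  then show ?case by (simp add: lift_TU_def K0_relations_zero)
next
  case (2 x y)
  from K0_relations_diff[OF 2(3,4)] show ?case
    by (simp add: lift_TU_def frag_extend_diff sign_diff algebra_simps)
next
  case (3 a)
  then show ?case using ind_shift_ind[of a] by (simp add: lift_TU_def)
qed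

lemma K0_isomorphisms:
  "group_isomorphisms (K0 C (add_closure C T)) (K0 C (add_closure C U))
     (\<lambda>x. Ind C d Angles U (K0_shift C F (K0_incl C (add_closure C T) x))
            [^]\<^bsub>K0 C (add_closure C U)\<^esub> ((-1) ^ d :: int))
     (\<lambda>y. Ind C d Angles T (K0_incl C (add_closure C U) y))"
proof -
  let ?f = "\<lambda>x. Ind C d Angles U (K0_shift C F (K0_incl C (add_closure C T) x))
            [^]\<^bsub>K0 C (add_closure C U)\<^esub> ((-1) ^ d :: int)"
  let ?g = "\<lambda>y. Ind C d Angles T (K0_incl C (add_closure C U) y)"
  have f: "?f \<in> hom (K0 C (add_closure C T)) (K0 C (add_closure C U))"
    using map_TU_coset keys_lift_TU[OF keys_add_closure]
    by (rule K0_hom_lift) (auto simp: lift_TU_def frag_extend_add frag_cmul_distrib2)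
  have g: "?g \<in> hom (K0 C (add_closure C U)) (K0 C (add_closure C T))"
    using map_UT_coset keys_lift_UT[OF keys_add_closure]
    by (rule K0_hom_lift) (auto simp: frag_extend_add)
  have gf: "?g (?f u) = u" if u: "u \<in> carrier (K0 C (add_closure C T))" for u
  proof -
    obtain x where x: "Poly_Mapping.keys x \<subseteq> add_closure C T" "u = K0_coset C (add_closure C T) x"
      using u by (auto simp: carrier_K0)
    note k = keys_lift_TU[OF keys_add_closure[OF x(1)]]
    have "?g (?f u) = K0_coset C (add_closure C T) (frag_extend t.ind (lift_TU x))"
      by (simp only: x(2) map_TU_coset[OF x(1)] map_UT_coset[OF k])
    also have "\<dots> = u"
      unfolding x(2) using K0_coset_eq_iff[OF keys_lift_UT[OF keys_add_closure[OF k]] x(1)] lift_UT_TU[OF x(1)]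
      by blast
    finally show ?thesis .
  qed
  have fg: "?f (?g u) = u" if u: "u \<in> carrier (K0 C (add_closure C U))" for u
  proof -
    obtain x where x: "Poly_Mapping.keys x \<subseteq> add_closure C U" "u = K0_coset C (add_closure C U) x"
      using u by (auto simp: carrier_K0)
    note k = keys_lift_UT[OF keys_add_closure[OF x(1)]]
    have "?f (?g u) = K0_coset C (add_closure C U) (lift_TU (frag_extend t.ind x))"
      by (simp only: x(2) map_UT_coset[OF x(1)] map_TU_coset[OF k])
    also have "\<dots> = u"
      unfolding x(2) using K0_coset_eq_iff[OF keys_lift_TU[OF keys_add_closure[OF k]] x(1)] lift_TU_UT[OF x(1)]
      by blast
    finally show ?thesis .
  qed
  show ?thesis unfolding group_isomorphisms_def using f g gf fg by blast
qed

end

theorem theoremA: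
  fixes K :: "('k, 'z) ring_scheme"
    and C :: "('o, 'm, 'k) category"
    and \<Sigma>d :: "('o, 'm) endofunctor"
    and d :: nat
    and Angles :: "('o, 'm) sequence set"
    and T U :: 'o
  assumes "algebraically_closed K"
    and "0 < d"
    and "angulated_category C \<Sigma>d d Angles"
    and "linear_category K C"
    and "hom_finite K C"
    and "krull_schmidt C"
    and "calabi_yau K C \<Sigma>d"
    and "cluster_tilting C \<Sigma>d d Angles T" and "basic_object C T"
    and "cluster_tilting C \<Sigma>d d Angles U" and "basic_object C U"
  shows "group_isomorphisms (K0 C (add_closure C T)) (K0 C (add_closure C U))
           (\<lambda>x. Ind C d Angles U (K0_shift C \<Sigma>d (K0_incl C (add_closure C T) x))
                  [^]\<^bsub>K0 C (add_closure C U)\<^esub> ((-1) ^ d :: int))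
           (\<lambda>y. Ind C d Angles T (K0_incl C (add_closure C U) y))"
proof -
  interpret two_tilting C \<Sigma>d d Angles T U
    using assms(3,8,10) by (intro two_tilting.intro tilting.intro tilting_axioms.intro)
  show ?thesis by (rule K0_isomorphisms)
qed

end
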